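(* Consider long-range first-passage percolation on $\mathbb{Z}^d$ (setting in the context) with a nonnegative non-increasing rate function $r(k)=k^{-\alpha}L(k)$, $k\ge1$, where $\alpha\in(d,2d)$ and $L$ is slowly varying at infinity with $L(1)=1$. Let $\Delta(\alpha,d)=\frac{\log2}{\log(2d/\alpha)}\in(1,\infty)$. Then for every $\varepsilon>0$: (1) $\displaystyle\lim_{\|x\|_1\to\infty}\mathbb{P}\Big(\Delta(\alpha,d)-\varepsilon\le\frac{\log T(0,x)}{\log\log\|x\|_1}\le\Delta(\alpha,d)+\varepsilon\Big)=1$; (2) $\displaystyle\lim_{t\to\infty}\mathbb{P}\Big(\Big|\frac{\log\log D_t}{\log t}-\frac1{\Delta(\alpha,d)}\Big|\le\varepsilon\Big)=1$.
   Context: Let $d\ge1$ and $\|x\|_1=\sum_i|x_i|$. Let $\mathcal{E}$ be the set of unordered pairs $e=\langle xy\rangle$ of distinct points of $\mathbb{Z}^d$, with length $\|e\|_1=\|x-y\|_1$. Let $(\omega_e)$ be i.i.d. mean-one exponential random variables and $W_e=\omega_e/r(\|e\|_1)$. For a finite path $\pi=\langle x_0\dots x_k\rangle$ ($x_i\ne x_{i-1}$), $W_\pi=\sum_iW_{\langle x_{i-1}x_i\rangle}$; $T(x,y)$ is the infimum of $W_\pi$ over finite paths from $x$ to $y$; $\mathcal{B}_t=\{x:T(0,x)\le t\}$ and $D_t=\sup\{\|x-y\|_1:x,y\in\mathcal{B}_t\}$. *)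

theory Defs
  imports "HOL-Probability.Probability"
begin

definition l1norm :: "int ^ 'd \<Rightarrow> int" where
  "l1norm x = (\<Sum>i\<in>UNIV. \<bar>x $ i\<bar>)"

definition lr_edges :: "(int ^ 'd) set set" where
  "lr_edges = {{x, y} | x y. x \<noteq> y}"

definition slowly_varying :: "(real \<Rightarrow> real) \<Rightarrow> bool" where
  "slowly_varying L \<longleftrightarrow> L \<in> borel_measurable borel \<and>
     (\<forall>x>0. L x > 0) \<and>
     (\<forall>lam>0. ((\<lambda>x. L (lam * x) / L x) \<longlongrightarrow> 1) at_top)"

definition edge_weight :: "(nat \<Rightarrow> real) \<Rightarrow> ((int ^ 'd) set \<Rightarrow> real) \<Rightarrow> int ^ 'd \<Rightarrow> int ^ 'd \<Rightarrow> real" where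
  "edge_weight r om a b = om {a, b} / r (nat (l1norm (a - b)))"

definition path_weight :: "(nat \<Rightarrow> real) \<Rightarrow> ((int ^ 'd) set \<Rightarrow> real) \<Rightarrow> (int ^ 'd) list \<Rightarrow> real" where
  "path_weight r om xs = sum_list (map (\<lambda>(a, b). edge_weight r om a b) (zip xs (tl xs)))"

definition is_path :: "(int ^ 'd) list \<Rightarrow> int ^ 'd \<Rightarrow> int ^ 'd \<Rightarrow> bool" where
  "is_path xs x y \<longleftrightarrow> xs \<noteq> [] \<and> hd xs = x \<and> last xs = y \<and>
     (\<forall>i. Suc i < length xs \<longrightarrow> xs ! i \<noteq> xs ! Suc i)"

definition passage_time :: "(nat \<Rightarrow> real) \<Rightarrow> ((int ^ 'd) set \<Rightarrow> real) \<Rightarrow> int ^ 'd \<Rightarrow> int ^ 'd \<Rightarrow> real" where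
  "passage_time r om x y = Inf {path_weight r om xs | xs. is_path xs x y}"

definition fpp_ball :: "(nat \<Rightarrow> real) \<Rightarrow> ((int ^ 'd) set \<Rightarrow> real) \<Rightarrow> real \<Rightarrow> (int ^ 'd) set" where
  "fpp_ball r om t = {x. passage_time r om 0 x \<le> t}"

definition fpp_diam :: "(nat \<Rightarrow> real) \<Rightarrow> ((int ^ 'd) set \<Rightarrow> real) \<Rightarrow> real \<Rightarrow> real" where
  "fpp_diam r om t = Sup {real_of_int (l1norm (x - y)) | x y. x \<in> fpp_ball r om t \<and> y \<in> fpp_ball r om t}"

end

theory Submission
  imports Defs "HOL-Real_Asymp.Real_Asymp"
begin

text \<open>
  Lower bound on passage times. Let \<open>g t\<close> be the expected size of a ball of radius \<open>t\<close>.
  A first moment estimate shows that a geodesic of weight at most \<open>t\<close> from \<open>0\<close> to \<open>x\<close> has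
  \<open>O(t + log |x|)\<close> steps, hence contains an edge \<open>{u, v}\<close> of length almost \<open>|x|\<close>. Exploring
  the ball around \<open>0\<close> until \<open>u\<close> is reached decouples the two remaining pieces of the geodesic, so that
  \<open>P(T(0,x) \<le> t)\<close> is at most \<open>|x| powr (-\<alpha> + o(1))\<close> times a power of \<open>t\<close> times
  \<open>max g(s) g(t + 1 - s)\<close>. Summing the minimum of \<open>1\<close> and this bound over \<open>x\<close> gives
  \<open>log g(t) \<le> C log t + (d/\<alpha> + o(1)) max (log g(s) + log g(t + 1 - s))\<close>, whose solutions grow at most like
  \<open>t powr (1/\<Delta> + o(1))\<close>.

  Upper bound on passage times. Two points at distance \<open>n\<close> are joined through a cheap edge between boxes of side
  \<open>n powr \<gamma>\<close>, \<open>\<alpha>/(2 d) < \<gamma> < 1\<close>, placed near the two points, and the two gaps are filled recursively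
  by shorter edges. The expected cost doubles at each of the \<open>log log n / log (1/\<gamma>)\<close> levels, which
  yields \<open>(log n) powr (\<Delta> + o(1))\<close>.
\<close>

section \<open>Suprema over countable sets and sums over the lattice\<close>

text \<open>The exponent arises from two dual computations. In the recursion for log g the trial
  solution t^\<beta> is reproduced with factor (d/\<alpha>) 2^(1-\<beta>), equal halves being the
  worst split; this is below 1 exactly when 2^\<beta> > 2d/\<alpha>, that is \<beta> > 1/\<Delta>.
  In the construction, boxes of side n^\<gamma> offer n^(2d\<gamma>) edges of rate about
  n^(-\<alpha>), which forces \<gamma> > \<alpha>/(2d), and costs that double per level stay below
  (log n)^\<kappa> when 2 \<gamma>^\<kappa> < 1; as \<gamma> approaches \<alpha>/(2d) this becomes
  \<kappa> > \<Delta>. The obstacle in the lower bound is that the two pieces of a geodesic are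
  disjoint but dependent. Summing over all candidates S for the explored ball replaces conditioning:
  the exploration of S, the long edge and the complement of S involve disjoint sets of edges. This
  needs finitely many S and existing geodesics, so it takes place in finite vertex sets A with
  constants independent of A, and the lattice is exhausted at the end. Rounding the time at which u
  is reached down to an integer produces the t + 1.\<close>

lemma not_bdd_above_Sup_real:
  fixes X :: "real set"
  assumes "\<not> bdd_above X"
  shows "Sup X = (LEAST z::real. False)"
proof -
  have "(\<lambda>z. \<forall>x\<in>X. x \<le> z) = (\<lambda>z. False)"
    using assms by (auto simp: bdd_above_def fun_eq_iff)
  then show ?thesis by (simp add: Sup_real_def)
qed

lemma borel_measurable_Sup_countable:
  fixes f :: "'i \<Rightarrow> real"
  assumes I: "countable I" and P: "\<And>i. i \<in> I \<Longrightarrow> {w \<in> space M. P i w} \<in> sets M"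
  shows "(\<lambda>w. Sup {f i | i. i \<in> I \<and> P i w}) \<in> borel_measurable M"
proof (rule borel_measurable_iff_greater[THEN iffD2, rule_format])
  fix a :: real
  let ?X = "\<lambda>w. {f i | i. i \<in> I \<and> P i w}"
  let ?c = "(LEAST z::real. False)"
  let ?U = "{w\<in>space M. \<forall>n::nat. \<exists>i\<in>I. P i w \<and> f i > real n}"
  let ?E = "{w\<in>space M. \<forall>i\<in>I. \<not> P i w}"
  let ?G = "{w\<in>space M. \<exists>i\<in>I. P i w \<and> a < f i}"
  have meas: "{w\<in>space M. P i w \<and> Q} \<in> sets M" if "i \<in> I" for i Q
    using P[OF that] by (cases Q) auto
  have 1: "?U \<in> sets M"
    by (intro sets.sets_Collect_countable_All sets.sets_Collect_countable_Ex' meas I)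
  have 2: "?E \<in> sets M"
    using sets.sets_Collect_neg[OF sets.sets_Collect_countable_Ex'[OF P I]] by simp
  have 3: "?G \<in> sets M"
    by (intro sets.sets_Collect_countable_Ex' meas I)
  have U: "w \<in> ?U \<longleftrightarrow> \<not> bdd_above (?X w)" if "w \<in> space M" for w
  proof -
    have "bdd_above (?X w) \<longleftrightarrow> (\<exists>n::nat. \<forall>i\<in>I. P i w \<longrightarrow> f i \<le> real n)"
    proof
      assume "bdd_above (?X w)"
      then obtain m where m: "\<And>i. i \<in> I \<Longrightarrow> P i w \<Longrightarrow> f i \<le> m"
        by (auto simp: bdd_above_def)
      obtain n :: nat where "m \<le> real n" using real_arch_simple by blast
      then have "\<forall>i\<in>I. P i w \<longrightarrow> f i \<le> real n" using m by (meson order_trans)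
      then show "\<exists>n::nat. \<forall>i\<in>I. P i w \<longrightarrow> f i \<le> real n" ..
    qed (auto simp: bdd_above_def)
    then show ?thesis using that by (auto simp: not_le)
  qed
  have "{w \<in> space M. a < Sup (?X w)} =
    (?U \<inter> {w. a < ?c}) \<union> (?E \<inter> {w. a < Sup {}}) \<union> (?G - ?U)"
  proof (intro set_eqI)
    fix w
    show "w \<in> {w \<in> space M. a < Sup (?X w)} \<longleftrightarrow>
      w \<in> (?U \<inter> {w. a < ?c}) \<union> (?E \<inter> {w. a < Sup {}}) \<union> (?G - ?U)"
    proof (cases "w \<in> space M")
      case w: True
      consider "\<not> bdd_above (?X w)" | "?X w = {}" | "bdd_above (?X w)" "?X w \<noteq> {}" by blast
      then show ?thesis
      proof cases
        case 1
        then have nE: "w \<notin> ?E" by auto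
        show ?thesis using 1 U[OF w] nE w not_bdd_above_Sup_real[OF 1] by auto
      next
        case 2
        have b: "bdd_above (?X w)" unfolding 2 by simp
        have s: "Sup (?X w) = Sup {}" unfolding 2 ..
        have E: "\<forall>i\<in>I. \<not> P i w" using 2 by blast
        have nU: "w \<notin> ?U" using U[OF w] b by blast
        show ?thesis using nU E w by (simp add: s)
      next
        case 3
        have "a < Sup (?X w) \<longleftrightarrow> (\<exists>i\<in>I. P i w \<and> a < f i)"
          using less_cSup_iff[OF 3(2,1)] by auto
        moreover have "w \<notin> ?E" using 3(2) by auto
        ultimately show ?thesis using U[OF w] 3(1) w by auto
      qed
    qed auto
  qed
  moreover have "?U \<inter> {w. a < ?c} \<in> sets M" using 1 by (cases "a < ?c") auto
  moreover have "?E \<inter> {w. a < Sup {}} \<in> sets M" using 2 by (cases "a < Sup {}") auto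
  ultimately show "{w \<in> space M. a < Sup (?X w)} \<in> sets M" using 1 3 by auto
qed

text \<open>Here the index set is fixed and the values are random. The only default value is that of
  sets unbounded below; it is \<open>- (LEAST z. False)\<close> because \<open>Inf\<close> is minus
  the \<open>Sup\<close> of the reflected set.\<close>

lemma borel_measurable_Inf_countable:
  fixes f :: "'i \<Rightarrow> 'w \<Rightarrow> real"
  assumes I: "countable I" "I \<noteq> {}" and f: "\<And>i. i \<in> I \<Longrightarrow> f i \<in> borel_measurable M"
  shows "(\<lambda>w. Inf {f i w | i. i \<in> I}) \<in> borel_measurable M"
proof (rule borel_measurable_iff_less[THEN iffD2, rule_format])
  fix a :: real
  let ?X = "\<lambda>w. {f i w | i. i \<in> I}"
  let ?c = "- (LEAST z::real. False)"
  let ?U = "{w\<in>space M. \<forall>n::nat. \<exists>i\<in>I. f i w < - real n}"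
  let ?G = "{w\<in>space M. \<exists>i\<in>I. f i w < a}"
  have meas: "{w\<in>space M. f i w < b} \<in> sets M" if "i \<in> I" for i b
    using f[OF that] by measurable
  have 1: "?U \<in> sets M"
    by (intro sets.sets_Collect_countable_All sets.sets_Collect_countable_Ex' meas I)
  have 3: "?G \<in> sets M"
    by (intro sets.sets_Collect_countable_Ex' meas I)
  have U: "w \<in> ?U \<longleftrightarrow> \<not> bdd_below (?X w)" if "w \<in> space M" for w
  proof -
    have "bdd_below (?X w) \<longleftrightarrow> (\<exists>n::nat. \<forall>i\<in>I. - real n \<le> f i w)"
    proof
      assume "bdd_below (?X w)"
      then obtain m where m: "\<And>i. i \<in> I \<Longrightarrow> m \<le> f i w"
        by (auto simp: bdd_below_def)
      obtain n :: nat where "- m \<le> real n" using real_arch_simple by blast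
      then have "\<forall>i\<in>I. - real n \<le> f i w" using m by (meson dual_order.trans minus_le_iff)
      then show "\<exists>n::nat. \<forall>i\<in>I. - real n \<le> f i w" ..
    qed (auto simp: bdd_below_def)
    then show ?thesis using that by (auto simp: not_le)
  qed
  have "{w \<in> space M. Inf (?X w) < a} = (?U \<inter> {w. ?c < a}) \<union> (?G - ?U)"
  proof (intro set_eqI)
    fix w
    show "w \<in> {w \<in> space M. Inf (?X w) < a} \<longleftrightarrow> w \<in> (?U \<inter> {w. ?c < a}) \<union> (?G - ?U)"
    proof (cases "w \<in> space M")
      case w: True
      have ne: "?X w \<noteq> {}" using I by auto
      show ?thesis
      proof (cases "bdd_below (?X w)")
        case True
        have "Inf (?X w) < a \<longleftrightarrow> (\<exists>i\<in>I. f i w < a)"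
          using cInf_less_iff[OF ne True] by auto
        then show ?thesis using U[OF w] True w by auto
      next
        case False
        then have "Inf (?X w) = ?c"
          unfolding Inf_real_def by (subst not_bdd_above_Sup_real) (use False in simp_all)
        then show ?thesis using U[OF w] False w by auto
      qed
    qed auto
  qed
  moreover have "?U \<inter> {w. ?c < a} \<in> sets M" using 1 by (cases "?c < a") auto
  ultimately show "{w \<in> space M. Inf (?X w) < a} \<in> sets M" using 1 3 by auto
qed

section \<open>The l1 norm and convergent power sums over the lattice\<close>

lemma l1norm_nonneg: "0 \<le> l1norm x"
  by (simp add: l1norm_def sum_nonneg)

lemma l1norm_eq_0_iff: "l1norm x = 0 \<longleftrightarrow> x = 0"
  by (simp add: l1norm_def sum_nonneg_eq_0_iff vec_eq_iff)

lemma l1norm_zero [simp]: "l1norm 0 = 0"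
  by (simp add: l1norm_eq_0_iff)

lemma l1norm_pos: "x \<noteq> y \<Longrightarrow> 1 \<le> l1norm (x - y)"
  using l1norm_nonneg[of "x - y"] l1norm_eq_0_iff[of "x - y"] by fastforce

lemma l1norm_minus [simp]: "l1norm (- x) = l1norm x"
  by (simp add: l1norm_def)

lemma l1norm_minus_commute: "l1norm (x - y) = l1norm (y - x)"
  using l1norm_minus[of "x - y"] by simp

lemma l1norm_add_le: "l1norm (x + y) \<le> l1norm x + l1norm y"
  by (simp add: l1norm_def sum.distrib[symmetric] sum_mono)

lemma l1norm_triangle: "l1norm (x - z) \<le> l1norm (x - y) + l1norm (y - z)"
  using l1norm_add_le[of "x - y" "y - z"] by simp

lemma component_le_l1norm: "\<bar>x $ i\<bar> \<le> l1norm x"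
  unfolding l1norm_def by (rule member_le_sum) auto

lemma finite_vec_box:
  fixes A :: "int set"
  assumes "finite A"
  shows "finite {x :: int ^ 'd. \<forall>i. x $ i \<in> A}"
proof -
  have "{x :: int ^ 'd. \<forall>i. x $ i \<in> A} \<subseteq> vec_lambda ` (PiE UNIV (\<lambda>_. A))"
  proof
    fix x :: "int ^ 'd" assume "x \<in> {x. \<forall>i. x $ i \<in> A}"
    then show "x \<in> vec_lambda ` (PiE UNIV (\<lambda>_. A))"
      by (intro image_eqI[where x="\<lambda>i. x $ i"]) auto
  qed
  then show ?thesis by (rule finite_subset) (intro finite_imageI finite_PiE; simp add: assms)
qed

lemma finite_l1norm_le: "finite {x :: int ^ 'd. l1norm x \<le> n}"
proof (rule finite_subset)
  show "{x :: int ^ 'd. l1norm x \<le> n} \<subseteq> {x. \<forall>i. x $ i \<in> {-n..n}}"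
  proof safe
    fix x :: "int ^ 'd" and i assume "l1norm x \<le> n"
    then show "x $ i \<in> {-n..n}" using component_le_l1norm[of x i] by auto
  qed
qed (rule finite_vec_box, simp)

lemma sum_int_powr_bounded:
  assumes "s > 1"
  obtains C where "C \<ge> 0" "\<And>n::nat. (\<Sum>k\<in>{-int n..int n}. max 1 (real_of_int \<bar>k\<bar>) powr (- s)) \<le> C"
proof -
  have sm: "summable (\<lambda>n. real n powr (- s))"
    using assms by (simp add: summable_real_powr_iff)
  let ?C = "1 + 2 * (\<Sum>n. real n powr (- s))"
  have "(\<Sum>k\<in>{-int n..int n}. max 1 (real_of_int \<bar>k\<bar>) powr (- s)) = 1 + 2 * (\<Sum>k\<in>{..n}. real k powr (-s))" for n
  proof (induction n)
    case (Suc n)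
    have "{-int (Suc n)..int (Suc n)} = insert (- int (Suc n)) (insert (int (Suc n)) {-int n..int n})"
      by auto
    then show ?case using Suc by (simp add: algebra_simps max_def)
  qed simp
  moreover have "(\<Sum>k\<in>{..n}. real k powr (-s)) \<le> (\<Sum>n. real n powr (- s))" for n
    by (rule sum_le_suminf[OF sm]) auto
  moreover have "0 \<le> ?C" using suminf_nonneg[OF sm] by simp
  ultimately show ?thesis by (intro that[of ?C]) auto
qed

text \<open>The bound \<open>\<Prod>i. max 1 \<bar>x\<^sub>i\<bar> \<le> (max 1 \<bar>x\<bar>)^d\<close> factorises the sum over the lattice.\<close>

lemma lattice_sum_bounded:
  assumes "s > real CARD('d)"
  obtains C where "C \<ge> 1" "\<And>F :: (int ^ 'd) set. finite F \<Longrightarrow>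
      (\<Sum>x\<in>F. max 1 (real_of_int (l1norm x)) powr (- s)) \<le> C"
proof -
  let ?d = "CARD('d)"
  have d: "real ?d > 0" by simp
  have "s / real ?d > 1" using assms d by (simp add: field_simps)
  then obtain C where C: "C \<ge> 0"
    "\<And>n::nat. (\<Sum>k\<in>{-int n..int n}. max 1 (real_of_int \<bar>k\<bar>) powr (- (s / real ?d))) \<le> C"
    using sum_int_powr_bounded by metis
  have s0: "s > 0" using assms d by linarith
  show ?thesis
  proof (rule that[of "max 1 (C ^ ?d)"])
    fix F :: "(int ^ 'd) set" assume F: "finite F"
    define g where "g k = max 1 (real_of_int \<bar>k\<bar>) powr (- (s / real ?d))" for k
    obtain n where n: "\<And>x. x \<in> F \<Longrightarrow> l1norm x \<le> int n"
    proof -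
      have "finite (l1norm ` F)" using F by simp
      then obtain m where "\<And>x. x \<in> F \<Longrightarrow> l1norm x \<le> m"
        by (meson bdd_above.E bdd_above_finite imageI)
      then show ?thesis using that[of "nat m"] by force
    qed
    have le: "max 1 (real_of_int (l1norm x)) powr (- s) \<le> (\<Prod>i\<in>UNIV. g (x $ i))" for x :: "int ^ 'd"
    proof -
      have "max 1 (real_of_int (l1norm x)) powr (- s) = (\<Prod>i\<in>(UNIV::'d set). max 1 (real_of_int (l1norm x)) powr (- (s / real ?d)))"
        using d by (simp add: powr_realpow[symmetric] powr_powr)
      also have "\<dots> \<le> (\<Prod>i\<in>UNIV. g (x $ i))"
      proof (intro prod_mono conjI)
        fix i
        have "max 1 (real_of_int \<bar>x $ i\<bar>) \<le> max 1 (real_of_int (l1norm x))"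
          using component_le_l1norm[of x i] by (intro max.mono) linarith+
        then show "max 1 (real_of_int (l1norm x)) powr (- (s / real ?d)) \<le> g (x $ i)"
          unfolding g_def using s0 d by (intro powr_mono2') auto
      qed auto
      finally show ?thesis .
    qed
    have "(\<Sum>x\<in>F. max 1 (real_of_int (l1norm x)) powr (- s)) \<le> (\<Sum>x\<in>F. \<Prod>i\<in>UNIV. g (x $ i))"
      by (intro sum_mono le)
    also have "\<dots> = (\<Sum>f\<in>(\<lambda>x i. x $ i) ` F. \<Prod>i\<in>UNIV. g (f i))"
      by (subst sum.reindex) (auto simp: inj_on_def vec_eq_iff fun_eq_iff)
    also have "\<dots> \<le> (\<Sum>f\<in>PiE (UNIV::'d set) (\<lambda>_. {-int n..int n}). \<Prod>i\<in>UNIV. g (f i))"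
    proof (rule sum_mono2)
      show "(\<lambda>x i. x $ i) ` F \<subseteq> PiE UNIV (\<lambda>_::'d. {-int n..int n})"
      proof safe
        fix x i assume "x \<in> F"
        then show "x $ i \<in> {-int n..int n}" using n[of x] component_le_l1norm[of x i] by auto
      qed auto
    qed (auto intro!: finite_PiE prod_nonneg simp: g_def)
    also have "\<dots> = (\<Prod>i\<in>(UNIV::'d set). \<Sum>k\<in>{-int n..int n}. g k)"
      by (rule prod_sum_PiE[symmetric]) auto
    also have "\<dots> = (\<Sum>k\<in>{-int n..int n}. g k) ^ ?d" by simp
    also have "\<dots> \<le> C ^ ?d"
      using C(2)[of n] by (intro power_mono sum_nonneg) (auto simp: g_def)
    finally show "(\<Sum>x\<in>F. max 1 (real_of_int (l1norm x)) powr (- s)) \<le> max 1 (C ^ ?d)" by simp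
  qed simp
qed

section \<open>The halving recursion and bounds on slowly varying rates\<close>

text \<open>Both powers are compared with the tangent line of x^\<beta> at the midpoint
  \<open>m\<close>, which is Young's inequality with weights \<beta> and 1 - \<beta>. In the sum the
  linear terms cancel.\<close>

lemma powr_add_powr_le:
  fixes a b \<beta> :: real
  assumes "0 < a" "0 < b" "0 < \<beta>" "\<beta> < 1"
  shows "a powr \<beta> + b powr \<beta> \<le> 2 powr (1 - \<beta>) * (a + b) powr \<beta>"
proof -
  define m where "m = (a + b) / 2"
  have m: "0 < m" using assms by (simp add: m_def)
  have *: "x powr \<beta> \<le> m powr \<beta> * (\<beta> * (x / m) + (1 - \<beta>))" if "0 < x" for x
  proof -
    have "(x / m) powr \<beta> * 1 powr (1 - \<beta>) \<le> \<beta> * (x / m) + (1 - \<beta>) * 1"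
      by (rule Youngs_inequality_0) (use assms m that in auto)
    then have "x powr \<beta> / m powr \<beta> \<le> \<beta> * (x / m) + (1 - \<beta>)"
      using m that by (simp add: powr_divide)
    then show ?thesis using m by (simp add: field_simps)
  qed
  have "a powr \<beta> + b powr \<beta> \<le> m powr \<beta> * (\<beta> * ((a + b) / m) + 2 * (1 - \<beta>))"
    using *[OF assms(1)] *[OF assms(2)] by (simp add: algebra_simps add_divide_distrib)
  also have "(a + b) / m = 2"
  proof -
    have "a + b = 2 * m" by (simp add: m_def)
    then show ?thesis using m by simp
  qed
  also have "m powr \<beta> * (\<beta> * 2 + 2 * (1 - \<beta>)) = 2 powr (1 - \<beta>) * (a + b) powr \<beta>"
    using assms by (simp add: m_def powr_divide powr_diff)
  finally show ?thesis .
qed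

text \<open>The maximum over \<open>i\<close> is handled by concavity of \<open>x\<^sup>\<beta>\<close> unless \<open>i \<in> {1, t}\<close>,
  where \<open>h t\<close> itself appears on the right and is absorbed because \<open>\<theta> < 1\<close>.\<close>

lemma halving_recursion_bound:
  fixes \<theta> \<beta> C :: real
  assumes \<theta>: "0 < \<theta>" "\<theta> < 1" and \<beta>: "0 < \<beta>" "\<beta> < 1" and q: "\<theta> * 2 powr (1 - \<beta>) < 1" and C: "0 \<le> C"
  shows "\<exists>B\<ge>0. \<forall>h :: nat \<Rightarrow> real. (\<forall>t\<ge>1. h t \<le> C * real t) \<longrightarrow>
      (\<forall>t\<ge>1. \<exists>i\<in>{1..t}. h t \<le> C + C * ln (real t) + \<theta> * (h i + h (t + 1 - i))) \<longrightarrow>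
      (\<forall>t\<ge>1. h t \<le> B * real t powr \<beta>)"
proof -
  define q where "q = \<theta> * 2 powr (1 - \<beta>)"
  have q1: "0 < q" "q < 1" using q \<theta> by (auto simp: q_def)
  have "((\<lambda>t::real. (C + C * ln t) / t powr \<beta>) \<longlongrightarrow> 0) at_top"
    using \<beta>(1) by real_asymp
  moreover have "((\<lambda>t::real. q * ((t + 1) powr \<beta> / t powr \<beta>)) \<longlongrightarrow> q * 1) at_top"
    by (rule tendsto_mult[OF tendsto_const]) (use \<beta> in real_asymp)
  ultimately have "((\<lambda>t::real. (C + C * ln t) / t powr \<beta> + q * ((t + 1) powr \<beta> / t powr \<beta>)) \<longlongrightarrow> 0 + q * 1) at_top"
    by (rule tendsto_add)
  \<comment> \<open>The gap between \<open>q\<close> and 1 absorbs the logarithmic term and the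
    excess of t + 1 over t. This serves the case 1 < i < t; \<open>ev2\<close> plays the same role
    for the extreme values of \<open>i\<close>, with the gap 1 - \<theta>.\<close>
  then have ev1: "eventually (\<lambda>t::real. (C + C * ln t) / t powr \<beta> + q * ((t + 1) powr \<beta> / t powr \<beta>) < 1) at_top"
    using q1 by (intro order_tendstoD(2)) auto
  have "((\<lambda>t::real. (C + C * ln t + \<theta> * C) / t powr \<beta>) \<longlongrightarrow> 0) at_top"
    using \<beta>(1) by real_asymp
  then have ev2: "eventually (\<lambda>t::real. (C + C * ln t + \<theta> * C) / t powr \<beta> < 1 - \<theta>) at_top"
    using \<theta> by (intro order_tendstoD(2)) auto
  from eventually_conj[OF ev1 ev2] obtain t0 :: real where t0: "\<And>t. t \<ge> t0 \<Longrightarrow>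
      (C + C * ln t) / t powr \<beta> + q * ((t + 1) powr \<beta> / t powr \<beta>) < 1 \<and>
      (C + C * ln t + \<theta> * C) / t powr \<beta> < 1 - \<theta>"
    unfolding eventually_at_top_linorder by auto
  define t1 where "t1 = nat \<lceil>max t0 1\<rceil>"
  have t1: "t0 \<le> real t1" "1 \<le> t1" unfolding t1_def by linarith+
  define B where "B = max 1 (C * real t1)"
  have B: "1 \<le> B" "C * real t1 \<le> B" by (auto simp: B_def)
  show ?thesis
  \<comment> \<open>\<open>B\<close> is fixed before \<open>h\<close>: later \<open>h\<close> runs
    through the logarithmic ball sizes of all finite vertex sets, and the bound has to be uniform in
    them. Below \<open>t1\<close> the linear hypothesis on \<open>h\<close> suffices.\<close>
  proof (intro exI[of _ B] conjI allI impI)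
    show "0 \<le> B" using B by simp
    fix h :: "nat \<Rightarrow> real" and t :: nat
    assume lin: "\<forall>t\<ge>1. h t \<le> C * real t"
      and rec: "\<forall>t\<ge>1. \<exists>i\<in>{1..t}. h t \<le> C + C * ln (real t) + \<theta> * (h i + h (t + 1 - i))"
    assume "1 \<le> t"
    then show "h t \<le> B * real t powr \<beta>"
    proof (induction t rule: less_induct)
      case (less t)
      have tp: "1 \<le> real t powr \<beta>" using less.prems \<beta> by (intro ge_one_powr_ge_zero) auto
      show ?case
      proof (cases "t < t1")
        case True
        have "h t \<le> C * real t" using lin less.prems by auto
        also have "\<dots> \<le> B" using True C B(2) by (meson mult_left_mono less_imp_le of_nat_mono order_trans)
        also have "\<dots> \<le> B * real t powr \<beta>" using tp B by simp
        finally show ?thesis .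
      next
        case False
        have "real t \<ge> t0" using False t1 by simp
        note big = t0[OF this]
        have tpos: "0 < real t powr \<beta>" using tp by linarith
        have "(C + C * ln (real t) + q * (real t + 1) powr \<beta>) / real t powr \<beta> < 1"
          using big by (simp add: add_divide_distrib)
        then have b1: "C + C * ln (real t) + q * (real t + 1) powr \<beta> < real t powr \<beta>"
          unfolding pos_divide_less_eq[OF tpos] by simp
        have b2: "C + C * ln (real t) + \<theta> * C < (1 - \<theta>) * real t powr \<beta>"
          using big unfolding pos_divide_less_eq[OF tpos] by simp
        have lnt: "0 \<le> C * ln (real t)" using C less.prems by simp
        obtain i where i: "1 \<le> i" "i \<le> t" and hi: "h t \<le> C + C * ln (real t) + \<theta> * (h i + h (t + 1 - i))"
          using rec less.prems by fastforce
        show ?thesis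
        proof (cases "i = 1 \<or> i = t")
          case True
          have "h i + h (t + 1 - i) = h 1 + h t" using True less.prems by auto
          also have "\<dots> \<le> C + h t" using lin by force
          finally have "\<theta> * (h i + h (t + 1 - i)) \<le> \<theta> * (C + h t)" using \<theta> by (intro mult_left_mono) auto
          then have "(1 - \<theta>) * h t \<le> C + C * ln (real t) + \<theta> * C"
            using hi by (simp add: algebra_simps)
          then have "(1 - \<theta>) * h t \<le> (1 - \<theta>) * real t powr \<beta>" using b2 by linarith
          then have "h t \<le> real t powr \<beta>" using \<theta> by simp
          also have "\<dots> \<le> B * real t powr \<beta>" using mult_right_mono[OF B(1), of "real t powr \<beta>"] tp by simp
          finally show ?thesis .
        next
          case False
          have "h i + h (t + 1 - i) \<le> B * real i powr \<beta> + B * real (t + 1 - i) powr \<beta>"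
            using i False by (intro add_mono less.IH) auto
          also have "\<dots> = B * (real i powr \<beta> + real (t + 1 - i) powr \<beta>)" by (simp add: algebra_simps)
          also have "\<dots> \<le> B * (2 powr (1 - \<beta>) * (real i + real (t + 1 - i)) powr \<beta>)"
            using i B \<beta> by (intro mult_left_mono powr_add_powr_le) auto
          also have "real i + real (t + 1 - i) = real t + 1" using i by (simp add: of_nat_diff)
          finally have "\<theta> * (h i + h (t + 1 - i)) \<le> \<theta> * (B * (2 powr (1 - \<beta>) * (real t + 1) powr \<beta>))"
            using \<theta> by (intro mult_left_mono) auto
          also have "\<dots> = B * (q * (real t + 1) powr \<beta>)" by (simp add: q_def)
          finally have "h t \<le> (C + C * ln (real t)) + B * (q * (real t + 1) powr \<beta>)" using hi by linarith
          also have "\<dots> \<le> B * (C + C * ln (real t)) + B * (q * (real t + 1) powr \<beta>)"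
            using B mult_right_mono[of 1 B "C + C * ln (real t)"] C lnt by simp
          also have "\<dots> = B * (C + C * ln (real t) + q * (real t + 1) powr \<beta>)" by (simp add: algebra_simps)
          also have "\<dots> \<le> B * real t powr \<beta>" using B b1 by (intro mult_left_mono) auto
          finally show ?thesis .
        qed
      qed
    qed
  qed
qed

section \<open>Power bounds for slowly varying rates\<close>

lemma geometric_bound:
  fixes R :: "nat \<Rightarrow> real"
  assumes q: "0 < q" and ev: "eventually (\<lambda>j. R (Suc j) \<le> q * R j) sequentially"
  shows "\<exists>C>0. \<forall>j. R j \<le> C * q ^ j"
proof -
  obtain m where m: "\<And>j. j \<ge> m \<Longrightarrow> R (Suc j) \<le> q * R j"
    using ev by (auto simp: eventually_sequentially)
  define C where "C = max 1 (Max ((\<lambda>j. R j / q ^ j) ` {..m}))"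
  have "R j / q ^ j \<le> C" for j
  proof (induction j)
    case 0
    show ?case unfolding C_def by (rule max.coboundedI2, rule Max_ge) (auto intro!: image_eqI[of _ _ 0])
  next
    case (Suc j)
    show ?case
    proof (cases "Suc j \<le> m")
      case True
      then show ?thesis unfolding C_def by (intro max.coboundedI2 Max_ge) (auto intro!: image_eqI[of _ _ "Suc j"])
    next
      case False
      then have "R (Suc j) \<le> q * R j" using m by simp
      then have "R (Suc j) / q ^ Suc j \<le> R j / q ^ j" using q by (simp add: field_simps)
      then show ?thesis using Suc by linarith
    qed
  qed
  then have "R j \<le> C * q ^ j" for j using q by (simp add: field_simps)
  then show ?thesis by (intro exI[of _ C]) (auto simp: C_def)
qed

lemma powr_ratio_bounds:
  fixes x s :: real
  assumes "1 / 2 \<le> x" "x \<le> 2"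
  shows "x powr s \<le> 2 powr \<bar>s\<bar>" and "2 powr (- \<bar>s\<bar>) \<le> x powr s"
proof -
  have "\<bar>ln x\<bar> \<le> ln 2"
    using assms ln_mono[of x 2] ln_mono[of "1/2" x] by (simp add: ln_div abs_le_iff)
  then have "\<bar>s * ln x\<bar> \<le> \<bar>s\<bar> * ln 2" by (simp add: abs_mult mult_left_mono)
  then show "x powr s \<le> 2 powr \<bar>s\<bar>" and "2 powr (- \<bar>s\<bar>) \<le> x powr s"
    using assms by (auto simp: powr_def abs_le_iff)
qed

lemma dyadic_bracket:
  assumes "1 \<le> (k::nat)"
  obtains j where "2 ^ j \<le> k" "k < 2 ^ Suc j"
    "1 / 2 \<le> 2 ^ j / real k" "2 ^ j / real k \<le> 2" "1 / 2 \<le> 2 ^ Suc j / real k" "2 ^ Suc j / real k \<le> 2"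
proof -
  obtain j where j: "2 ^ j \<le> k" "k < 2 ^ Suc j"
    using ex_power_ivl1[of 2 k] assms by auto
  define p where "p = real (2 ^ j)"
  have "p \<le> real k" "real k < 2 * p"
    unfolding p_def using j by (simp_all del: of_nat_power)
  moreover have "2 ^ j = p" "2 ^ Suc j = 2 * p" by (simp_all add: p_def)
  ultimately show ?thesis using assms
    by (intro that[of j] j) (simp_all only: \<open>2 ^ j = p\<close> \<open>2 ^ Suc j = 2 * p\<close>, simp_all add: field_simps)
qed

text \<open>Monotonicity of \<open>r\<close> replaces the uniform convergence theorem for slowly varying functions.\<close>

lemma slowly_varying_rate_bounds:
  fixes r :: "nat \<Rightarrow> real"
  assumes L: "slowly_varying L" and r: "\<forall>k\<ge>1. r k = real k powr (- \<alpha>) * L (real k)"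
    and mono: "\<forall>m n. 1 \<le> m \<longrightarrow> m \<le> n \<longrightarrow> r n \<le> r m" and \<eta>: "0 < \<eta>"
  shows "\<exists>C>0. \<forall>k\<ge>1. r k \<le> C * real k powr (\<eta> - \<alpha>)"
    and "\<exists>c>0. \<forall>k\<ge>1. c * real k powr (- \<eta> - \<alpha>) \<le> r k"
proof -
  have Lpos: "0 < L x" if "0 < x" for x using L that by (auto simp: slowly_varying_def)
  have rpos: "0 < r k" if "1 \<le> k" for k using r that Lpos by auto
  \<comment> \<open>Slow variation with factor 2 shows that the ratios
    \<open>R (Suc j) / R j\<close> tend to 2^(-\<alpha>), hence geometric bounds along powers of 2;
    monotonicity fills the dyadic gaps at the price of the constant
    \<open>2 powr \<bar>s\<bar>\<close>.\<close>
  define R where "R j = r (2 ^ j)" for j :: nat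
  have Rpos: "0 < R j" for j using rpos by (simp add: R_def)
  have "((\<lambda>x. L (2 * x) / L x) \<longlongrightarrow> 1) at_top" using L by (simp add: slowly_varying_def)
  moreover have "filterlim (\<lambda>j::nat. 2 ^ j :: real) at_top sequentially" by real_asymp
  ultimately have lim: "((\<lambda>j::nat. L (2 * 2 ^ j) / L (2 ^ j)) \<longlongrightarrow> 1) sequentially"
    by (rule filterlim_compose)
  have ratio: "R (Suc j) = 2 powr (- \<alpha>) * (L (2 * 2 ^ j) / L (2 ^ j)) * R j" for j
    using r Lpos[of "2 ^ j"] by (simp add: R_def powr_mult)
  have "eventually (\<lambda>j. L (2 * 2 ^ j) / L (2 ^ j) < 2 powr \<eta>) sequentially"
    by (rule order_tendstoD(2)[OF lim]) (use \<eta> in simp)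
  then have ev1: "eventually (\<lambda>j. R (Suc j) \<le> 2 powr (\<eta> - \<alpha>) * R j) sequentially"
  proof eventually_elim
    case (elim j)
    have "R (Suc j) \<le> 2 powr (- \<alpha>) * 2 powr \<eta> * R j"
      unfolding ratio using elim Rpos[of j] by (intro mult_right_mono mult_left_mono) auto
    then show ?case by (simp add: powr_add[symmetric])
  qed
  have "eventually (\<lambda>j. 2 powr (- \<eta>) < L (2 * 2 ^ j) / L (2 ^ j)) sequentially"
    by (rule order_tendstoD(1)[OF lim]) (use \<eta> in \<open>simp add: powr_minus field_simps\<close>)
  \<comment> \<open>Passing to reciprocals turns the lower bound on \<open>R\<close> into another
    application of \<open>geometric_bound\<close>.\<close>
  then have ev2: "eventually (\<lambda>j. 1 / R (Suc j) \<le> 2 powr (\<eta> + \<alpha>) * (1 / R j)) sequentially"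
  proof eventually_elim
    case (elim j)
    have "2 powr (- \<alpha>) * 2 powr (- \<eta>) * R j \<le> R (Suc j)"
      unfolding ratio using elim Rpos[of j] by (intro mult_right_mono mult_left_mono) auto
    then have "R j \<le> 2 powr (\<eta> + \<alpha>) * R (Suc j)"
      by (simp add: powr_add[symmetric]) (simp add: powr_diff powr_minus powr_add field_simps)
    then show ?case using Rpos[of j] Rpos[of "Suc j"] by (simp add: field_simps)
  qed
  have pw: "(2 powr s) ^ j = (2 ^ j) powr s" for s :: real and j :: nat
    by (simp add: powr_realpow[symmetric] powr_powr mult.commute)
  obtain C where C: "C > 0" "\<And>j. R j \<le> C * (2 ^ j) powr (\<eta> - \<alpha>)"
    using geometric_bound[OF _ ev1] unfolding pw by auto
  show "\<exists>C>0. \<forall>k\<ge>1. r k \<le> C * real k powr (\<eta> - \<alpha>)"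
  proof (intro exI conjI allI impI)
    show "0 < C * 2 powr \<bar>\<eta> - \<alpha>\<bar>" using C by simp
    fix k :: nat assume k: "1 \<le> k"
    obtain j where j: "2 ^ j \<le> k" "k < 2 ^ Suc j"
      and j': "1 / 2 \<le> 2 ^ j / real k" "2 ^ j / real k \<le> 2" "1 / 2 \<le> 2 ^ Suc j / real k" "2 ^ Suc j / real k \<le> 2"
      using dyadic_bracket[OF k] by blast
    have "r k \<le> R j" unfolding R_def using mono j by simp
    also have "\<dots> \<le> C * (2 ^ j) powr (\<eta> - \<alpha>)" by (rule C(2))
    also have "(2 ^ j) powr (\<eta> - \<alpha>) = (2 ^ j / real k) powr (\<eta> - \<alpha>) * real k powr (\<eta> - \<alpha>)"
      using k by (simp add: powr_mult[symmetric])
    also have "C * \<dots> \<le> C * (2 powr \<bar>\<eta> - \<alpha>\<bar> * real k powr (\<eta> - \<alpha>))"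
      by (intro mult_left_mono mult_right_mono powr_ratio_bounds j') (use C(1) in auto)
    finally show "r k \<le> C * 2 powr \<bar>\<eta> - \<alpha>\<bar> * real k powr (\<eta> - \<alpha>)" by (simp add: mult.assoc)
  qed
  obtain D where D: "D > 0" "\<And>j. 1 / R j \<le> D * (2 ^ j) powr (\<eta> + \<alpha>)"
    using geometric_bound[OF _ ev2] unfolding pw by auto
  have D': "(1 / D) * (2 ^ j) powr (- \<eta> - \<alpha>) \<le> R j" for j
    using D(2)[of j] D(1) Rpos[of j] by (simp add: powr_diff powr_minus powr_add field_simps)
  show "\<exists>c>0. \<forall>k\<ge>1. c * real k powr (- \<eta> - \<alpha>) \<le> r k"
  proof (intro exI conjI allI impI)
    let ?s = "- \<eta> - \<alpha>"
    show "0 < 1 / D * 2 powr (- \<bar>?s\<bar>)" using D by simp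
    fix k :: nat assume k: "1 \<le> k"
    obtain j where j: "2 ^ j \<le> k" "k < 2 ^ Suc j"
      and j': "1 / 2 \<le> 2 ^ j / real k" "2 ^ j / real k \<le> 2" "1 / 2 \<le> 2 ^ Suc j / real k" "2 ^ Suc j / real k \<le> 2"
      using dyadic_bracket[OF k] by blast
    have "1 / D * 2 powr (- \<bar>?s\<bar>) * real k powr ?s \<le> 1 / D * ((2 ^ Suc j / real k) powr ?s * real k powr ?s)"
      unfolding mult.assoc
      by (intro mult_left_mono mult_right_mono powr_ratio_bounds j') (use D(1) in auto)
    also have "(2 ^ Suc j / real k) powr ?s * real k powr ?s = (2 ^ Suc j) powr ?s"
      using k by (simp add: powr_mult[symmetric])
    also have "1 / D * \<dots> \<le> R (Suc j)" by (rule D')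
    also have "\<dots> \<le> r k" unfolding R_def using mono j k by (simp add: less_imp_le)
    finally show "1 / D * 2 powr (- \<bar>?s\<bar>) * real k powr ?s \<le> r k" .
  qed
qed

section \<open>Paths and geodesics\<close>

lemma is_path_single [simp]: "is_path [v] x y \<longleftrightarrow> v = x \<and> v = y"
  by (auto simp: is_path_def)

lemma not_is_path_Nil [simp]: "\<not> is_path [] x y"
  by (simp add: is_path_def)

lemma is_path_Cons2: "is_path (u # v # xs) x y \<longleftrightarrow> u = x \<and> u \<noteq> v \<and> is_path (v # xs) v y"
  by (auto simp: is_path_def nth_Cons split: nat.splits)

lemma is_path_hd: "is_path xs x y \<Longrightarrow> hd xs = x" and is_path_last: "is_path xs x y \<Longrightarrow> last xs = y"
  by (simp_all add: is_path_def)

lemma path_weight_single [simp]: "path_weight r om [v] = 0"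
  by (simp add: path_weight_def)

lemma path_weight_Cons2 [simp]:
  "path_weight r om (u # v # xs) = edge_weight r om u v + path_weight r om (v # xs)"
  by (simp add: path_weight_def)

lemma edge_weight_commute: "edge_weight r om a b = edge_weight r om b a"
  by (simp add: edge_weight_def insert_commute l1norm_minus_commute[of a b])

lemma path_weight_append:
  "path_weight r om (xs @ [v] @ ys) = path_weight r om (xs @ [v]) + path_weight r om (v # ys)"
proof (induction xs)
  case (Cons a xs)
  then show ?case by (cases xs) auto
qed simp

lemma path_weight_split:
  "path_weight r om (xs @ [u, v] @ ys) =
     path_weight r om (xs @ [u]) + edge_weight r om u v + path_weight r om (v # ys)"
  using path_weight_append[of r om xs u "v # ys"] by simp

lemma is_path_append:
  "is_path (xs @ [v] @ ys) x y \<longleftrightarrow> is_path (xs @ [v]) x v \<and> is_path (v # ys) v y"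
proof (induction xs arbitrary: x)
  case Nil
  then show ?case by (auto simp: is_path_def)
next
  case (Cons a xs)
  show ?case
  proof (cases xs)
    case Nil
    then show ?thesis by (auto simp: is_path_Cons2)
  next
    case (Cons b zs)
    then show ?thesis using Cons.IH[of b] by (auto simp: is_path_Cons2)
  qed
qed

lemma is_path_split:
  "is_path (xs @ [u, v] @ ys) x y \<longleftrightarrow> is_path (xs @ [u]) x u \<and> u \<noteq> v \<and> is_path (v # ys) v y"
  using is_path_append[of xs u "v # ys" x y] by (auto simp: is_path_Cons2)

lemma is_path_rev: "is_path xs x y \<Longrightarrow> is_path (rev xs) y x"
proof (induction xs arbitrary: x)
  case (Cons a xs)
  show ?case
  proof (cases xs)
    case Nil
    then show ?thesis using Cons by auto
  next
    case (Cons b zs)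
    then have p: "is_path (rev zs @ [b]) y b" "a = x" "a \<noteq> b"
      using Cons.IH[of b] Cons.prems by (auto simp: is_path_Cons2)
    have "is_path (rev zs @ [b, a] @ []) y a"
      unfolding is_path_split using p by (auto simp: is_path_def)
    then show ?thesis using p Cons by simp
  qed
qed simp

lemma path_weight_rev: "path_weight r om (rev xs) = path_weight r om xs"
proof (induction xs)
  case (Cons a xs)
  show ?case
  proof (cases xs)
    case (Cons b zs)
    then show ?thesis using Cons.IH path_weight_append[of r om "rev zs" b "[a]"]
      by (simp add: edge_weight_commute)
  qed simp
qed simp

definition edges_in :: "(int ^ 'd) set \<Rightarrow> (int ^ 'd) set set" where
  "edges_in A = {{x, y} | x y. x \<in> A \<and> y \<in> A \<and> x \<noteq> y}"

lemma edges_in_subset: "edges_in A \<subseteq> lr_edges"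
  by (auto simp: edges_in_def lr_edges_def)

text \<open>A single configuration with the properties that hold almost surely. The geometry of
  geodesics is deterministic and is developed here, away from the probability space.\<close>

locale positive_weights =
  fixes r :: "nat \<Rightarrow> real" and om :: "(int ^ 'd) set \<Rightarrow> real"
  assumes rate_pos: "\<And>k. 1 \<le> k \<Longrightarrow> 0 < r k"
    and om_pos: "\<And>e. e \<in> lr_edges \<Longrightarrow> 0 < om e"
begin

abbreviation "pw \<equiv> path_weight r om"

lemma edge_weight_pos: "a \<noteq> b \<Longrightarrow> 0 < edge_weight r om a b"
  unfolding edge_weight_def
  by (intro divide_pos_pos om_pos rate_pos) (use l1norm_pos[of a b] in \<open>auto simp: lr_edges_def\<close>)

lemma path_weight_nonneg: "is_path xs x y \<Longrightarrow> 0 \<le> pw xs"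
proof (induction xs arbitrary: x)
  case (Cons a xs)
  then show ?case
    by (cases xs) (auto simp: is_path_Cons2 intro!: add_nonneg_nonneg less_imp_le[OF edge_weight_pos])
qed simp

lemma path_weight_prefix_le: "is_path (xs @ [v] @ ys) x y \<Longrightarrow> pw (xs @ [v]) \<le> pw (xs @ [v] @ ys)"
  unfolding path_weight_append is_path_append using path_weight_nonneg by fastforce

text \<open>Removing a closed segment cannot increase a sum of positive weights. Minimising over
  paths in a finite set thus becomes a minimum over finitely many simple paths, and simple paths
  repeat no edge, so that their edge weights are independent.\<close>

lemma loop_erasure:
  "is_path xs x y \<Longrightarrow> \<exists>ys. is_path ys x y \<and> distinct ys \<and> set ys \<subseteq> set xs \<and> pw ys \<le> pw xs"
proof (induction "length xs" arbitrary: xs rule: less_induct)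
  case less
  show ?case
  proof (cases "distinct xs")
    case False
    then obtain as bs cs v where xs: "xs = as @ [v] @ bs @ [v] @ cs"
      by (meson not_distinct_decomp)
    have 1: "is_path (as @ [v]) x v" "is_path (v # bs @ [v] @ cs) v y"
      using less.prems unfolding xs is_path_append by auto
    have 2: "is_path ((v # bs) @ [v]) v v" "is_path (v # cs) v y"
      using 1(2) is_path_append[of "v # bs" v cs v y] by auto
    have 3: "is_path (as @ [v] @ cs) x y" using 1 2 is_path_append by blast
    have "pw (as @ [v] @ cs) \<le> pw xs"
      using path_weight_append[of r om as v cs] path_weight_append[of r om as v "bs @ [v] @ cs"]
        path_weight_append[of r om "v # bs" v cs] path_weight_nonneg[OF 2(1)]
      by (simp add: xs)
    moreover have "set (as @ [v] @ cs) \<subseteq> set xs" by (auto simp: xs)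
    ultimately show ?thesis using less.hyps[OF _ 3] by (fastforce simp: xs)
  qed (use less in auto)
qed

end

section \<open>Distances and balls inside a finite vertex set\<close>

definition simple_paths :: "(int ^ 'd) set \<Rightarrow> int ^ 'd \<Rightarrow> int ^ 'd \<Rightarrow> (int ^ 'd) list set" where
  "simple_paths A x y = {xs. is_path xs x y \<and> distinct xs \<and> set xs \<subseteq> A}"

lemma finite_simple_paths: "finite A \<Longrightarrow> finite (simple_paths A x y)"
  unfolding simple_paths_def
  by (rule finite_subset[OF _ finite_subset_distinct[of A]]) auto

text \<open>For finite \<open>A\<close> a minimum over a finite nonempty set of paths whenever both
  endpoints lie in \<open>A\<close>: it is attained, and it depends on the edges inside
  \<open>A\<close> alone.\<close>

definition fdist :: "(nat \<Rightarrow> real) \<Rightarrow> ((int ^ 'd) set \<Rightarrow> real) \<Rightarrow> (int ^ 'd) set \<Rightarrow> int ^ 'd \<Rightarrow> int ^ 'd \<Rightarrow> real" where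
  "fdist r om A x y = Min (path_weight r om ` simple_paths A x y)"

lemma simple_paths_nonempty: "x \<in> A \<Longrightarrow> y \<in> A \<Longrightarrow> simple_paths A x y \<noteq> {}"
proof (cases "x = y")
  case True
  then show "x \<in> A \<Longrightarrow> y \<in> A \<Longrightarrow> ?thesis"
    by (auto simp: simple_paths_def intro!: exI[of _ "[x]"])
next
  case False
  then show "x \<in> A \<Longrightarrow> y \<in> A \<Longrightarrow> ?thesis"
    by (auto simp: simple_paths_def is_path_Cons2 intro!: exI[of _ "[x, y]"])
qed

lemma fdist_attained:
  assumes "finite A" "x \<in> A" "y \<in> A"
  obtains xs where "xs \<in> simple_paths A x y" "path_weight r om xs = fdist r om A x y"
proof -
  have "fdist r om A x y \<in> path_weight r om ` simple_paths A x y"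
    unfolding fdist_def using finite_simple_paths[OF assms(1)] simple_paths_nonempty[OF assms(2,3)]
    by (intro Min_in) auto
  then show ?thesis using that by auto
qed

text \<open>Unlike \<open>fdist\<close> this is also meaningful for infinite \<open>A\<close>, where
  the infimum of the path weights need not be attained.\<close>

definition reach :: "(nat \<Rightarrow> real) \<Rightarrow> ((int ^ 'd) set \<Rightarrow> real) \<Rightarrow> (int ^ 'd) set \<Rightarrow> int ^ 'd \<Rightarrow> int ^ 'd \<Rightarrow> real \<Rightarrow> bool" where
  "reach r om A x y s \<longleftrightarrow> (\<exists>xs. is_path xs x y \<and> set xs \<subseteq> A \<and> path_weight r om xs \<le> s)"

lemma reach_commute: "reach r om A x y s \<longleftrightarrow> reach r om A y x s"
  unfolding reach_def by (metis is_path_rev path_weight_rev set_rev)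

lemma reach_mono: "reach r om A x y s \<Longrightarrow> A \<subseteq> B \<Longrightarrow> s \<le> t \<Longrightarrow> reach r om B x y t"
  unfolding reach_def by (meson order_trans)

text \<open>On positive weights \<open>frontier r om S A x u v j\<close> identifies \<open>S\<close> as the closed ball of \<open>A\<close>
  around \<open>x\<close> with \<open>u\<close> on its boundary. The pair \<open>(u, v)\<close> is exempted so that the event depends
  neither on the edge \<open>{u, v}\<close> nor on any edge inside \<open>A - S\<close>.\<close>

definition frontier :: "(nat \<Rightarrow> real) \<Rightarrow> ((int ^ 'd) set \<Rightarrow> real) \<Rightarrow> (int ^ 'd) set \<Rightarrow> (int ^ 'd) set \<Rightarrow>
    int ^ 'd \<Rightarrow> int ^ 'd \<Rightarrow> int ^ 'd \<Rightarrow> real \<Rightarrow> bool" where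
  "frontier r om S A x u v j \<longleftrightarrow>
     (\<forall>y\<in>S. fdist r om S x y \<le> fdist r om S x u) \<and>
     j \<le> fdist r om S x u \<and> fdist r om S x u < j + 1 \<and>
     (\<forall>y\<in>S. \<forall>z\<in>A - S. (y, z) \<noteq> (u, v) \<longrightarrow> fdist r om S x u < fdist r om S x y + edge_weight r om y z)"

context positive_weights
begin

abbreviation "D \<equiv> fdist r om"

lemma fdist_le:
  assumes "finite A" "is_path xs x y" "set xs \<subseteq> A"
  shows "D A x y \<le> pw xs"
proof -
  obtain ys where "is_path ys x y" "distinct ys" "set ys \<subseteq> set xs" "pw ys \<le> pw xs"
    using loop_erasure[OF assms(2)] by auto
  then have "ys \<in> simple_paths A x y" using assms by (auto simp: simple_paths_def)
  then have "D A x y \<le> pw ys"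
    unfolding fdist_def using finite_simple_paths[OF assms(1)] by (intro Min_le) auto
  then show ?thesis using \<open>pw ys \<le> pw xs\<close> by linarith
qed

lemma reach_iff_fdist:
  assumes "finite A" "x \<in> A" "y \<in> A"
  shows "reach r om A x y s \<longleftrightarrow> D A x y \<le> s"
proof
  assume "reach r om A x y s"
  then show "D A x y \<le> s" unfolding reach_def using fdist_le[OF assms(1)] by (meson order_trans)
next
  assume *: "D A x y \<le> s"
  obtain xs where "xs \<in> simple_paths A x y" "pw xs = D A x y"
    using fdist_attained[OF assms] by metis
  then show "reach r om A x y s" using * by (auto simp: reach_def simple_paths_def)
qed

lemma exit_edge:
  assumes "is_path xs x z" "x \<in> S" "z \<notin> S" "set xs \<subseteq> A"
  shows "\<exists>ys y z' zs. xs = ys @ [y, z'] @ zs \<and> set (ys @ [y]) \<subseteq> S \<and> z' \<in> A - S"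
  using assms
proof (induction xs arbitrary: x)
  case (Cons a xs)
  obtain b zs where xs: "xs = b # zs" using Cons.prems by (cases xs) auto
  have p: "is_path xs b z" "a = x" using Cons.prems xs by (auto simp: is_path_Cons2)
  show ?case
  proof (cases "b \<in> S")
    case True
    then obtain ys y z' zs' where "xs = ys @ [y, z'] @ zs'" "set (ys @ [y]) \<subseteq> S" "z' \<in> A - S"
      using Cons.IH[OF p(1)] Cons.prems by auto
    then show ?thesis using p Cons.prems by (intro exI[of _ "a # ys"] exI[of _ y] exI[of _ z'] exI[of _ zs']) auto
  next
    case False
    then show ?thesis using p Cons.prems xs
      by (intro exI[of _ "[]"] exI[of _ a] exI[of _ b] exI[of _ zs]) auto
  qed
qed simp

text \<open>A path from \<open>x\<close> that leaves \<open>S\<close> is heavier than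
  \<open>D S x u\<close>: its first exit is either an edge covered by the strict inequality in
  \<open>frontier\<close>, or the exempted pair, whose positive weight comes on top of the distance
  to \<open>u\<close>. Such paths cannot compete, so distances to \<open>u\<close> in
  \<open>S\<close> and \<open>A\<close> agree. In particular \<open>S\<close> is determined by the
  configuration and \<open>u\<close>, which makes the events for different \<open>S\<close>
  disjoint.\<close>

lemma frontierD:
  assumes fr: "frontier r om S A x u v j" and A: "finite A" "S \<subseteq> A" "x \<in> S" "u \<in> S" "v \<notin> S"
  shows "S = {y \<in> A. D A x y \<le> D A x u}" and "D A x u = D S x u"
proof -
  have fS: "finite S" using A finite_subset by blast
  have out: "D S x u < pw xs" if xs: "is_path xs x z" "set xs \<subseteq> A" "\<not> set xs \<subseteq> S" for xs z
  proof -
    obtain as z' bs where s1: "xs = as @ [z'] @ bs" "z' \<notin> S"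
      using xs(3) by (metis append_Cons append_Nil in_set_conv_decomp subsetI)
    have p1: "is_path (as @ [z']) x z'" using xs(1) unfolding s1 is_path_append by auto
    obtain ys y z2 zs where s2: "as @ [z'] = ys @ [y, z2] @ zs" "set (ys @ [y]) \<subseteq> S" "z2 \<in> A - S"
      using exit_edge[OF p1, of S A] s1 xs(2) A by auto
    have p2: "is_path (ys @ [y]) x y" "y \<noteq> z2" "is_path (z2 # zs) z2 z'"
      using p1 unfolding s2(1) is_path_split by auto
    have "D S x u < D S x y + edge_weight r om y z2"
    proof (cases "(y, z2) = (u, v)")
      case True
      then show ?thesis using edge_weight_pos[of u v] A by auto
    next
      case False
      then show ?thesis using fr s2 unfolding frontier_def by auto
    qed
    also have "\<dots> \<le> pw (ys @ [y]) + edge_weight r om y z2"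
      using fdist_le[OF fS p2(1) s2(2)] by simp
    also have "\<dots> \<le> pw (as @ [z'])"
      unfolding s2(1) path_weight_split using path_weight_nonneg[OF p2(3)] by simp
    also have "\<dots> \<le> pw xs" unfolding s1 using path_weight_prefix_le xs(1) s1 by metis
    finally show ?thesis .
  qed
  have le: "D A x y \<le> D S x y" if y: "y \<in> S" for y
  proof -
    obtain ys where "ys \<in> simple_paths S x y" "pw ys = D S x y"
      using fdist_attained[OF fS A(3) y] by metis
    then show ?thesis using fdist_le[OF A(1), of ys x y] A by (auto simp: simple_paths_def)
  qed
  show eq: "D A x u = D S x u"
  proof (rule antisym)
    obtain xs where xs: "xs \<in> simple_paths A x u" "pw xs = D A x u"
      using fdist_attained[OF A(1), of x u] A by (metis subsetD)
    show "D S x u \<le> D A x u"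
    proof (cases "set xs \<subseteq> S")
      case True
      then show ?thesis using xs fdist_le[OF fS, of xs x u] by (auto simp: simple_paths_def)
    next
      case False
      then show ?thesis using xs out[of xs u] by (auto simp: simple_paths_def)
    qed
  qed (use le A in auto)
  show "S = {y \<in> A. D A x y \<le> D A x u}"
  proof (intro set_eqI iffI)
    fix y assume "y \<in> S"
    then show "y \<in> {y \<in> A. D A x y \<le> D A x u}"
      using le[of y] fr A eq by (force simp: frontier_def)
  next
    fix y assume y: "y \<in> {y \<in> A. D A x y \<le> D A x u}"
    obtain xs where xs: "xs \<in> simple_paths A x y" "pw xs = D A x y"
      using fdist_attained[OF A(1), of x y] A y by (metis (no_types, lifting) mem_Collect_eq subsetD)
    show "y \<in> S"
    proof (rule ccontr)
      assume "y \<notin> S"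
      moreover have "y \<in> set xs" using xs by (auto simp: simple_paths_def is_path_def)
      ultimately have "\<not> set xs \<subseteq> S" by auto
      then show False using out[of xs y] xs y eq by (auto simp: simple_paths_def)
    qed
  qed
qed

text \<open>Geodesics to points of the ball stay in the ball because their prefixes are no heavier;
  hence distances measured in \<open>S\<close> and in \<open>A\<close> coincide there. Every point
  outside the ball is strictly farther than \<open>u\<close>, which gives the inequalities across
  the boundary.\<close>

lemma frontierI:
  assumes A: "finite A" "x \<in> A" "u \<in> A" and S: "S = {y \<in> A. D A x y \<le> D A x u}"
    and j: "j \<le> D A x u" "D A x u < j + 1" and xs: "x \<in> S"
  shows "frontier r om S A x u v j" and "\<forall>y\<in>S. D S x y = D A x y"
proof -
  have fS: "finite S" using A S by auto
  have SA: "S \<subseteq> A" using S by auto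
  show eq: "\<forall>y\<in>S. D S x y = D A x y"
  proof (intro ballI antisym)
    fix y assume y: "y \<in> S"
    obtain ps where ps: "ps \<in> simple_paths A x y" "pw ps = D A x y"
      using fdist_attained[OF A(1,2), of y] SA y by (metis subsetD)
    have "set ps \<subseteq> S"
    proof
      fix z assume "z \<in> set ps"
      then obtain as bs where s: "ps = as @ [z] @ bs"
        by (metis append_Cons append_Nil in_set_conv_decomp)
      have p: "is_path (as @ [z] @ bs) x y" "z \<in> A" using ps s by (auto simp: simple_paths_def)
      have "D A x z \<le> pw (as @ [z])"
        by (rule fdist_le[OF A(1)]) (use p(1) ps s in \<open>auto simp: simple_paths_def is_path_append[of as z bs, simplified]\<close>)
      also have "\<dots> \<le> D A x y" using path_weight_prefix_le[OF p(1)] ps s by simp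
      also have "\<dots> \<le> D A x u" using y S by auto
      finally show "z \<in> S" using S p by auto
    qed
    then show "D S x y \<le> D A x y"
      using fdist_le[OF fS, of ps x y] ps by (auto simp: simple_paths_def)
    obtain qs where "qs \<in> simple_paths S x y" "pw qs = D S x y"
      using fdist_attained[OF fS xs y] by metis
    then show "D A x y \<le> D S x y"
      using fdist_le[OF A(1), of qs x y] SA by (auto simp: simple_paths_def)
  qed
  have u: "u \<in> S" using A S by auto
  have far: "D S x u < D S x y + edge_weight r om y z" if y: "y \<in> S" and z: "z \<in> A - S" for y z
  proof -
    obtain ps where ps: "ps \<in> simple_paths A x y" "pw ps = D A x y"
      using fdist_attained[OF A(1,2), of y] SA y by (metis subsetD)
    obtain qs where qs: "ps = qs @ [y]" using ps
      by (auto simp: simple_paths_def is_path_def) (metis append_butlast_last_id)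
    have "is_path (qs @ [y, z] @ []) x z"
      unfolding is_path_split using ps qs y z by (auto simp: simple_paths_def)
    then have "D A x z \<le> pw (qs @ [y, z] @ [])"
      using fdist_le[OF A(1)] ps qs z by (auto simp: simple_paths_def)
    also have "\<dots> = D A x y + edge_weight r om y z"
      unfolding path_weight_split using ps qs by simp
    finally have "D A x z \<le> D A x y + edge_weight r om y z" .
    moreover have "D A x u < D A x z" using z S by auto
    ultimately show ?thesis using eq y u by simp
  qed
  show "frontier r om S A x u v j"
    unfolding frontier_def using far j eq u S by auto
qed

end

section \<open>Long edges and prefixes of geodesics\<close>

lemma path_l1norm_le:
  assumes "is_path xs x y" "0 \<le> q"
    and "\<And>ys u v zs. xs = ys @ [u, v] @ zs \<Longrightarrow> q * l1norm (u - v) \<le> c"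
  shows "q * l1norm (x - y) \<le> (int (length xs) - 1) * c"
  using assms
proof (induction xs arbitrary: x)
  case (Cons a xs)
  show ?case
  proof (cases xs)
    case Nil
    then show ?thesis using Cons.prems by auto
  next
    case (Cons b zs)
    then have p: "is_path xs b y" "a = x" using Cons.prems by (auto simp: is_path_Cons2)
    have "q * l1norm (u - v) \<le> c" if "xs = ys @ [u, v] @ zs" for ys u v zs
      by (rule Cons.prems(3)[of "a # ys" u v zs]) (use that in auto)
    then have "q * l1norm (b - y) \<le> (int (length xs) - 1) * c"
      using Cons.IH[OF p(1) assms(2)] by blast
    moreover have "q * l1norm (a - b) \<le> c"
      by (rule Cons.prems(3)[of "[]" a b zs]) (use Cons in auto)
    moreover have "q * l1norm (x - y) \<le> q * (l1norm (a - b) + l1norm (b - y))"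
      using assms(2) l1norm_triangle[of x y b] p by (intro mult_left_mono) auto
    ultimately show ?thesis by (simp add: algebra_simps)
  qed
qed simp

text \<open>Otherwise \<open>K\<close> times the length of each step is at most n - 1, where n is
  the distance of the endpoints, and at most K - 1 steps cannot cover n. Multiplying by
  \<open>K\<close> keeps the argument in the integers.\<close>

lemma path_long_edge:
  assumes "is_path xs x y" "length xs \<le> K" "x \<noteq> y"
  shows "\<exists>ys u v zs. xs = ys @ [u, v] @ zs \<and> l1norm (x - y) \<le> int K * l1norm (u - v)"
proof (rule ccontr)
  assume neg: "\<not> ?thesis"
  let ?n = "l1norm (x - y)"
  have n: "1 \<le> ?n" using l1norm_pos assms by auto
  have K: "int (length xs) - 1 \<le> int K - 1" "1 \<le> K"
    using assms by (auto simp: Suc_le_eq) (metis length_greater_0_conv not_is_path_Nil order_less_le_trans)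
  have "int K * ?n \<le> (int (length xs) - 1) * (?n - 1)"
    by (rule path_l1norm_le[OF assms(1)]) (use neg in force)+
  also have "\<dots> \<le> (int K - 1) * (?n - 1)"
    using K n by (intro mult_right_mono) auto
  also have "\<dots> < int K * ?n" using K n by (simp add: algebra_simps)
  finally show False by simp
qed

lemma (in positive_weights) geodesic_prefix:
  assumes A: "finite A" "is_path (as @ [z] @ bs) x y" "set (as @ [z] @ bs) \<subseteq> A"
    and geo: "pw (as @ [z] @ bs) = D A x y"
  shows "D A x z = pw (as @ [z])"
proof (rule antisym)
  have p: "is_path (as @ [z]) x z" "is_path (z # bs) z y" using A(2) unfolding is_path_append by auto
  show "D A x z \<le> pw (as @ [z])" using fdist_le[OF A(1) p(1)] A(3) by auto
  have "hd (as @ [z]) = x" using is_path_hd[OF p(1)] .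
  then have "x \<in> set (as @ [z])" by (metis list.set_sel(1) snoc_eq_iff_butlast)
  then have xA: "x \<in> A" "z \<in> A" using A(3) by auto
  obtain cs where cs: "cs \<in> simple_paths A x z" "pw cs = D A x z"
    using fdist_attained[OF A(1) xA] by metis
  then have q: "is_path cs x z" "set cs \<subseteq> A" by (auto simp: simple_paths_def)
  then have "cs \<noteq> []" "last cs = z" using is_path_last by auto
  then obtain ds where ds: "cs = ds @ [z]" by (metis append_butlast_last_id)
  have "is_path (ds @ [z] @ bs) x y" unfolding is_path_append using p q ds by auto
  then have "D A x y \<le> pw (ds @ [z] @ bs)" using fdist_le[OF A(1)] q A(3) ds by auto
  then show "pw (as @ [z]) \<le> D A x z"
    using geo cs ds unfolding path_weight_append[of r om as] path_weight_append[of r om ds] by simp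
qed

section \<open>Independence over disjoint sets of edges\<close>

text \<open>The slowly varying factor is represented by its power bounds \<open>rate_upper\<close>
  and \<open>rate_lower\<close>, with an arbitrarily small loss \<open>\<eta>\<close> in the
  exponent.\<close>

locale lr_percolation = prob_space M for M :: "'w measure" +
  fixes om :: "(int ^ 'd::finite) set \<Rightarrow> 'w \<Rightarrow> real" and r :: "nat \<Rightarrow> real" and \<alpha> :: real
  assumes indep: "indep_vars (\<lambda>_. borel) om lr_edges"
    and expo: "\<And>e. e \<in> lr_edges \<Longrightarrow> distributed M lborel (om e) (exponential_density 1)"
    and rate_pos: "\<And>k. 1 \<le> k \<Longrightarrow> 0 < r k"
    and rate_antimono: "\<And>m n. 1 \<le> m \<Longrightarrow> m \<le> n \<Longrightarrow> r n \<le> r m"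
    and alpha_gt: "real CARD('d) < \<alpha>" and alpha_less: "\<alpha> < 2 * real CARD('d)"
    and rate_upper: "\<And>\<eta>. 0 < \<eta> \<Longrightarrow> \<exists>C>0. \<forall>k\<ge>1. r k \<le> C * real k powr (\<eta> - \<alpha>)"
    and rate_lower: "\<And>\<eta>. 0 < \<eta> \<Longrightarrow> \<exists>c>0. \<forall>k\<ge>1. c * real k powr (- \<eta> - \<alpha>) \<le> r k"
begin

lemma alpha_pos: "0 < \<alpha>"
  using alpha_gt by (meson of_nat_0_le_iff order_le_less_trans)

abbreviation cfg :: "'w \<Rightarrow> (int ^ 'd) set \<Rightarrow> real" where
  "cfg w \<equiv> (\<lambda>e. om e w)"

text \<open>The sigma-algebra generated by the weights of the edges in \<open>K\<close>.
  Independence claims thereby reduce to disjointness of edge sets.\<close>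

definition Fil :: "(int ^ 'd) set set \<Rightarrow> 'w measure" where
  "Fil K = vimage_algebra (space M) (\<lambda>w. restrict (cfg w) K) (PiM K (\<lambda>_. borel))"

lemma space_Fil [simp]: "space (Fil K) = space M"
  by (simp add: Fil_def)

lemma om_Fil: "e \<in> K \<Longrightarrow> om e \<in> borel_measurable (Fil K)"
proof -
  assume e: "e \<in> K"
  have "(\<lambda>w. restrict (cfg w) K) \<in> measurable (Fil K) (PiM K (\<lambda>_. borel))"
    unfolding Fil_def by (rule measurable_vimage_algebra1) (auto simp: space_PiM)
  from measurable_compose[OF this measurable_component_singleton[OF e]]
  show ?thesis using e by simp
qed

lemma om_measurable: "e \<in> lr_edges \<Longrightarrow> om e \<in> borel_measurable M"
  using expo distributed_measurable by fastforce

lemma sets_Fil_mono: "K \<subseteq> K' \<Longrightarrow> sets (Fil K) \<subseteq> sets (Fil K')"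
  unfolding Fil_def[of K]
  by (intro sets_image_in_sets measurable_restrict) (auto intro: om_Fil)

lemma sets_Fil_subset: "K \<subseteq> lr_edges \<Longrightarrow> sets (Fil K) \<subseteq> sets M"
  unfolding Fil_def[of K]
  by (intro sets_image_in_sets measurable_restrict) (auto intro: om_measurable)

lemma measurable_Fil_mono: "f \<in> measurable (Fil K) N \<Longrightarrow> K \<subseteq> K' \<Longrightarrow> f \<in> measurable (Fil K') N"
  using sets_Fil_mono[of K K'] by (auto simp: measurable_def)

lemma measurable_Fil_M: "f \<in> measurable (Fil K) N \<Longrightarrow> K \<subseteq> lr_edges \<Longrightarrow> f \<in> measurable M N"
  using sets_Fil_subset[of K] by (auto simp: measurable_def)

lemma Fil_indep:
  assumes "K1 \<subseteq> lr_edges" "K2 \<subseteq> lr_edges" "K1 \<inter> K2 = {}" "A1 \<in> sets (Fil K1)" "A2 \<in> sets (Fil K2)"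
  shows "prob (A1 \<inter> A2) = prob A1 * prob A2"
proof -
  have ex: "\<exists>P\<in>sets (PiM K (\<lambda>_. borel)). A = (\<lambda>w. restrict (cfg w) K) -` P \<inter> space M"
    if "A \<in> sets (Fil K)" for A K
    using that unfolding Fil_def by (subst (asm) sets_vimage_algebra2) (auto simp: space_PiM)
  obtain P1 where P1: "P1 \<in> sets (PiM K1 (\<lambda>_. borel))" "A1 = (\<lambda>w. restrict (cfg w) K1) -` P1 \<inter> space M"
    using ex[OF assms(4)] by auto
  obtain P2 where P2: "P2 \<in> sets (PiM K2 (\<lambda>_. borel))" "A2 = (\<lambda>w. restrict (cfg w) K2) -` P2 \<inter> space M"
    using ex[OF assms(5)] by auto
  have "prob ((\<lambda>w. (restrict (cfg w) K1, restrict (cfg w) K2)) -` (P1 \<times> P2) \<inter> space M) = prob A1 * prob A2"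
    unfolding P1 P2 by (rule indep_varD[OF indep_var_restrict[OF indep assms(3,1,2)] P1(1) P2(1)])
  also have "(\<lambda>w. (restrict (cfg w) K1, restrict (cfg w) K2)) -` (P1 \<times> P2) \<inter> space M = A1 \<inter> A2"
    unfolding P1 P2 by auto
  finally show ?thesis .
qed

lemma Fil_indep_var:
  assumes K: "K1 \<subseteq> lr_edges" "K2 \<subseteq> lr_edges" "K1 \<inter> K2 = {}"
    and f: "f \<in> measurable (Fil K1) N1" and g: "g \<in> measurable (Fil K2) N2"
  shows "indep_var N1 f N2 g"
  unfolding indep_var_eq indep_sets2_eq
proof (intro conjI ballI)
  show "random_variable N1 f" "random_variable N2 g"
    using f g K measurable_Fil_M by blast+
  have sub: "sigma_sets (space M) {h -` A \<inter> space M |A. A \<in> sets N} \<subseteq> sets (Fil K)"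
    if "h \<in> measurable (Fil K) N" for h K and N :: "'z measure"
    using sets.sigma_sets_subset[of "{h -` A \<inter> space M |A. A \<in> sets N}" "Fil K"] measurable_sets[OF that]
    by auto
  show "sigma_sets (space M) {f -` A \<inter> space M |A. A \<in> sets N1} \<subseteq> events"
    using sub[OF f] sets_Fil_subset[OF K(1)] by blast
  show "sigma_sets (space M) {g -` A \<inter> space M |A. A \<in> sets N2} \<subseteq> events"
    using sub[OF g] sets_Fil_subset[OF K(2)] by blast
  fix a b assume "a \<in> sigma_sets (space M) {f -` A \<inter> space M |A. A \<in> sets N1}"
    "b \<in> sigma_sets (space M) {g -` A \<inter> space M |A. A \<in> sets N2}"
  then show "prob (a \<inter> b) = prob a * prob b"
    using Fil_indep[OF K] sub[OF f] sub[OF g] by blast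
qed

lemma Fil_nn_integral_mult:
  fixes f g :: "'w \<Rightarrow> ennreal"
  assumes K: "K1 \<subseteq> lr_edges" "K2 \<subseteq> lr_edges" "K1 \<inter> K2 = {}"
    and f: "f \<in> borel_measurable (Fil K1)" and g: "g \<in> borel_measurable (Fil K2)"
  shows "(\<integral>\<^sup>+w. f w * g w \<partial>M) = (\<integral>\<^sup>+w. f w \<partial>M) * (\<integral>\<^sup>+w. g w \<partial>M)"
proof -
  have "indep_vars (\<lambda>_. borel) (case_bool f g) UNIV"
    using Fil_indep_var[OF K f g] unfolding indep_var_def
    by (rule indep_vars_cong[THEN iffD1, rotated -1]) (auto split: bool.split)
  from indep_vars_nn_integral[OF _ this] show ?thesis
    by (simp add: UNIV_bool mult.commute)
qed

section \<open>The almost sure event of positive weights, and the edges on which path events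
  depend\<close>

definition good :: "'w set" where
  "good = {w \<in> space M. \<forall>e\<in>lr_edges. 0 < om e w}"

lemma AE_good: "AE w in M. w \<in> good"
proof -
  have "AE w in M. \<forall>e\<in>lr_edges. 0 < om e w"
  proof (rule AE_ball_countable'[rotated])
    show "countable (lr_edges :: (int ^ 'd) set set)"
    proof -
      have "lr_edges \<subseteq> (\<lambda>(x, y). {x, y}) ` (UNIV :: ((int ^ 'd) \<times> (int ^ 'd)) set)"
        by (auto simp: lr_edges_def)
      then show ?thesis by (rule countable_subset) auto
    qed
  next
    fix e :: "(int ^ 'd) set" assume e: "e \<in> lr_edges"
    have "prob {w \<in> space M. om e w \<le> 0} = 0"
      using exponential_distributedD_le[OF expo[OF e], of 0] by simp
    moreover have "{w \<in> space M. om e w \<le> 0} \<in> sets M"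
      using om_measurable[OF e] by measurable
    ultimately have "AE w in M. w \<notin> {w \<in> space M. om e w \<le> 0}"
      by (intro AE_not_in) (auto simp: null_sets_def emeasure_eq_measure)
    then show "AE w in M. 0 < om e w" by (auto simp: not_le elim!: AE_mp)
  qed
  then show ?thesis unfolding good_def by (auto elim!: AE_mp)
qed

lemma good_positive_weights: "w \<in> good \<Longrightarrow> positive_weights r (cfg w)"
  by unfold_locales (auto simp: good_def rate_pos)

lemma edge_weight_Fil [measurable]:
  "{a, b} \<in> K \<Longrightarrow> (\<lambda>w. edge_weight r (cfg w) a b) \<in> borel_measurable (Fil K)"
  unfolding edge_weight_def using om_Fil by measurable

lemma path_weight_Fil:
  "is_path xs x y \<Longrightarrow> set xs \<subseteq> A \<Longrightarrow> (\<lambda>w. path_weight r (cfg w) xs) \<in> borel_measurable (Fil (edges_in A))"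
proof (induction xs arbitrary: x)
  case (Cons a xs)
  show ?case
  proof (cases xs)
    case (Cons b zs)
    then have p: "is_path xs b y" "a \<noteq> b" using Cons.prems by (auto simp: is_path_Cons2)
    then have "{a, b} \<in> edges_in A" using Cons.prems Cons by (auto simp: edges_in_def)
    then show ?thesis using Cons.IH[OF p(1)] Cons.prems Cons by simp
  qed simp
qed simp

lemma fdist_Fil:
  assumes "finite S"
  shows "(\<lambda>w. fdist r (cfg w) S x y) \<in> borel_measurable (Fil (edges_in S))"
  unfolding fdist_def
  by (intro borel_measurable_Min finite_simple_paths assms path_weight_Fil[of _ x y]) (auto simp: simple_paths_def)

lemma reach_Fil: "{w \<in> space M. reach r (cfg w) A x y s} \<in> sets (Fil (edges_in A))"
proof -
  have "{w \<in> space M. reach r (cfg w) A x y s} =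
      (\<Union>xs\<in>{xs. is_path xs x y \<and> set xs \<subseteq> A}. {w \<in> space (Fil (edges_in A)). path_weight r (cfg w) xs \<le> s})"
    by (auto simp: reach_def)
  also have "\<dots> \<in> sets (Fil (edges_in A))"
  proof (intro sets.countable_UN'')
    show "countable {xs. is_path xs x y \<and> set xs \<subseteq> A}" by (rule countable_subset[OF subset_UNIV]) auto
    fix xs assume "xs \<in> {xs. is_path xs x y \<and> set xs \<subseteq> A}"
    then have [measurable]: "(\<lambda>w. path_weight r (cfg w) xs) \<in> borel_measurable (Fil (edges_in A))"
      by (auto intro: path_weight_Fil)
    show "{w \<in> space (Fil (edges_in A)). path_weight r (cfg w) xs \<le> s} \<in> sets (Fil (edges_in A))"
      by measurable
  qed
  finally show ?thesis .
qed

lemma reach_sets [measurable]: "{w \<in> space M. reach r (cfg w) A x y s} \<in> sets M"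
  using reach_Fil sets_Fil_subset[OF edges_in_subset] by blast

text \<open>The event reads edges inside \<open>S\<close> and edges from \<open>S\<close> to its
  complement, except \<open>{u, v}\<close>. Both \<open>{u, v}\<close> and the edges inside
  \<open>A - S\<close> therefore remain fresh after \<open>S\<close> has been explored.\<close>

lemma frontier_Fil:
  assumes "finite A" "S \<subseteq> A" "x \<in> S" "u \<in> S" "v \<in> A - S"
  shows "{w \<in> space M. frontier r (cfg w) S A x u v j} \<in> sets (Fil (edges_in A - edges_in (A - S) - {{u, v}}))"
    (is "_ \<in> sets ?F")
proof -
  have fS: "finite S" using assms finite_subset by blast
  have [measurable]: "(\<lambda>w. fdist r (cfg w) S x y) \<in> borel_measurable ?F" for y
    by (rule measurable_Fil_mono[OF fdist_Fil[OF fS]])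
       (use assms in \<open>auto simp: edges_in_def doubleton_eq_iff\<close>)
  have ew: "(\<lambda>w. edge_weight r (cfg w) y z) \<in> borel_measurable ?F"
    if "y \<in> S" "z \<in> A - S" "(y, z) \<noteq> (u, v)" for y z
    by (rule edge_weight_Fil) (use assms that in \<open>auto simp: edges_in_def doubleton_eq_iff\<close>)
  have far: "{w \<in> space ?F. (y, z) \<noteq> (u, v) \<longrightarrow>
      fdist r (cfg w) S x u < fdist r (cfg w) S x y + edge_weight r (cfg w) y z} \<in> sets ?F"
    if yz: "y \<in> S" "z \<in> A - S" for y z
  proof (cases "(y, z) = (u, v)")
    case False
    note [measurable] = ew[OF yz False]
    have "{w \<in> space ?F. fdist r (cfg w) S x u < fdist r (cfg w) S x y + edge_weight r (cfg w) y z} \<in> sets ?F"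
      by measurable
    then show ?thesis using False by simp
  next
    case True
    then have "{w \<in> space ?F. (y, z) \<noteq> (u, v) \<longrightarrow>
      fdist r (cfg w) S x u < fdist r (cfg w) S x y + edge_weight r (cfg w) y z} = space ?F" by simp
    then show ?thesis by (simp only: sets.top)
  qed
  have 1: "{w \<in> space ?F. \<forall>y\<in>S. fdist r (cfg w) S x y \<le> fdist r (cfg w) S x u} \<in> sets ?F"
    by (intro sets.sets_Collect_finite_All fS) measurable
  have 2: "{w \<in> space ?F. j \<le> fdist r (cfg w) S x u} \<in> sets ?F"
    "{w \<in> space ?F. fdist r (cfg w) S x u < j + 1} \<in> sets ?F"
    by measurable
  have 3: "{w \<in> space ?F. \<forall>y\<in>S. \<forall>z\<in>A - S. (y, z) \<noteq> (u, v) \<longrightarrow>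
      fdist r (cfg w) S x u < fdist r (cfg w) S x y + edge_weight r (cfg w) y z} \<in> sets ?F"
    by (intro sets.sets_Collect_finite_All fS finite_Diff assms(1) far)
  have "{w \<in> space ?F. frontier r (cfg w) S A x u v j} \<in> sets ?F"
    unfolding frontier_def by (intro sets.sets_Collect_conj 1 2 3)
  then show ?thesis by simp
qed

section \<open>First moment bounds\<close>

text \<open>An exponential variable of rate r has Laplace transform r / (r + \<theta>), and the r in
  the denominator is dropped. In the proof \<open>c\<close> is \<theta> / r.\<close>

lemma laplace_edge_weight:
  assumes "a \<noteq> b" "0 < \<theta>"
  shows "(\<integral>\<^sup>+w. ennreal (exp (- \<theta> * edge_weight r (cfg w) a b)) \<partial>M) \<le> ennreal (r (nat (l1norm (a - b))) / \<theta>)"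
proof -
  define c where "c = \<theta> / r (nat (l1norm (a - b)))"
  have r: "0 < r (nat (l1norm (a - b)))" using l1norm_pos[OF assms(1)] by (intro rate_pos) auto
  then have c: "0 < c" using assms by (simp add: c_def)
  have e: "{a, b} \<in> lr_edges" using assms by (auto simp: lr_edges_def)
  have "(\<integral>\<^sup>+w. ennreal (exp (- \<theta> * edge_weight r (cfg w) a b)) \<partial>M)
      = (\<integral>\<^sup>+w. ennreal (exp (- c * om {a, b} w)) \<partial>M)"
    by (simp add: edge_weight_def c_def)
  also have "\<dots> = (\<integral>\<^sup>+x. ennreal (exponential_density 1 x) * ennreal (exp (- c * x)) \<partial>lborel)"
    by (rule distributed_nn_integral[OF expo[OF e], symmetric]) simp
  also have "\<dots> = (\<integral>\<^sup>+x. ennreal (1 / (1 + c)) * ennreal (exponential_density (1 + c) x) \<partial>lborel)"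
  proof (intro nn_integral_cong)
    fix x :: real
    have "exp (- x) * exp (- c * x) = 1 / (1 + c) * ((1 + c) * exp (- x * (1 + c)))"
    proof -
      have "1 / (1 + c) * ((1 + c) * exp (- x * (1 + c))) = exp (- x * (1 + c))" using c by simp
      also have "\<dots> = exp (- x) * exp (- c * x)" by (simp add: exp_add[symmetric] algebra_simps)
      finally show ?thesis by simp
    qed
    then show "ennreal (exponential_density 1 x) * ennreal (exp (- c * x)) =
        ennreal (1 / (1 + c)) * ennreal (exponential_density (1 + c) x)"
      using c by (simp add: exponential_density_def ennreal_mult[symmetric])
  qed
  also have "\<dots> = ennreal (1 / (1 + c)) * (\<integral>\<^sup>+x. ennreal (exponential_density (1 + c) x) \<partial>lborel)"
    by (intro nn_integral_cmult) simp
  also have "(\<integral>\<^sup>+x. ennreal (exponential_density (1 + c) x) \<partial>lborel) = 1"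
    using prob_space.emeasure_space_1[OF prob_space_exponential_density[of "1 + c"]] c
    by (simp add: emeasure_density)
  also have "ennreal (1 / (1 + c)) * 1 \<le> ennreal (1 / c)"
    using c by (simp add: field_simps ennreal_leI)
  also have "1 / c = r (nat (l1norm (a - b))) / \<theta>" by (simp add: c_def)
  finally show ?thesis .
qed

text \<open>The value 0 on the diagonal allows sums over all lists of vertices: lists with a
  repeated consecutive vertex contribute nothing.\<close>

definition rho :: "int ^ 'd \<Rightarrow> int ^ 'd \<Rightarrow> real" where
  "rho a b = (if a = b then 0 else r (nat (l1norm (a - b))))"

lemma rho_nonneg: "0 \<le> rho a b"
  using rate_pos[of "nat (l1norm (a - b))"] l1norm_pos[of a b] by (auto simp: rho_def intro!: less_imp_le)

fun rate_prod :: "int ^ 'd \<Rightarrow> (int ^ 'd) list \<Rightarrow> real" where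
  "rate_prod a [] = 1"
| "rate_prod a (b # xs) = rho a b * rate_prod b xs"

lemma rate_prod_nonneg: "0 \<le> rate_prod a xs"
  by (induction xs arbitrary: a) (auto simp: rho_nonneg)

text \<open>The first vertex of a simple path does not recur, so the first edge is independent of
  the remaining path and the transforms multiply.\<close>

lemma laplace_path_weight:
  assumes "0 < \<theta>" "is_path (a # xs) a y" "distinct (a # xs)"
  shows "(\<integral>\<^sup>+w. ennreal (exp (- \<theta> * path_weight r (cfg w) (a # xs))) \<partial>M)
    \<le> ennreal (rate_prod a xs / \<theta> ^ length xs)"
  using assms(2,3)
proof (induction xs arbitrary: a)
  case Nil
  then show ?case by (simp add: emeasure_space_1)
next
  case (Cons b xs)
  then have p: "is_path (b # xs) b y" "a \<noteq> b" "distinct (b # xs)" "a \<notin> set (b # xs)"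
    by (auto simp: is_path_Cons2)
  let ?f = "\<lambda>w. ennreal (exp (- \<theta> * edge_weight r (cfg w) a b))"
  let ?g = "\<lambda>w. ennreal (exp (- \<theta> * path_weight r (cfg w) (b # xs)))"
  have [measurable]: "(\<lambda>w. edge_weight r (cfg w) a b) \<in> borel_measurable (Fil {{a, b}})"
    by (rule edge_weight_Fil) simp
  have [measurable]: "(\<lambda>w. path_weight r (cfg w) (b # xs)) \<in> borel_measurable (Fil (edges_in (set (b # xs))))"
    by (rule path_weight_Fil[OF p(1)]) simp
  have "(\<integral>\<^sup>+w. ennreal (exp (- \<theta> * path_weight r (cfg w) (a # b # xs))) \<partial>M) = (\<integral>\<^sup>+w. ?f w * ?g w \<partial>M)"
    by (simp add: ennreal_mult[symmetric] exp_add[symmetric] algebra_simps)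
  also have "\<dots> = (\<integral>\<^sup>+w. ?f w \<partial>M) * (\<integral>\<^sup>+w. ?g w \<partial>M)"
  proof (rule Fil_nn_integral_mult)
    show "{{a, b}} \<subseteq> lr_edges" using p by (auto simp: lr_edges_def)
    show "{{a, b}} \<inter> edges_in (set (b # xs)) = {}"
      using p by (auto simp: edges_in_def doubleton_eq_iff)
    show "?f \<in> borel_measurable (Fil {{a, b}})" by measurable
    show "?g \<in> borel_measurable (Fil (edges_in (set (b # xs))))" by measurable
  qed (rule edges_in_subset)
  also have "\<dots> \<le> ennreal (r (nat (l1norm (a - b))) / \<theta>) * ennreal (rate_prod b xs / \<theta> ^ length xs)"
    using laplace_edge_weight[OF p(2) assms(1)] Cons.IH[OF p(1,3)] by (intro mult_mono) auto
  also have "\<dots> = ennreal (rate_prod a (b # xs) / \<theta> ^ length (b # xs))"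
    using assms(1) p rate_prod_nonneg rho_nonneg[of a b]
    by (simp add: ennreal_mult[symmetric] rho_def)
  finally show ?case .
qed

lemma path_weight_measurable:
  "is_path xs x y \<Longrightarrow> (\<lambda>w. path_weight r (cfg w) xs) \<in> borel_measurable M"
  by (rule measurable_Fil_M[OF path_weight_Fil edges_in_subset]) auto

lemma prob_path_weight_le:
  assumes \<theta>: "0 < \<theta>" and p: "is_path (a # xs) a y" "distinct (a # xs)"
  shows "prob {w \<in> space M. path_weight r (cfg w) (a # xs) \<le> s} \<le> exp (\<theta> * s) * rate_prod a xs / \<theta> ^ length xs"
proof -
  let ?A = "{w \<in> space M. path_weight r (cfg w) (a # xs) \<le> s}"
  note [measurable] = path_weight_measurable[OF p(1)]
  have "ennreal (prob ?A) = (\<integral>\<^sup>+w. indicator ?A w \<partial>M)"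
    by (subst nn_integral_indicator) (measurable, simp add: emeasure_eq_measure)
  also have "\<dots> \<le> (\<integral>\<^sup>+w. ennreal (exp (\<theta> * s)) * ennreal (exp (- \<theta> * path_weight r (cfg w) (a # xs))) \<partial>M)"
    using \<theta> by (intro nn_integral_mono)
      (auto simp: indicator_def ennreal_mult[symmetric] exp_add[symmetric] simp flip: ennreal_1 intro!: ennreal_leI)
  also have "\<dots> = ennreal (exp (\<theta> * s)) * (\<integral>\<^sup>+w. ennreal (exp (- \<theta> * path_weight r (cfg w) (a # xs))) \<partial>M)"
    by (intro nn_integral_cmult) measurable
  also have "\<dots> \<le> ennreal (exp (\<theta> * s)) * ennreal (rate_prod a xs / \<theta> ^ length xs)"
    by (intro mult_left_mono laplace_path_weight[OF \<theta> p]) auto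
  also have "\<dots> = ennreal (exp (\<theta> * s) * rate_prod a xs / \<theta> ^ length xs)"
    using \<theta> rate_prod_nonneg by (simp add: ennreal_mult[symmetric])
  finally show ?thesis
    using \<theta> rate_prod_nonneg by (subst (asm) ennreal_le_iff) auto
qed

text \<open>Since \<alpha> exceeds the dimension, half of the excess can be lost in
  \<open>rate_upper\<close> and the rates out of a vertex remain summable. Translation makes the
  bound independent of the vertex.\<close>

lemma rate_sum_bounded: "\<exists>S\<ge>1. \<forall>A a. finite A \<longrightarrow> (\<Sum>b\<in>A. rho a b) \<le> S"
proof -
  define \<eta> where "\<eta> = (\<alpha> - real CARD('d)) / 2"
  have \<eta>: "0 < \<eta>" "\<alpha> - \<eta> > real CARD('d)" using alpha_gt by (auto simp: \<eta>_def field_simps)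
  obtain C where C: "C > 0" "\<And>k. k \<ge> 1 \<Longrightarrow> r k \<le> C * real k powr (\<eta> - \<alpha>)"
    using rate_upper[OF \<eta>(1)] by auto
  obtain C' where C': "C' \<ge> 1" "\<And>F :: (int ^ 'd) set. finite F \<Longrightarrow>
      (\<Sum>x\<in>F. max 1 (real_of_int (l1norm x)) powr (- (\<alpha> - \<eta>))) \<le> C'"
    using lattice_sum_bounded[OF \<eta>(2)] by metis
  have "(\<Sum>b\<in>A. rho a b) \<le> max 1 (C * C')" if A: "finite A" for A a
  proof -
    have "(\<Sum>b\<in>A. rho a b) \<le> (\<Sum>b\<in>A. C * max 1 (real_of_int (l1norm (a - b))) powr (- (\<alpha> - \<eta>)))"
    proof (intro sum_mono)
      fix b
      show "rho a b \<le> C * max 1 (real_of_int (l1norm (a - b))) powr (- (\<alpha> - \<eta>))"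
      proof (cases "a = b")
        case False
        have 1: "1 \<le> l1norm (a - b)" using l1norm_pos False by auto
        then have "real (nat (l1norm (a - b))) = max 1 (real_of_int (l1norm (a - b)))" by simp
        then show ?thesis using C(2)[of "nat (l1norm (a - b))"] 1 False by (simp add: rho_def)
      qed (use C in \<open>simp add: rho_def\<close>)
    qed
    also have "\<dots> = C * (\<Sum>x\<in>(\<lambda>b. a - b) ` A. max 1 (real_of_int (l1norm x)) powr (- (\<alpha> - \<eta>)))"
      by (subst sum.reindex) (auto simp: inj_on_def sum_distrib_left)
    also have "\<dots> \<le> C * C'"
      using C C'(2)[of "(\<lambda>b. a - b) ` A"] A by (intro mult_left_mono) auto
    finally show ?thesis by simp
  qed
  then show ?thesis by (intro exI[of _ "max 1 (C * C')"]) auto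
qed

definition rate_total :: real where
  "rate_total = (SOME S. S \<ge> 1 \<and> (\<forall>A a. finite A \<longrightarrow> (\<Sum>b\<in>A. rho a b) \<le> S))"

lemma rate_total: "rate_total \<ge> 1" "finite A \<Longrightarrow> (\<Sum>b\<in>A. rho a b) \<le> rate_total"
proof -
  have "rate_total \<ge> 1 \<and> (\<forall>A a. finite A \<longrightarrow> (\<Sum>b\<in>A. rho a b) \<le> rate_total)"
    unfolding rate_total_def by (rule someI_ex[OF rate_sum_bounded])
  then show "rate_total \<ge> 1" "finite A \<Longrightarrow> (\<Sum>b\<in>A. rho a b) \<le> rate_total" by auto
qed

lemma sum_rate_prod_le:
  assumes "finite A"
  shows "(\<Sum>xs | set xs \<subseteq> A \<and> length xs = k. rate_prod a xs) \<le> rate_total ^ k"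
proof (induction k arbitrary: a)
  case 0
  have "{xs. set xs \<subseteq> A \<and> length xs = 0} = {[]}" by auto
  then show ?case by simp
next
  case (Suc k)
  let ?L = "{xs. set xs \<subseteq> A \<and> length xs = k}"
  have L: "{xs. set xs \<subseteq> A \<and> length xs = Suc k} = (\<lambda>(b, xs). b # xs) ` (A \<times> ?L)"
    by (auto simp: length_Suc_conv image_iff)
  have "(\<Sum>xs | set xs \<subseteq> A \<and> length xs = Suc k. rate_prod a xs) = (\<Sum>(b, xs)\<in>A \<times> ?L. rho a b * rate_prod b xs)"
    unfolding L by (subst sum.reindex) (auto simp: inj_on_def intro!: sum.cong)
  also have "\<dots> = (\<Sum>b\<in>A. rho a b * (\<Sum>xs\<in>?L. rate_prod b xs))"
    by (simp add: sum.cartesian_product[symmetric] sum_distrib_left)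
  also have "\<dots> \<le> (\<Sum>b\<in>A. rho a b * rate_total ^ k)"
    by (intro sum_mono mult_left_mono Suc rho_nonneg)
  also have "\<dots> \<le> rate_total * rate_total ^ k"
    unfolding sum_distrib_right[symmetric] using rate_total assms
    by (intro mult_right_mono) auto
  finally show ?case by simp
qed

lemma simple_path_sets:
  assumes "xs \<in> simple_paths A x y"
  shows "{w \<in> space M. path_weight r (cfg w) xs \<le> s} \<in> sets M"
proof -
  have [measurable]: "(\<lambda>w. path_weight r (cfg w) xs) \<in> borel_measurable M"
    using path_weight_measurable[of xs x y] assms by (simp add: simple_paths_def)
  show ?thesis by measurable
qed

definition simple_from :: "(int ^ 'd) set \<Rightarrow> int ^ 'd \<Rightarrow> nat \<Rightarrow> (int ^ 'd) list set" where
  "simple_from A a k = {xs. xs \<in> simple_paths A a (last xs) \<and> length xs = Suc k}"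

lemma finite_simple_from: "finite A \<Longrightarrow> finite (simple_from A a k)"
  unfolding simple_from_def simple_paths_def
  by (rule finite_subset[OF _ finite_subset_distinct[of A]]) auto

text \<open>Exponential Markov inequality with \<theta> left free. The value
  \<open>2 * rate_total\<close> makes the bounds summable over \<open>k\<close>; the value
  \<open>exp 1 * rate_total\<close> gives the decay \<open>exp (- k)\<close> for paths with many
  steps.\<close>

lemma sum_prob_simple_from:
  assumes A: "finite A" and \<theta>: "0 < \<theta>"
  shows "(\<Sum>xs\<in>simple_from A a k. prob {w \<in> space M. path_weight r (cfg w) xs \<le> s})
    \<le> exp (\<theta> * s) * (rate_total / \<theta>) ^ k"
proof -
  have sf: "xs = a # tl xs" "set (tl xs) \<subseteq> A" "length (tl xs) = k" "is_path xs a (last xs)" "distinct xs"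
    if "xs \<in> simple_from A a k" for xs
  proof -
    have *: "is_path xs a (last xs)" "distinct xs" "set xs \<subseteq> A" "length xs = Suc k"
      using that by (simp_all add: simple_from_def simple_paths_def)
    have "xs \<noteq> []" using *(4) by auto
    then show "xs = a # tl xs" using is_path_hd[OF *(1)] by (metis list.collapse)
    show "set (tl xs) \<subseteq> A" using *(3) list.set_sel(2)[OF \<open>xs \<noteq> []\<close>] by (meson subset_iff)
    show "length (tl xs) = k" "is_path xs a (last xs)" "distinct xs" using * by simp_all
  qed
  have inj: "inj_on tl (simple_from A a k)"
    by (rule inj_onI) (metis sf(1))
  have "(\<Sum>xs\<in>simple_from A a k. prob {w \<in> space M. path_weight r (cfg w) xs \<le> s})
      \<le> (\<Sum>xs\<in>simple_from A a k. exp (\<theta> * s) * rate_prod a (tl xs) / \<theta> ^ k)"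
  proof (rule sum_mono)
    fix xs assume "xs \<in> simple_from A a k"
    note xs = sf[OF this]
    have "is_path (a # tl xs) a (last xs)" "distinct (a # tl xs)" using xs(4,5) unfolding xs(1)[symmetric] .
    from prob_path_weight_le[OF \<theta> this, of s] show "prob {w \<in> space M. path_weight r (cfg w) xs \<le> s} \<le> exp (\<theta> * s) * rate_prod a (tl xs) / \<theta> ^ k"
      unfolding xs(1)[symmetric] xs(3) .
  qed
  also have "\<dots> = exp (\<theta> * s) / \<theta> ^ k * (\<Sum>xs\<in>simple_from A a k. rate_prod a (tl xs))"
    by (simp add: sum_distrib_left)
  also have "\<dots> \<le> exp (\<theta> * s) / \<theta> ^ k * rate_total ^ k"
  proof (rule mult_left_mono)
    have "(\<Sum>xs\<in>simple_from A a k. rate_prod a (tl xs)) = (\<Sum>ys\<in>tl ` simple_from A a k. rate_prod a ys)"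
      by (simp add: sum.reindex inj)
    also have "\<dots> \<le> (\<Sum>xs | set xs \<subseteq> A \<and> length xs = k. rate_prod a xs)"
      by (intro sum_mono2 finite_lists_length_eq A rate_prod_nonneg) (use sf in auto)
    also have "\<dots> \<le> rate_total ^ k" by (rule sum_rate_prod_le[OF A])
    finally show "(\<Sum>xs\<in>simple_from A a k. rate_prod a (tl xs)) \<le> rate_total ^ k" .
  qed (use \<theta> in auto)
  finally show ?thesis by (simp add: power_divide)
qed

definition p_reach :: "(int ^ 'd) set \<Rightarrow> int ^ 'd \<Rightarrow> int ^ 'd \<Rightarrow> real \<Rightarrow> real" where
  "p_reach A x y s = prob {w \<in> space M. reach r (cfg w) A x y s}"

lemma p_reach_commute: "p_reach A x y s = p_reach A y x s"
  unfolding p_reach_def by (subst reach_commute) simp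

lemma p_reach_mono: "A \<subseteq> B \<Longrightarrow> s \<le> t \<Longrightarrow> p_reach A x y s \<le> p_reach B x y t"
  unfolding p_reach_def by (intro finite_measure_mono) (auto intro: reach_mono)

lemma p_reach_bounds: "0 \<le> p_reach A x y s" "p_reach A x y s \<le> 1"
  by (auto simp: p_reach_def)

lemma prob_le_of_good:
  assumes "B \<in> sets M" "\<And>w. w \<in> A \<Longrightarrow> w \<in> good \<Longrightarrow> w \<in> B" "A \<subseteq> space M"
  shows "prob A \<le> prob B"
  by (rule finite_measure_mono_AE) (use AE_good assms in \<open>auto elim!: AE_mp\<close>)

text \<open>The crude exponential bound on ball sizes. It supplies the linear a priori hypothesis of
  \<open>halving_recursion_bound\<close>, without which the recursion has no starting point.\<close>

lemma sum_p_reach_exp_bound: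
  assumes A: "finite A" and a: "a \<in> A" and s: "0 \<le> s"
  shows "(\<Sum>y\<in>A. p_reach A a y s) \<le> 2 * exp (2 * rate_total * s)"
proof -
  let ?Q = "\<lambda>xs. prob {w \<in> space M. path_weight r (cfg w) xs \<le> s}"
  have 1: "p_reach A a y s \<le> (\<Sum>xs\<in>simple_paths A a y. ?Q xs)" if y: "y \<in> A" for y
  proof -
    note meas = simple_path_sets
    have "p_reach A a y s \<le> prob (\<Union>xs\<in>simple_paths A a y. {w \<in> space M. path_weight r (cfg w) xs \<le> s})"
      unfolding p_reach_def
    proof (rule prob_le_of_good)
      fix w assume w: "w \<in> {w \<in> space M. reach r (cfg w) A a y s}" "w \<in> good"
      interpret positive_weights r "cfg w" by (rule good_positive_weights) fact
      have "fdist r (cfg w) A a y \<le> s" using w reach_iff_fdist[OF A a y] by simp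
      moreover obtain xs where xs: "xs \<in> simple_paths A a y" "path_weight r (cfg w) xs = fdist r (cfg w) A a y"
        using fdist_attained[OF A a y] by metis
      ultimately show "w \<in> (\<Union>xs\<in>simple_paths A a y. {w \<in> space M. path_weight r (cfg w) xs \<le> s})"
        using w by (auto intro!: bexI[of _ xs])
    qed (use meas[of _ A a y] in \<open>auto intro!: sets.finite_UN finite_simple_paths A\<close>)
    also have "\<dots> \<le> (\<Sum>xs\<in>simple_paths A a y. ?Q xs)"
      using meas[of _ A a y] by (intro finite_measure_subadditive_finite finite_simple_paths A) auto
    finally show ?thesis .
  qed
  have "(\<Sum>y\<in>A. p_reach A a y s) \<le> (\<Sum>y\<in>A. \<Sum>xs\<in>simple_paths A a y. ?Q xs)"
    by (intro sum_mono 1)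
  also have "\<dots> = (\<Sum>xs\<in>(\<Union>y\<in>A. simple_paths A a y). ?Q xs)"
    by (subst sum.UNION_disjoint) (auto simp: A finite_simple_paths, auto simp: simple_paths_def dest: is_path_last)
  also have "\<dots> \<le> (\<Sum>xs\<in>(\<Union>k\<in>{..card A}. simple_from A a k). ?Q xs)"
  proof (intro sum_mono2)
    show "(\<Union>y\<in>A. simple_paths A a y) \<subseteq> (\<Union>k\<in>{..card A}. simple_from A a k)"
    proof safe
      fix y xs assume *: "xs \<in> simple_paths A a y" "y \<in> A"
      then have l: "length xs \<le> card A"
        using card_mono[OF A, of "set xs"] by (simp add: simple_paths_def distinct_card)
      have "xs \<noteq> []" "last xs = y" using * by (auto simp: simple_paths_def dest: is_path_last)
      then have "xs \<in> simple_from A a (length xs - 1)" using * by (auto simp: simple_from_def)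
      then show "xs \<in> (\<Union>k\<in>{..card A}. simple_from A a k)" using l by (intro UN_I[of "length xs - 1"]) auto
    qed
  qed (auto simp: A finite_simple_from)
  also have "\<dots> \<le> (\<Sum>k\<in>{..card A}. \<Sum>xs\<in>simple_from A a k. ?Q xs)"
    by (subst sum.UNION_disjoint) (auto simp: A finite_simple_from, auto simp: simple_from_def)
  also have "\<dots> \<le> (\<Sum>k\<in>{..card A}. exp (2 * rate_total * s) * (1 / 2) ^ k)"
    using sum_prob_simple_from[OF A, where \<theta> = "2 * rate_total" and a = a and s = s] rate_total(1) by (intro sum_mono) (simp add: field_simps)
  also have "\<dots> = exp (2 * rate_total * s) * (\<Sum>k<Suc (card A). (1 / 2) ^ k)"
    by (simp add: sum_distrib_left lessThan_Suc_atMost)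
  also have "\<dots> \<le> exp (2 * rate_total * s) * 2"
    by (intro mult_left_mono) (simp_all add: sum_gp_strict del: sum.lessThan_Suc)
  finally show ?thesis by simp
qed

text \<open>Exactly \<open>K\<close> steps are enough: a light path with more steps has a light
  prefix with \<open>K\<close> steps.\<close>

definition many_steps :: "(int ^ 'd) set \<Rightarrow> int ^ 'd \<Rightarrow> nat \<Rightarrow> real \<Rightarrow> 'w set" where
  "many_steps A a K s = (\<Union>xs\<in>simple_from A a K. {w \<in> space M. path_weight r (cfg w) xs \<le> s})"

lemma simple_from_sets: "xs \<in> simple_from A a K \<Longrightarrow> {w \<in> space M. path_weight r (cfg w) xs \<le> s} \<in> sets M"
  using simple_path_sets[of xs A a "last xs"] by (simp add: simple_from_def)

lemma prob_many_steps:
  assumes A: "finite A"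
  shows "many_steps A a K s \<in> sets M" "prob (many_steps A a K s) \<le> exp (exp 1 * rate_total * s - real K)"
proof -
  show "many_steps A a K s \<in> sets M"
    unfolding many_steps_def by (intro sets.finite_UN finite_simple_from A simple_from_sets)
  have "prob (many_steps A a K s) \<le> (\<Sum>xs\<in>simple_from A a K. prob {w \<in> space M. path_weight r (cfg w) xs \<le> s})"
    unfolding many_steps_def using simple_from_sets
    by (intro finite_measure_subadditive_finite finite_simple_from A) auto
  also have "\<dots> \<le> exp (exp 1 * rate_total * s) * (rate_total / (exp 1 * rate_total)) ^ K"
    using rate_total by (intro sum_prob_simple_from A) auto
  also have "rate_total / (exp 1 * rate_total) = exp (- 1)"
    using rate_total by (simp add: exp_minus field_simps)
  also have "exp (exp 1 * rate_total * s) * exp (- 1) ^ K = exp (exp 1 * rate_total * s - real K)"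
    by (simp add: exp_of_nat_mult[symmetric] exp_add[symmetric])
  finally show "prob (many_steps A a K s) \<le> exp (exp 1 * rate_total * s - real K)" .
qed

section \<open>Splitting a geodesic at a long edge\<close>

lemma prob_edge_weight_le:
  assumes "u \<noteq> v" "0 \<le> t"
  shows "prob {w \<in> space M. edge_weight r (cfg w) u v \<le> t} \<le> rho u v * t"
proof -
  have r: "0 < r (nat (l1norm (u - v)))" using l1norm_pos[OF assms(1)] by (intro rate_pos) auto
  have e: "{u, v} \<in> lr_edges" using assms by (auto simp: lr_edges_def)
  have "{w \<in> space M. edge_weight r (cfg w) u v \<le> t} = {w \<in> space M. om {u, v} w \<le> rho u v * t}"
    using r assms by (auto simp: edge_weight_def rho_def field_simps)
  then have "prob {w \<in> space M. edge_weight r (cfg w) u v \<le> t} = 1 - exp (- (rho u v * t))"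
    using exponential_distributedD_le[OF expo[OF e], of "rho u v * t"] assms rho_nonneg by simp
  also have "\<dots> \<le> rho u v * t" using exp_ge_add_one_self[of "- (rho u v * t)"] by linarith
  finally show ?thesis .
qed

text \<open>The three factors use disjoint edge sets: those explored with \<open>S\<close>, the edge
  \<open>{u, v}\<close>, and those inside \<open>A - S\<close>. Time j is spent before
  \<open>u\<close>, hence at most t - j remains after \<open>v\<close>.\<close>

definition split_event where
  "split_event A a x t u v j S = {w \<in> space M. frontier r (cfg w) S A a u v (real j)}
    \<inter> {w \<in> space M. edge_weight r (cfg w) u v \<le> real t}
    \<inter> {w \<in> space M. reach r (cfg w) (A - S) v x (real t - real j)}"

lemma split_event_prob:
  assumes A: "finite A" and S: "S \<subseteq> A" "a \<in> S" "u \<in> S" "v \<in> A - S"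
  shows "split_event A a x t u v j S \<in> sets M"
    and "prob (split_event A a x t u v j S) \<le>
      prob {w \<in> space M. frontier r (cfg w) S A a u v (real j)} * (rho u v * real t) * p_reach A v x (real t - real j)"
proof -
  let ?K1 = "edges_in A - edges_in (A - S) - {{u, v}}"
  let ?K2 = "{{u, v}}"
  let ?K3 = "edges_in (A - S)"
  let ?F = "{w \<in> space M. frontier r (cfg w) S A a u v (real j)}"
  let ?W = "{w \<in> space M. edge_weight r (cfg w) u v \<le> real t}"
  let ?R = "{w \<in> space M. reach r (cfg w) (A - S) v x (real t - real j)}"
  have uv: "u \<noteq> v" using S by auto
  have K: "?K1 \<subseteq> lr_edges" "?K2 \<subseteq> lr_edges" "?K3 \<subseteq> lr_edges" "?K1 \<union> ?K2 \<subseteq> lr_edges"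
    using edges_in_subset uv by (auto simp: lr_edges_def)
  have F: "?F \<in> sets (Fil ?K1)" by (rule frontier_Fil[OF A]) (use S in auto)
  have [measurable]: "(\<lambda>w. edge_weight r (cfg w) u v) \<in> borel_measurable (Fil ?K2)"
    by (rule edge_weight_Fil) simp
  have "{w \<in> space (Fil ?K2). edge_weight r (cfg w) u v \<le> real t} \<in> sets (Fil ?K2)" by measurable
  then have W: "?W \<in> sets (Fil ?K2)" by simp
  have R: "?R \<in> sets (Fil ?K3)" by (rule reach_Fil)
  have FW: "?F \<inter> ?W \<in> sets (Fil (?K1 \<union> ?K2))"
    using F W sets_Fil_mono[of ?K1 "?K1 \<union> ?K2"] sets_Fil_mono[of ?K2 "?K1 \<union> ?K2"] by blast
  show "split_event A a x t u v j S \<in> sets M"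
    unfolding split_event_def using FW R sets_Fil_subset[OF K(4)] sets_Fil_subset[OF K(3)] by blast
  have uvS: "{u, v} \<notin> ?K3" using S by (auto simp: edges_in_def doubleton_eq_iff)
  have "prob (split_event A a x t u v j S) = prob (?F \<inter> ?W) * prob ?R"
    unfolding split_event_def by (rule Fil_indep[OF K(4,3) _ FW R]) (use uvS in auto)
  also have "prob (?F \<inter> ?W) = prob ?F * prob ?W"
    by (rule Fil_indep[OF K(1,2) _ F W]) auto
  also have "prob ?F * prob ?W * prob ?R \<le> prob ?F * (rho u v * real t) * p_reach A v x (real t - real j)"
  proof (intro mult_mono)
    show "prob ?W \<le> rho u v * real t" by (rule prob_edge_weight_le[OF uv]) simp
    show "prob ?R \<le> p_reach A v x (real t - real j)"
      using p_reach_mono[of "A - S" A] unfolding p_reach_def by auto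
  qed (auto intro!: mult_nonneg_nonneg rho_nonneg)
  finally show "prob (split_event A a x t u v j S) \<le>
    prob ?F * (rho u v * real t) * p_reach A v x (real t - real j)" .
qed

definition splitters :: "(int ^ 'd) set \<Rightarrow> int ^ 'd \<Rightarrow> int ^ 'd \<Rightarrow> int ^ 'd \<Rightarrow> (int ^ 'd) set set" where
  "splitters A a u v = {S. S \<subseteq> A \<and> a \<in> S \<and> u \<in> S \<and> v \<notin> S}"

text \<open>By \<open>frontierD\<close> almost surely at most one \<open>S\<close> occurs, and then
  \<open>u\<close> is reached within time j + 1. Summing over all candidate balls therefore costs no
  entropy.\<close>

lemma sum_prob_frontier:
  assumes A: "finite A" "v \<in> A"
  shows "(\<Sum>S\<in>splitters A a u v. prob {w \<in> space M. frontier r (cfg w) S A a u v (real j)})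
    \<le> p_reach A a u (real j + 1)"
proof -
  let ?F = "\<lambda>S. {w \<in> space M. frontier r (cfg w) S A a u v (real j)}"
  have fin: "finite (splitters A a u v)"
    unfolding splitters_def by (rule finite_subset[of _ "Pow A"]) (use A in auto)
  have meas: "?F S \<in> sets M" if "S \<in> splitters A a u v" for S
  proof -
    have "edges_in A - edges_in (A - S) - {{u, v}} \<subseteq> lr_edges" using edges_in_subset[of A] by blast
    from sets_Fil_subset[OF this] show ?thesis
      using frontier_Fil[OF A(1), of S a u v "real j"] that A(2) unfolding splitters_def by blast
  qed
  obtain N where N: "{w \<in> space M. \<not> w \<in> good} \<subseteq> N" "N \<in> null_sets M"
    using AE_good unfolding eventually_ae_filter by blast
  \<comment> \<open>A measurable set of full measure inside \<open>good\<close>. Intersecting with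
    it makes the frontier events literally disjoint without changing their probabilities.\<close>
  define G where "G = space M - N"
  have G: "G \<in> sets M" "G \<subseteq> good" using N by (auto simp: G_def)
  have PG: "prob (B \<inter> G) = prob B" if B: "B \<in> sets M" for B
  proof -
    have "B \<inter> G = B - N" using sets.sets_into_space[OF B] by (auto simp: G_def)
    then show ?thesis using measure_Diff_null_set[OF B N(2)] by simp
  qed
  have "(\<Sum>S\<in>splitters A a u v. prob (?F S)) = (\<Sum>S\<in>splitters A a u v. prob (?F S \<inter> G))"
    by (intro sum.cong refl PG[symmetric] meas)
  also have "\<dots> = prob (\<Union>S\<in>splitters A a u v. ?F S \<inter> G)"
  proof (rule finite_measure_finite_Union[symmetric, OF fin])
    show "(\<lambda>S. ?F S \<inter> G) ` splitters A a u v \<subseteq> events" using meas G by auto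
    show "disjoint_family_on (\<lambda>S. ?F S \<inter> G) (splitters A a u v)"
      unfolding disjoint_family_on_def
    proof (intro ballI impI equals0I)
      fix S T w assume ST: "S \<in> splitters A a u v" "T \<in> splitters A a u v" "S \<noteq> T"
        and w: "w \<in> (?F S \<inter> G) \<inter> (?F T \<inter> G)"
      interpret positive_weights r "cfg w" by (rule good_positive_weights) (use w G in auto)
      show False
        using frontierD(1)[of S A a u v "real j"] frontierD(1)[of T A a u v "real j"] ST w A(1)
        unfolding splitters_def by auto
    qed
  qed
  also have "\<dots> \<le> p_reach A a u (real j + 1)"
    unfolding p_reach_def
  proof (rule finite_measure_mono)
    show "(\<Union>S\<in>splitters A a u v. ?F S \<inter> G) \<subseteq> {w \<in> space M. reach r (cfg w) A a u (real j + 1)}"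
    proof safe
      fix S w assume S: "S \<in> splitters A a u v" and fr: "frontier r (cfg w) S A a u v (real j)" and w: "w \<in> G"
      interpret positive_weights r "cfg w" by (rule good_positive_weights) (use w G in auto)
      have "fdist r (cfg w) A a u = fdist r (cfg w) S a u"
        using frontierD(2)[OF fr A(1)] S unfolding splitters_def by auto
      also have "\<dots> \<le> real j + 1" using fr unfolding frontier_def by auto
      finally show "reach r (cfg w) A a u (real j + 1)"
        using reach_iff_fdist[OF A(1), of a u] S unfolding splitters_def by auto
    qed
  qed simp
  finally show ?thesis .
qed

definition long_pairs :: "(int ^ 'd) set \<Rightarrow> int ^ 'd \<Rightarrow> int ^ 'd \<Rightarrow> nat \<Rightarrow> ((int ^ 'd) \<times> (int ^ 'd)) set" where
  "long_pairs A a x K = {(u, v) \<in> A \<times> A. u \<noteq> v \<and> l1norm (a - x) \<le> int K * l1norm (u - v)}"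

text \<open>Take a geodesic. If it has at least \<open>K\<close> steps, its prefix is in
  \<open>many_steps\<close>. Otherwise it has an edge \<open>(u, v)\<close> of length at least 1/K
  of the total distance. Distances strictly increase along a geodesic, so from \<open>v\<close> on
  it never meets the closed ball of radius \<open>D A a u\<close>, and the last piece lives in
  \<open>A - S\<close>.\<close>

lemma split_cover:
  assumes A: "finite A" "a \<in> A" "x \<in> A" "a \<noteq> x"
    and w: "w \<in> good" "reach r (cfg w) A a x (real t)"
  shows "w \<in> many_steps A a K (real t) \<union>
    (\<Union>(u, v)\<in>long_pairs A a x K. \<Union>j\<in>{..<t}. \<Union>S\<in>splitters A a u v. split_event A a x t u v j S)"
proof -
  interpret positive_weights r "cfg w" by (rule good_positive_weights) fact
  have wM: "w \<in> space M" using w(1) by (simp add: good_def)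
  obtain xs where "xs \<in> simple_paths A a x" and geo: "pw xs = D A a x"
    using fdist_attained[OF A(1-3)] by metis
  then have xs: "is_path xs a x" "distinct xs" "set xs \<subseteq> A" by (auto simp: simple_paths_def)
  have Dt: "D A a x \<le> real t" using w(2) reach_iff_fdist[OF A(1-3)] by simp
  show ?thesis
  proof (cases "length xs \<le> K")
    case False
    let ?z = "xs ! K" and ?as = "take K xs" and ?bs = "drop (Suc K) xs"
    have s: "xs = ?as @ [?z] @ ?bs" using False id_take_nth_drop[of K xs] by simp
    have tk: "?as @ [?z] = take (Suc K) xs" using False by (simp add: take_Suc_conv_app_nth)
    have p: "is_path (?as @ [?z]) a ?z" using xs(1) is_path_append[of ?as ?z ?bs a x] s by simp
    have "set (take (Suc K) xs) \<subseteq> A" using set_take_subset[of "Suc K" xs] xs(3) by (rule subset_trans)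
    moreover have "distinct (take (Suc K) xs)" using xs(2) by simp
    ultimately have "?as @ [?z] \<in> simple_from A a K"
      using p False unfolding simple_from_def simple_paths_def by (simp add: tk[symmetric])
    moreover have "pw (?as @ [?z]) \<le> real t"
      using path_weight_prefix_le[of ?as ?z ?bs a x] xs(1) s geo Dt by simp
    ultimately show ?thesis using wM unfolding many_steps_def by blast
  next
    case True
    obtain ys u v zs where s: "xs = ys @ [u, v] @ zs" and long: "l1norm (a - x) \<le> int K * l1norm (u - v)"
      using path_long_edge[OF xs(1) True A(4)] by auto
    have p: "is_path (ys @ [u]) a u" "u \<noteq> v" "is_path (v # zs) v x"
      using xs(1) unfolding s is_path_split by auto
    have Du: "D A a u = pw (ys @ [u])"
      by (rule geodesic_prefix[OF A(1), of ys u "v # zs" a x]) (use xs geo s in simp_all)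
    have e: "0 < edge_weight r (cfg w) u v" using edge_weight_pos p by auto
    have tot: "pw xs = pw (ys @ [u]) + edge_weight r (cfg w) u v + pw (v # zs)"
      unfolding s path_weight_split ..
    have nn: "0 \<le> pw (ys @ [u])" "0 \<le> pw (v # zs)" using path_weight_nonneg p by auto
    \<comment> \<open>Rounding down keeps the remaining time at most \<open>t - j\<close> and
      weakens the time bound for \<open>u\<close> to j + 1; this is the extra unit of time in the
      recursion.\<close>
    define j where "j = nat \<lfloor>D A a u\<rfloor>"
    have j: "real j \<le> D A a u" "D A a u < real j + 1" using nn Du by (auto simp: j_def)
    have jt: "j < t" using j tot nn e Du geo Dt by linarith
    define S where "S = {y \<in> A. D A a y \<le> D A a u}"
    have "D A a a \<le> 0" using fdist_le[OF A(1), of "[a]" a a] A by simp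
    then have aS: "a \<in> S" unfolding S_def using A Du nn by auto
    have uS: "u \<in> S" "v \<in> A" unfolding S_def using xs(3) s by auto
    have out: "set (v # zs) \<subseteq> A - S"
    proof
      fix z assume "z \<in> set (v # zs)"
      then obtain as bs where ab: "v # zs = as @ [z] @ bs"
        by (metis append_Cons append_Nil in_set_conv_decomp)
      have xs': "xs = (ys @ [u] @ as) @ [z] @ bs" using s ab by simp
      have "D A a z = pw ((ys @ [u] @ as) @ [z])"
        by (rule geodesic_prefix[OF A(1), of _ z bs a x]) (use xs geo xs' in simp_all)
      also have "\<dots> = pw (ys @ [u]) + pw (u # as @ [z])"
        using path_weight_append[of r "cfg w" ys u "as @ [z]"] by simp
      finally have Dz: "D A a z = pw (ys @ [u]) + pw (u # as @ [z])" .
      have "0 < pw (u # as @ [z])"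
      proof -
        have q: "is_path (v # zs) v x" "as @ [z] @ bs = v # zs" using p ab by auto
        then have q2: "is_path (as @ [z]) v z" using is_path_append[of as z bs v x] by simp
        obtain cs where cs: "as @ [z] = v # cs" using is_path_hd[OF q2] by (cases "as @ [z]") auto
        show ?thesis unfolding cs using path_weight_nonneg[OF q2] e cs by simp
      qed
      then have "D A a z > D A a u" using Du Dz by simp
      then show "z \<in> A - S" using xs(3) xs' by (auto simp: S_def)
    qed
    have fr: "frontier r (cfg w) S A a u v (real j)"
      by (rule frontierI(1)[OF A(1,2) _ S_def j aS]) (use uS S_def in auto)
    have "pw (v # zs) \<le> real t - real j" using tot geo Dt j Du e by linarith
    then have "reach r (cfg w) (A - S) v x (real t - real j)"
      unfolding reach_def using p out by blast
    moreover have "edge_weight r (cfg w) u v \<le> real t" using tot nn geo Dt by linarith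
    ultimately have "w \<in> split_event A a x t u v j S" using fr wM by (simp add: split_event_def)
    moreover have "S \<in> splitters A a u v" using aS uS out unfolding splitters_def S_def by auto
    moreover have "(u, v) \<in> long_pairs A a x K" using p long uS xs(3) s unfolding long_pairs_def by auto
    ultimately show ?thesis using jt by blast
  qed
qed

text \<open>Union bound over the long edge, the integer time and the explored ball; the sum over
  balls collapses by \<open>sum_prob_frontier\<close>.\<close>

lemma split_bound:
  assumes A: "finite A" "a \<in> A" "x \<in> A" "a \<noteq> x"
  shows "p_reach A a x (real t) \<le> exp (exp 1 * rate_total * real t - real K) +
    (\<Sum>(u, v)\<in>long_pairs A a x K. \<Sum>j<t.
      p_reach A a u (real j + 1) * (rho u v * real t) * p_reach A v x (real t - real j))"
proof -
  have fS: "finite (splitters A a u v)" for u v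
    unfolding splitters_def by (rule finite_subset[of _ "Pow A"]) (use A in auto)
  have fL: "finite (long_pairs A a x K)"
    unfolding long_pairs_def by (rule finite_subset[of _ "A \<times> A"]) (use A in auto)
  let ?E3 = "\<lambda>u v j. \<Union>S\<in>splitters A a u v. split_event A a x t u v j S"
  let ?E2 = "\<lambda>u v. \<Union>j\<in>{..<t}. ?E3 u v j"
  let ?E1 = "\<Union>(u, v)\<in>long_pairs A a x K. ?E2 u v"
  have m: "split_event A a x t u v j S \<in> sets M"
    and pr: "prob (split_event A a x t u v j S) \<le>
      prob {w \<in> space M. frontier r (cfg w) S A a u v (real j)} * (rho u v * real t) * p_reach A v x (real t - real j)"
    if "(u, v) \<in> long_pairs A a x K" "S \<in> splitters A a u v" for u v j S
    using split_event_prob[OF A(1), of S a u v x t j] that unfolding long_pairs_def splitters_def by auto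
  have m3: "?E3 u v j \<in> sets M" if "(u, v) \<in> long_pairs A a x K" for u v j
    using m that fS by (intro sets.finite_UN) auto
  have m2: "?E2 u v \<in> sets M" if "(u, v) \<in> long_pairs A a x K" for u v
    by (rule sets.finite_UN[OF finite_lessThan m3[OF that]])
  have m1: "?E1 \<in> sets M"
    using m2 fL by (intro sets.finite_UN) auto
  have p3: "prob (?E3 u v j) \<le> p_reach A a u (real j + 1) * (rho u v * real t) * p_reach A v x (real t - real j)"
    if uv: "(u, v) \<in> long_pairs A a x K" for u v j
  proof -
    have "prob (?E3 u v j) \<le> (\<Sum>S\<in>splitters A a u v. prob (split_event A a x t u v j S))"
      using m[OF uv] fS by (intro finite_measure_subadditive_finite) auto
    also have "\<dots> \<le> (\<Sum>S\<in>splitters A a u v. prob {w \<in> space M. frontier r (cfg w) S A a u v (real j)} * (rho u v * real t) * p_reach A v x (real t - real j))"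
      by (intro sum_mono pr uv)
    also have "\<dots> = (\<Sum>S\<in>splitters A a u v. prob {w \<in> space M. frontier r (cfg w) S A a u v (real j)}) * (rho u v * real t) * p_reach A v x (real t - real j)"
      by (simp add: sum_distrib_right)
    also have "\<dots> \<le> p_reach A a u (real j + 1) * (rho u v * real t) * p_reach A v x (real t - real j)"
      using uv by (intro mult_right_mono sum_prob_frontier A rho_nonneg p_reach_bounds mult_nonneg_nonneg) (auto simp: long_pairs_def)
    finally show ?thesis .
  qed
  have p1: "prob ?E1 \<le> (\<Sum>(u, v)\<in>long_pairs A a x K. \<Sum>j<t. prob (?E3 u v j))"
  proof -
    have "prob ?E1 \<le> (\<Sum>(u, v)\<in>long_pairs A a x K. prob (?E2 u v))"
    proof -
      have "(\<lambda>(u, v). ?E2 u v) ` long_pairs A a x K \<subseteq> events"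
        by (rule image_subsetI) (use m2 in \<open>simp add: case_prod_unfold\<close>)
      from finite_measure_subadditive_finite[OF fL this] show ?thesis by (simp add: case_prod_unfold)
    qed
    also have "\<dots> \<le> (\<Sum>(u, v)\<in>long_pairs A a x K. \<Sum>j<t. prob (?E3 u v j))"
    proof (rule sum_mono, safe)
      fix u v assume "(u, v) \<in> long_pairs A a x K"
      from m3[OF this] have "?E3 u v ` {..<t} \<subseteq> events" by blast
      then show "prob (?E2 u v) \<le> (\<Sum>j<t. prob (?E3 u v j))"
        by (rule finite_measure_subadditive_finite[OF finite_lessThan])
    qed
    finally show ?thesis .
  qed
  have "p_reach A a x (real t) \<le> prob (many_steps A a K (real t) \<union> ?E1)"
    unfolding p_reach_def
  proof (rule prob_le_of_good)
    show "many_steps A a K (real t) \<union> ?E1 \<in> sets M" using m1 prob_many_steps(1)[OF A(1)] by blast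
  qed (use split_cover[OF A] in auto)
  also have "\<dots> \<le> prob (many_steps A a K (real t)) + prob ?E1"
    by (rule measure_Un_le[OF prob_many_steps(1)[OF A(1)] m1])
  also have "\<dots> \<le> exp (exp 1 * rate_total * real t - real K) + (\<Sum>(u, v)\<in>long_pairs A a x K. \<Sum>j<t. prob (?E3 u v j))"
    by (intro add_mono prob_many_steps(2) A p1)
  also have "(\<Sum>(u, v)\<in>long_pairs A a x K. \<Sum>j<t. prob (?E3 u v j)) \<le>
    (\<Sum>(u, v)\<in>long_pairs A a x K. \<Sum>j<t.
      p_reach A a u (real j + 1) * (rho u v * real t) * p_reach A v x (real t - real j))"
    by (rule sum_mono, safe, rule sum_mono, rule p3)
  finally show ?thesis by simp
qed

section \<open>Growth of the expected ball size\<close>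

text \<open>A finite set \<open>A\<close> is not translation invariant. The maximum over starting
  points replaces invariance, since the two pieces of a geodesic are measured from different
  endpoints.\<close>

definition ball_size :: "(int ^ 'd) set \<Rightarrow> real \<Rightarrow> real" where
  "ball_size A t = Max ((\<lambda>a. \<Sum>y\<in>A. p_reach A a y t) ` A)"

lemma sum_p_reach_le_ball_size: "finite A \<Longrightarrow> a \<in> A \<Longrightarrow> (\<Sum>y\<in>A. p_reach A a y t) \<le> ball_size A t"
  unfolding ball_size_def by (intro Max_ge) auto

lemma ball_size_leI:
  assumes "finite A" "A \<noteq> {}" "\<And>a. a \<in> A \<Longrightarrow> (\<Sum>y\<in>A. p_reach A a y t) \<le> c"
  shows "ball_size A t \<le> c"
  unfolding ball_size_def using assms by (intro Max.boundedI) auto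

lemma p_reach_self: "a \<in> A \<Longrightarrow> 0 \<le> t \<Longrightarrow> p_reach A a a t = 1"
proof -
  assume "a \<in> A" "0 \<le> t"
  then have "reach r (cfg w) A a a t" for w
    unfolding reach_def by (intro exI[of _ "[a]"]) auto
  then show ?thesis unfolding p_reach_def by (simp add: prob_space)
qed

lemma ball_size_ge_1:
  assumes "finite A" "A \<noteq> {}" "0 \<le> t"
  shows "1 \<le> ball_size A t"
proof -
  obtain a where a: "a \<in> A" using assms by auto
  have "p_reach A a a t \<le> (\<Sum>y\<in>A. p_reach A a y t)"
    by (rule member_le_sum) (use a assms p_reach_bounds in auto)
  then show ?thesis using p_reach_self[OF a assms(3)] sum_p_reach_le_ball_size[OF assms(1) a, of t] by linarith
qed

lemma long_pairs_bound:
  assumes A: "finite A" "a \<in> A" "x \<in> A"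
    and R: "\<And>u v. (u, v) \<in> long_pairs A a x K \<Longrightarrow> rho u v \<le> R" "0 \<le> R"
    and G: "\<And>j. j < t \<Longrightarrow> ball_size A (real j + 1) * ball_size A (real t - real j) \<le> G"
  shows "(\<Sum>(u, v)\<in>long_pairs A a x K. \<Sum>j<t.
      p_reach A a u (real j + 1) * (rho u v * real t) * p_reach A v x (real t - real j)) \<le> R * real t ^ 2 * G"
proof -
  let ?p = "\<lambda>u j. p_reach A a u (real j + 1)" and ?q = "\<lambda>v j. p_reach A v x (real t - real j)"
  have "(\<Sum>(u, v)\<in>long_pairs A a x K. \<Sum>j<t. ?p u j * (rho u v * real t) * ?q v j)
      \<le> (\<Sum>(u, v)\<in>long_pairs A a x K. \<Sum>j<t. ?p u j * (R * real t) * ?q v j)"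
    by (rule sum_mono, safe, intro sum_mono mult_right_mono mult_left_mono p_reach_bounds R) auto
  also have "\<dots> \<le> (\<Sum>(u, v)\<in>A \<times> A. \<Sum>j<t. ?p u j * (R * real t) * ?q v j)"
    by (rule sum_mono2) (auto simp: long_pairs_def A intro!: sum_nonneg mult_nonneg_nonneg p_reach_bounds R)
  also have "\<dots> = (\<Sum>u\<in>A. \<Sum>v\<in>A. \<Sum>j<t. ?p u j * (R * real t) * ?q v j)"
    by (rule sum.cartesian_product[symmetric])
  also have "\<dots> = (\<Sum>u\<in>A. \<Sum>j<t. \<Sum>v\<in>A. ?p u j * (R * real t) * ?q v j)"
    by (rule sum.cong[OF refl], rule sum.swap)
  also have "\<dots> = (\<Sum>j<t. \<Sum>u\<in>A. \<Sum>v\<in>A. ?p u j * (R * real t) * ?q v j)"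
    by (rule sum.swap)
  also have "\<dots> = (\<Sum>j<t. R * real t * ((\<Sum>u\<in>A. ?p u j) * (\<Sum>v\<in>A. ?q v j)))"
    by (intro sum.cong refl) (simp only: sum_distrib_left[symmetric] sum_distrib_right[symmetric] mult.assoc, simp only: mult_ac)
  also have "\<dots> \<le> (\<Sum>j<t. R * real t * G)"
  proof (intro sum_mono mult_left_mono)
    fix j assume j: "j \<in> {..<t}"
    have "(\<Sum>v\<in>A. ?q v j) = (\<Sum>v\<in>A. p_reach A x v (real t - real j))"
      by (simp add: p_reach_commute[of A _ x])
    moreover have bs1: "1 \<le> ball_size A (real j + 1)" by (rule ball_size_ge_1) (use A in auto)
    ultimately have "(\<Sum>u\<in>A. ?p u j) * (\<Sum>v\<in>A. ?q v j) \<le> ball_size A (real j + 1) * ball_size A (real t - real j)"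
      using sum_p_reach_le_ball_size[OF A(1,2), of "real j + 1"] sum_p_reach_le_ball_size[OF A(1,3), of "real t - real j"]
        bs1
      by (intro mult_mono) (auto intro!: sum_nonneg p_reach_bounds)
    then show "(\<Sum>u\<in>A. ?p u j) * (\<Sum>v\<in>A. ?q v j) \<le> G" using G[of j] j by simp
  qed (use R in auto)
  also have "\<dots> = R * real t ^ 2 * G" by (simp add: power2_eq_square)
  finally show ?thesis .
qed

text \<open>The long edge has length at least n / K, so its rate is about (n / K)^(-\<alpha>), where
  K is of order t + log n. One \<eta> is lost in \<open>rate_upper\<close>; the other absorbs the
  power of log n contained in K. The power of t is \<alpha> from K and 2 from
  \<open>long_pairs_bound\<close>.\<close>

lemma p_reach_polynomial_bound:
  assumes \<eta>: "0 < \<eta>" "2 * \<eta> < \<alpha>"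
  obtains C where "1 \<le> C" "\<And>A a x t G. finite A \<Longrightarrow> a \<in> A \<Longrightarrow> x \<in> A \<Longrightarrow> a \<noteq> x \<Longrightarrow> 1 \<le> t \<Longrightarrow> 1 \<le> G \<Longrightarrow>
    (\<And>j. j < t \<Longrightarrow> ball_size A (real j + 1) * ball_size A (real t - real j) \<le> G) \<Longrightarrow>
    p_reach A a x (real t) \<le> C * real t powr (\<alpha> + 2) * G * real_of_int (l1norm (a - x)) powr (- (\<alpha> - 2 * \<eta>))"
proof -
  obtain C1 where C1: "C1 > 0" "\<And>k. k \<ge> 1 \<Longrightarrow> r k \<le> C1 * real k powr (\<eta> - \<alpha>)"
    using rate_upper[OF \<eta>(1)] by auto
  define s where "s = \<alpha> - \<eta>"
  have s: "0 < s" "s \<le> \<alpha>" using \<eta> by (auto simp: s_def)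
  define c2 where "c2 = exp 1 * rate_total + \<alpha> + 1"
  have S0: "0 \<le> exp 1 * rate_total" using rate_total(1) by simp
  have c2: "1 \<le> c2" using S0 alpha_pos by (simp add: c2_def)
  define c3 where "c3 = 1 + \<alpha> / \<eta>"
  have c3: "1 \<le> c3" using \<eta> alpha_pos by (simp add: c3_def)
  have log_le: "(1 + ln n) powr s \<le> c3 powr s * n powr \<eta>" if n: "1 \<le> n" for n :: real
  proof -
    have "1 + ln n \<le> n powr (\<eta> / \<alpha>) + n powr (\<eta> / \<alpha>) / (\<eta> / \<alpha>)"
      using n \<eta> alpha_pos by (intro add_mono ge_one_powr_ge_zero ln_powr_bound) auto
    also have "\<dots> = c3 * n powr (\<eta> / \<alpha>)" using \<eta> alpha_pos by (simp add: c3_def field_simps)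
    finally have "(1 + ln n) powr s \<le> (c3 * n powr (\<eta> / \<alpha>)) powr s"
      using s n by (intro powr_mono2) auto
    also have "\<dots> = c3 powr s * n powr (\<eta> / \<alpha> * s)" using c3 by (simp add: powr_mult powr_powr)
    also have "\<dots> \<le> c3 powr s * n powr \<eta>"
    proof (intro mult_left_mono powr_mono n)
      show "\<eta> / \<alpha> * s \<le> \<eta>" using s \<eta> alpha_pos by (simp add: field_simps)
    qed auto
    finally show ?thesis .
  qed
  define C where "C = 1 + C1 * (c2 * c3) powr s"
  show ?thesis
  proof (rule that[of C])
    show "1 \<le> C" using C1 by (simp add: C_def)
    fix A :: "(int ^ 'd) set" and a x :: "int ^ 'd" and t :: nat and G :: real
    assume A: "finite A" "a \<in> A" "x \<in> A" "a \<noteq> x" and t: "1 \<le> t" and G1: "1 \<le> G"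
      and G: "\<And>j. j < t \<Longrightarrow> ball_size A (real j + 1) * ball_size A (real t - real j) \<le> G"
    define n where "n = real_of_int (l1norm (a - x))"
    have n: "1 \<le> n" using l1norm_pos[OF A(4)] by (simp add: n_def)
    \<comment> \<open>The least \<open>K\<close> for which \<open>prob_many_steps\<close> yields at
      most n^(-\<alpha>).\<close>
    define K where "K = nat \<lceil>exp 1 * rate_total * real t + \<alpha> * ln n\<rceil>"
    have z: "0 \<le> exp 1 * rate_total * real t + \<alpha> * ln n"
      using S0 n alpha_pos rate_total(1) by (intro add_nonneg_nonneg mult_nonneg_nonneg) auto
    have K1: "exp 1 * rate_total * real t + \<alpha> * ln n \<le> real K" unfolding K_def by linarith
    have "0 < exp 1 * rate_total * real t" using rate_total(1) t by simp
    moreover have "0 \<le> \<alpha> * ln n" using alpha_pos n by simp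
    ultimately have Kpos: "0 < real K" using K1 by linarith
    have "real K \<le> exp 1 * rate_total * real t + \<alpha> * ln n + 1" unfolding K_def using z by linarith
    also have "\<dots> \<le> c2 * (real t * (1 + ln n))"
    proof -
      have "1 * ln n \<le> real t * ln n" by (rule mult_right_mono) (use t n in auto)
      then have a: "\<alpha> * ln n \<le> \<alpha> * (real t * (1 + ln n))"
        using alpha_pos n t by (auto simp: algebra_simps intro!: add_increasing)
      have b: "1 \<le> real t * (1 + ln n)" using mult_mono[of 1 "real t" 1 "1 + ln n"] n t by simp
      have "0 \<le> real t * ln n" using n by simp
      then have "exp 1 * rate_total * real t \<le> exp 1 * rate_total * (real t * (1 + ln n))"
        using S0 by (intro mult_left_mono) (auto simp: algebra_simps)
      with a b show ?thesis unfolding c2_def distrib_right by linarith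
    qed
    finally have K2: "real K \<le> c2 * (real t * (1 + ln n))" .
    define R where "R = C1 * (n / real K) powr (- s)"
    have R: "rho u v \<le> R" if uv: "(u, v) \<in> long_pairs A a x K" for u v
    proof -
      have ne: "u \<noteq> v" and l: "l1norm (a - x) \<le> int K * l1norm (u - v)" using uv by (auto simp: long_pairs_def)
      define m where "m = nat (l1norm (u - v))"
      have m: "1 \<le> m" "real m = real_of_int (l1norm (u - v))" using l1norm_pos[OF ne] by (auto simp: m_def)
      have "n \<le> real K * real m" unfolding n_def m(2)
        using l by (metis of_int_le_iff of_int_mult of_int_of_nat_eq)
      then have le: "n / real K \<le> real m" using Kpos by (simp add: field_simps)
      have "rho u v = r m" using ne by (simp add: rho_def m_def)
      also have "\<dots> \<le> C1 * real m powr (- s)" using C1(2)[OF m(1)] by (simp add: s_def)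
      also have "\<dots> \<le> R" unfolding R_def using C1(1) n Kpos s le
        by (intro mult_left_mono powr_mono2') auto
      finally show ?thesis .
    qed
    have R0: "0 \<le> R" using C1 by (simp add: R_def)
    have "R = C1 * real K powr s * n powr (- s)"
      using n Kpos by (simp add: R_def powr_divide powr_minus field_simps)
    also have "\<dots> \<le> C1 * (c2 * (real t * (1 + ln n))) powr s * n powr (- s)"
      using C1 K2 s by (intro mult_right_mono mult_left_mono powr_mono2) auto
    also have "\<dots> = C1 * c2 powr s * real t powr s * (1 + ln n) powr s * n powr (- s)"
      using c2 n by (simp add: powr_mult)
    also have "\<dots> \<le> C1 * c2 powr s * real t powr s * (c3 powr s * n powr \<eta>) * n powr (- s)"
      using C1 by (intro mult_right_mono mult_left_mono log_le n) auto
    also have "\<dots> = C1 * (c2 * c3) powr s * real t powr s * n powr (\<eta> - s)"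
      using c2 c3 by (simp add: powr_mult powr_diff powr_minus field_simps)
    also have "\<dots> \<le> C1 * (c2 * c3) powr s * real t powr \<alpha> * n powr (\<eta> - s)"
      using C1 t s by (intro mult_right_mono mult_left_mono powr_mono) auto
    finally have R2: "R \<le> C1 * (c2 * c3) powr s * real t powr \<alpha> * n powr (- (\<alpha> - 2 * \<eta>))"
      by (simp add: s_def)
    have t1: "1 \<le> real t powr (\<alpha> + 2)" using t alpha_pos by (intro ge_one_powr_ge_zero) auto
    have "exp (exp 1 * rate_total * real t - real K) \<le> exp (- \<alpha> * ln n)" using K1 by simp
    also have "\<dots> = n powr (- \<alpha>)" using n by (simp add: powr_def)
    also have "\<dots> \<le> n powr (- (\<alpha> - 2 * \<eta>))" using n \<eta> by (intro powr_mono) auto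
    also have "\<dots> \<le> real t powr (\<alpha> + 2) * G * n powr (- (\<alpha> - 2 * \<eta>))"
      using mult_mono[OF t1 G1] mult_right_mono[of 1 "real t powr (\<alpha> + 2) * G" "n powr (- (\<alpha> - 2 * \<eta>))"] by simp
    finally have e1: "exp (exp 1 * rate_total * real t - real K) \<le> real t powr (\<alpha> + 2) * G * n powr (- (\<alpha> - 2 * \<eta>))" .
    have "R * real t ^ 2 * G \<le> (C1 * (c2 * c3) powr s * real t powr \<alpha> * n powr (- (\<alpha> - 2 * \<eta>))) * real t ^ 2 * G"
      using R2 G1 by (intro mult_right_mono) auto
    also have "\<dots> = C1 * (c2 * c3) powr s * (real t powr (\<alpha> + 2) * G * n powr (- (\<alpha> - 2 * \<eta>)))"
      using t by (simp add: powr_add powr_realpow)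
    finally have e2: "R * real t ^ 2 * G \<le> C1 * (c2 * c3) powr s * (real t powr (\<alpha> + 2) * G * n powr (- (\<alpha> - 2 * \<eta>)))" .
    have "p_reach A a x (real t) \<le> exp (exp 1 * rate_total * real t - real K) + R * real t ^ 2 * G"
      using split_bound[OF A, of t K] long_pairs_bound[where K = K and t = t, OF A(1-3) R R0 G] by linarith
    also have "\<dots> \<le> C * (real t powr (\<alpha> + 2) * G * n powr (- (\<alpha> - 2 * \<eta>)))"
      using e1 e2 unfolding C_def distrib_right by linarith
    finally show "p_reach A a x (real t) \<le> C * real t powr (\<alpha> + 2) * G * real_of_int (l1norm (a - x)) powr (- (\<alpha> - 2 * \<eta>))"
      by (simp add: n_def mult.assoc)
  qed
qed


text \<open>A probability p satisfies p \<le> p^q when 0 < q < 1, an interpolation between the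
  bounds 1 and Q n^(-(\<alpha> - 2\<eta>)). The exponent \<open>q\<close> is chosen so that
  (\<alpha> - 2\<eta>) q = d + \<eta>, which is just summable over the lattice. The sum is then of
  order Q^q, and q, close to d/\<alpha>, becomes the contraction factor after taking logarithms. The
  maximising \<open>j\<close> enters as i = j + 1, so that t + 1 - i = t - j.\<close>

lemma ball_size_recursion:
  assumes \<eta>: "0 < \<eta>" "2 * \<eta> < \<alpha>" and q: "q = (real CARD('d) + \<eta>) / (\<alpha> - 2 * \<eta>)" "q < 1"
  obtains C where "0 \<le> C" "\<And>A t. finite A \<Longrightarrow> A \<noteq> {} \<Longrightarrow> 1 \<le> t \<Longrightarrow>
    \<exists>i\<in>{1..t}. ln (ball_size A (real t)) \<le>
      C + C * ln (real t) + q * (ln (ball_size A (real i)) + ln (ball_size A (real (t + 1 - i))))"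
proof -
  obtain C where C: "1 \<le> C" "\<And>A a x t G. finite A \<Longrightarrow> a \<in> A \<Longrightarrow> x \<in> A \<Longrightarrow> a \<noteq> x \<Longrightarrow> 1 \<le> t \<Longrightarrow> 1 \<le> G \<Longrightarrow>
    (\<And>j. j < t \<Longrightarrow> ball_size A (real j + 1) * ball_size A (real t - real j) \<le> G) \<Longrightarrow>
    p_reach A a x (real t) \<le> C * real t powr (\<alpha> + 2) * G * real_of_int (l1norm (a - x)) powr (- (\<alpha> - 2 * \<eta>))"
    using p_reach_polynomial_bound[OF \<eta>] by metis
  obtain C6 where C6: "C6 \<ge> 1" "\<And>F :: (int ^ 'd) set. finite F \<Longrightarrow>
      (\<Sum>x\<in>F. max 1 (real_of_int (l1norm x)) powr (- (real CARD('d) + \<eta>))) \<le> C6"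
    using lattice_sum_bounded[of "real CARD('d) + \<eta>", where 'd='d] \<eta> by auto
  have q0: "0 < q" unfolding q(1) using \<eta> by (intro divide_pos_pos) (auto intro: add_pos_pos)
  define D where "D = ln C6 + q * ln C + q * (\<alpha> + 2)"
  have lnC: "0 \<le> ln C6" "0 \<le> ln C" using C(1) C6(1) by auto
  have Dn: "0 \<le> D" "ln C6 + q * ln C \<le> D" "q * (\<alpha> + 2) \<le> D"
    using lnC q0 alpha_pos by (auto simp: D_def)
  show ?thesis
  proof (rule that[OF Dn(1)])
    fix A :: "(int ^ 'd) set" and t :: nat
    assume A: "finite A" "A \<noteq> {}" and t: "1 \<le> t"
    let ?g = "\<lambda>j. ball_size A (real j + 1) * ball_size A (real t - real j)"
    define G where "G = Max (?g ` {..<t})"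
    have "G \<in> ?g ` {..<t}" unfolding G_def using t by (intro Max_in) (auto simp: lessThan_empty_iff)
    then obtain j where j: "j < t" "G = ?g j" by auto
    have Gge: "?g i \<le> G" if "i < t" for i unfolding G_def using that by (intro Max_ge) auto
    have b: "1 \<le> ball_size A (real j + 1)" "1 \<le> ball_size A (real t - real j)"
      using ball_size_ge_1[OF A] j(1) by auto
    have G1: "1 \<le> G" using mult_mono[OF b] b j(2) by simp
    define Q where "Q = C * real t powr (\<alpha> + 2) * G"
    have t1: "1 \<le> real t powr (\<alpha> + 2)" using t alpha_pos by (intro ge_one_powr_ge_zero) auto
    have "1 \<le> C * real t powr (\<alpha> + 2)" using mult_mono[OF C(1) t1] C(1) by simp
    then have Q1: "1 \<le> Q" unfolding Q_def using mult_mono[of 1 "C * real t powr (\<alpha> + 2)" 1 G] G1 by simp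
    have "ball_size A (real t) \<le> Q powr q * C6"
    proof (rule ball_size_leI[OF A])
      fix a assume a: "a \<in> A"
      have "(\<Sum>y\<in>A. p_reach A a y (real t)) \<le> (\<Sum>y\<in>A. Q powr q * max 1 (real_of_int (l1norm (a - y))) powr (- (real CARD('d) + \<eta>)))"
      proof (rule sum_mono)
        fix y assume y: "y \<in> A"
        let ?n = "max 1 (real_of_int (l1norm (a - y)))"
        have "p_reach A a y (real t) \<le> Q * ?n powr (- (\<alpha> - 2 * \<eta>))"
        proof (cases "a = y")
          case True
          then show ?thesis using Q1 p_reach_bounds(2)[of A a y "real t"] by simp
        next
          case False
          then have "?n = real_of_int (l1norm (a - y))" using l1norm_pos[OF False] by simp
          then show ?thesis using C(2)[OF A(1) a y False t G1 Gge] unfolding Q_def by simp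
        qed
        then have "p_reach A a y (real t) powr q \<le> (Q * ?n powr (- (\<alpha> - 2 * \<eta>))) powr q"
          using q0 p_reach_bounds by (intro powr_mono2) auto
        also have "\<dots> = Q powr q * ?n powr (- (\<alpha> - 2 * \<eta>) * q)"
          using Q1 by (simp add: powr_mult powr_powr)
        also have "- (\<alpha> - 2 * \<eta>) * q = - (real CARD('d) + \<eta>)" unfolding q(1) using \<eta> by (simp add: field_simps)
        finally have le: "p_reach A a y (real t) powr q \<le> Q powr q * ?n powr (- (real CARD('d) + \<eta>))" .
        have "p_reach A a y (real t) \<le> p_reach A a y (real t) powr q"
        proof (cases "p_reach A a y (real t) = 0")
          case False
          then have "0 < p_reach A a y (real t)" using p_reach_bounds(1)[of A a y "real t"] by linarith
          then have "p_reach A a y (real t) powr 1 \<le> p_reach A a y (real t) powr q"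
            using p_reach_bounds(2)[of A a y "real t"] q(2) by (intro powr_mono') auto
          then show ?thesis using p_reach_bounds(1) by simp
        qed simp
        then show "p_reach A a y (real t) \<le> Q powr q * ?n powr (- (real CARD('d) + \<eta>))" using le by linarith
      qed
      also have "\<dots> = Q powr q * (\<Sum>x\<in>(\<lambda>y. a - y) ` A. max 1 (real_of_int (l1norm x)) powr (- (real CARD('d) + \<eta>)))"
        by (subst sum.reindex) (auto simp: inj_on_def sum_distrib_left)
      also have "\<dots> \<le> Q powr q * C6"
        using A by (intro mult_left_mono C6) auto
      finally show "(\<Sum>y\<in>A. p_reach A a y (real t)) \<le> Q powr q * C6" .
    qed
    then have "ln (ball_size A (real t)) \<le> ln (Q powr q * C6)"
      using ball_size_ge_1[OF A, of "real t"] by (intro ln_mono) auto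
    also have "\<dots> = q * ln Q + ln C6" using Q1 C6(1) by (simp add: ln_mult ln_powr)
    also have "ln Q = ln C + (\<alpha> + 2) * ln (real t) + (ln (ball_size A (real j + 1)) + ln (ball_size A (real t - real j)))"
      unfolding Q_def j(2) using C(1) b t by (simp add: ln_mult ln_powr)
    finally have "ln (ball_size A (real t)) \<le> (ln C6 + q * ln C) + q * (\<alpha> + 2) * ln (real t) +
        q * (ln (ball_size A (real j + 1)) + ln (ball_size A (real t - real j)))"
      by (simp add: algebra_simps)
    also have "\<dots> \<le> D + D * ln (real t) + q * (ln (ball_size A (real j + 1)) + ln (ball_size A (real t - real j)))"
      using Dn t by (intro add_right_mono add_mono mult_right_mono) auto
    finally show "\<exists>i\<in>{1..t}. ln (ball_size A (real t)) \<le>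
      D + D * ln (real t) + q * (ln (ball_size A (real i)) + ln (ball_size A (real (t + 1 - i))))"
      using j(1) by (intro bexI[of _ "Suc j"]) (auto simp: of_nat_diff add.commute)
  qed
qed

text \<open>As \<eta> tends to 0 the quotient tends to d/\<alpha>, and the hypothesis says
  (d/\<alpha>) 2^(1-\<beta>) < 1, so small \<eta> work by continuity. The margin in 4\<eta> <
  \<alpha> - d is needed for the decay exponent in \<open>prob_escape_tendsto_0\<close>.\<close>

lemma exponent_choice:
  assumes "2 * real CARD('d) / \<alpha> < 2 powr \<beta>"
  obtains \<eta> where "0 < \<eta>" "4 * \<eta> < \<alpha> - real CARD('d)" "(real CARD('d) + \<eta>) / (\<alpha> - 2 * \<eta>) < 1"
    "(real CARD('d) + \<eta>) / (\<alpha> - 2 * \<eta>) * 2 powr (1 - \<beta>) < 1"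
proof -
  let ?q = "\<lambda>\<eta>. (real CARD('d) + \<eta>) / (\<alpha> - 2 * \<eta>)"
  have lim: "(?q \<longlongrightarrow> (real CARD('d) + 0) / (\<alpha> - 2 * 0)) (at_right 0)"
    using alpha_pos by (intro tendsto_intros) auto
  have lim2: "((\<lambda>\<eta>. ?q \<eta> * 2 powr (1 - \<beta>)) \<longlongrightarrow> (real CARD('d) + 0) / (\<alpha> - 2 * 0) * 2 powr (1 - \<beta>)) (at_right 0)"
    by (intro tendsto_mult lim tendsto_const)
  have "eventually (\<lambda>\<eta>. ?q \<eta> < 1) (at_right 0)"
    by (rule order_tendstoD(2)[OF lim]) (use alpha_gt alpha_pos in simp)
  moreover have "eventually (\<lambda>\<eta>. ?q \<eta> * 2 powr (1 - \<beta>) < 1) (at_right 0)"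
    by (rule order_tendstoD(2)[OF lim2]) (use assms alpha_pos in \<open>simp add: powr_diff field_simps\<close>)
  moreover have "eventually (\<lambda>\<eta>::real. \<eta> \<in> {0<..<(\<alpha> - real CARD('d)) / 4}) (at_right 0)"
    by (rule eventually_at_right_real) (use alpha_gt in simp)
  ultimately have "eventually (\<lambda>\<eta>. ?q \<eta> < 1 \<and> ?q \<eta> * 2 powr (1 - \<beta>) < 1 \<and> \<eta> \<in> {0<..<(\<alpha> - real CARD('d)) / 4}) (at_right 0)"
    by eventually_elim auto
  then obtain \<eta> where "?q \<eta> < 1" "?q \<eta> * 2 powr (1 - \<beta>) < 1" "\<eta> \<in> {0<..<(\<alpha> - real CARD('d)) / 4}"
    using eventually_happens'[OF trivial_limit_at_right_real] by blast
  then show ?thesis by (intro that[of \<eta>]) auto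
qed

text \<open>Stretched exponential growth for every \<beta> in (0, 1) above 1/\<Delta>. That
  \<open>B\<close> is independent of \<open>A\<close> is what permits the passage to the whole
  lattice.\<close>

lemma ball_size_growth:
  assumes \<beta>: "0 < \<beta>" "\<beta> < 1" "2 * real CARD('d) / \<alpha> < 2 powr \<beta>"
  obtains B where "0 \<le> B" "\<And>A t. finite A \<Longrightarrow> A \<noteq> {} \<Longrightarrow> 1 \<le> t \<Longrightarrow> ball_size A (real t) \<le> exp (B * real t powr \<beta>)"
proof -
  obtain \<eta> where \<eta>: "0 < \<eta>" "4 * \<eta> < \<alpha> - real CARD('d)" 
    and q': "(real CARD('d) + \<eta>) / (\<alpha> - 2 * \<eta>) < 1" "(real CARD('d) + \<eta>) / (\<alpha> - 2 * \<eta>) * 2 powr (1 - \<beta>) < 1"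
    using exponent_choice[OF \<beta>(3)] by blast
  define q where "q = (real CARD('d) + \<eta>) / (\<alpha> - 2 * \<eta>)"
  have "0 \<le> real CARD('d)" by simp
  then have \<eta>2: "2 * \<eta> < \<alpha>" using \<eta> by linarith
  have q: "0 < q" "q < 1" "q * 2 powr (1 - \<beta>) < 1"
    using q' \<eta> \<eta>2 by (auto simp: q_def intro!: divide_pos_pos add_nonneg_pos)
  obtain C where C: "0 \<le> C" "\<And>A t. finite A \<Longrightarrow> A \<noteq> {} \<Longrightarrow> 1 \<le> t \<Longrightarrow>
    \<exists>i\<in>{1..t}. ln (ball_size A (real t)) \<le>
      C + C * ln (real t) + q * (ln (ball_size A (real i)) + ln (ball_size A (real (t + 1 - i))))"
    using ball_size_recursion[OF \<eta>(1) \<eta>2 q_def q(2)] by metis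
  \<comment> \<open>One constant has to serve both hypotheses of
    \<open>halving_recursion_bound\<close>, the recursion and the a priori linear bound.\<close>
  define C' where "C' = max C (ln 2 + 2 * rate_total)"
  have C': "0 \<le> C'" "C \<le> C'" "ln 2 + 2 * rate_total \<le> C'" using C(1) by (auto simp: C'_def)
  obtain B where B: "0 \<le> B" "\<forall>h :: nat \<Rightarrow> real. (\<forall>t\<ge>1. h t \<le> C' * real t) \<longrightarrow>
      (\<forall>t\<ge>1. \<exists>i\<in>{1..t}. h t \<le> C' + C' * ln (real t) + q * (h i + h (t + 1 - i))) \<longrightarrow>
      (\<forall>t\<ge>1. h t \<le> B * real t powr \<beta>)"
    using halving_recursion_bound[OF q(1,2) \<beta>(1,2) q(3) C'(1)] by blast
  show ?thesis
  proof (rule that[OF B(1)])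
    fix A :: "(int ^ 'd) set" and t :: nat
    assume A: "finite A" "A \<noteq> {}" and t: "1 \<le> t"
    have "ln (ball_size A (real t)) \<le> B * real t powr \<beta>"
    proof (rule B(2)[rule_format, OF _ _ t])
      fix t :: nat assume t: "1 \<le> t"
      have "ball_size A (real t) \<le> 2 * exp (2 * rate_total * real t)"
        using sum_p_reach_exp_bound[OF A(1)] by (intro ball_size_leI A) auto
      then have "ln (ball_size A (real t)) \<le> ln (2 * exp (2 * rate_total * real t))"
        using ball_size_ge_1[OF A, of "real t"] by (intro ln_mono) auto
      also have "\<dots> = ln 2 * 1 + 2 * rate_total * real t" by (simp add: ln_mult)
      also have "\<dots> \<le> ln 2 * real t + 2 * rate_total * real t" using t by (intro add_right_mono mult_left_mono) auto
      also have "\<dots> = (ln 2 + 2 * rate_total) * real t" by (simp add: algebra_simps)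
      also have "\<dots> \<le> C' * real t" by (intro mult_right_mono C') auto
      finally show "ln (ball_size A (real t)) \<le> C' * real t" .
      obtain i where i: "i \<in> {1..t}" "ln (ball_size A (real t)) \<le>
          C + C * ln (real t) + q * (ln (ball_size A (real i)) + ln (ball_size A (real (t + 1 - i))))"
        using C(2)[OF A t] by blast
      have "C + C * ln (real t) \<le> C' + C' * ln (real t)"
        using C' t by (intro add_mono mult_right_mono) auto
      then show "\<exists>i\<in>{1..t}. ln (ball_size A (real t)) \<le>
          C' + C' * ln (real t) + q * (ln (ball_size A (real i)) + ln (ball_size A (real (t + 1 - i))))"
        using i by (intro bexI[of _ i]) auto
    qed
    moreover have "ball_size A (real t) = exp (ln (ball_size A (real t)))"
      using ball_size_ge_1[OF A, of "real t"] by simp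
    ultimately show "ball_size A (real t) \<le> exp (B * real t powr \<beta>)" by (metis exp_le_cancel_iff)
  qed
qed

section \<open>The exponent and the probability of getting far in a short time\<close>

definition Delta :: real where
  "Delta = ln 2 / ln (2 * real CARD('d) / \<alpha>)"

lemma Delta_gt_1: "1 < Delta"
proof -
  have "1 < 2 * real CARD('d) / \<alpha>" using alpha_less alpha_pos by simp
  moreover have "2 * real CARD('d) / \<alpha> < 2" using alpha_gt by (simp add: pos_divide_less_eq[OF alpha_pos])
  ultimately show ?thesis unfolding Delta_def by simp
qed

lemma powr_inverse_Delta: "2 powr (1 / Delta) = 2 * real CARD('d) / \<alpha>"
proof -
  have "0 < 2 * real CARD('d) / \<alpha>" using alpha_less alpha_pos by simp
  then show ?thesis by (simp add: Delta_def powr_def)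
qed

definition escape :: "(int ^ 'd) set \<Rightarrow> real \<Rightarrow> real \<Rightarrow> 'w set" where
  "escape A n t = {w \<in> space M. \<exists>x. n \<le> real_of_int (l1norm x) \<and> reach r (cfg w) A 0 x t}"

lemma escape_sets [measurable]: "escape A n t \<in> sets M"
proof -
  have "escape A n t = (\<Union>x\<in>{x. n \<le> real_of_int (l1norm x)}. {w \<in> space M. reach r (cfg w) A 0 x t})"
    by (auto simp: escape_def)
  also have "\<dots> \<in> sets M"
    by (rule sets.countable_UN''[OF countable_subset[OF subset_UNIV] reach_sets]) simp
  finally show ?thesis .
qed

text \<open>Every path is finite and hence lies in some l1 ball, so the escape events increase along
  the exhaustion by balls and continuity of the measure applies.\<close>

lemma prob_escape_UNIV_le:
  assumes "\<And>A. finite A \<Longrightarrow> 0 \<in> A \<Longrightarrow> prob (escape A n t) \<le> c"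
  shows "prob (escape UNIV n t) \<le> c"
proof -
  define B where "B N = {x :: int ^ 'd. l1norm x \<le> int N}" for N :: nat
  have B: "finite (B N)" "0 \<in> B N" for N by (auto simp: B_def finite_l1norm_le)
  have Bmono: "B N \<subseteq> B N'" if "N \<le> N'" for N N' using that by (auto simp: B_def)
  have mono: "incseq (\<lambda>N. escape (B N) n t)"
  proof (intro incseq_SucI subsetI)
    fix N w assume "w \<in> escape (B N) n t"
    then obtain x where "w \<in> space M" "n \<le> real_of_int (l1norm x)" "reach r (cfg w) (B N) 0 x t"
      unfolding escape_def by blast
    moreover from reach_mono[OF this(3) Bmono[of N "Suc N"] order_refl]
    have "reach r (cfg w) (B (Suc N)) 0 x t" by simp
    ultimately show "w \<in> escape (B (Suc N)) n t" unfolding escape_def by blast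
  qed
  have "escape UNIV n t = (\<Union>N. escape (B N) n t)"
  proof (intro equalityI subsetI)
    fix w assume "w \<in> escape UNIV n t"
    then obtain x xs where x: "w \<in> space M" "n \<le> real_of_int (l1norm x)"
      and xs: "is_path xs 0 x" "path_weight r (cfg w) xs \<le> t" by (auto simp: escape_def reach_def)
    have "set xs \<subseteq> B (nat (Max (l1norm ` set xs)))"
    proof
      fix z assume "z \<in> set xs"
      then have "l1norm z \<le> Max (l1norm ` set xs)" by (intro Max_ge) auto
      then show "z \<in> B (nat (Max (l1norm ` set xs)))" by (auto simp: B_def)
    qed
    then show "w \<in> (\<Union>N. escape (B N) n t)" using x xs by (auto simp: escape_def reach_def)
  next
    fix w assume "w \<in> (\<Union>N. escape (B N) n t)"
    then show "w \<in> escape UNIV n t" by (auto simp: escape_def reach_def)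
  qed
  moreover have "(\<lambda>N. prob (escape (B N) n t)) \<longlonglongrightarrow> prob (\<Union>N. escape (B N) n t)"
    by (rule finite_Lim_measure_incseq[OF _ mono]) auto
  ultimately show ?thesis using assms B by (auto intro: LIMSEQ_le_const2)
qed

text \<open>Ball sizes grow at most like exp (B t^\<beta>1) for a \<beta>1 strictly between
  1/\<Delta> and min \<beta> 1. The polynomial decay at distance n = exp (t^\<beta>) is exp (-
  \<gamma> t^\<beta>), which wins because \<beta>1 < \<beta>.\<close>

lemma prob_escape_tendsto_0:
  assumes \<beta>: "1 / Delta < \<beta>"
  shows "((\<lambda>t. prob (escape UNIV (exp (t powr \<beta>)) t)) \<longlongrightarrow> 0) at_top"
proof -
  define l where "l = 1 / Delta"
  have l: "0 < l" "l < 1" "l < \<beta>" using Delta_gt_1 \<beta> by (auto simp: l_def)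
  define \<beta>1 where "\<beta>1 = (l + min \<beta> 1) / 2"
  have "l < \<beta>1" "0 < \<beta>1" "\<beta>1 < 1" "\<beta>1 < \<beta>" using l by (auto simp: \<beta>1_def min_def)
  then have \<beta>1: "1 / Delta < \<beta>1" "0 < \<beta>1" "\<beta>1 < 1" "\<beta>1 < \<beta>" by (simp_all only: l_def)
  have gt: "2 * real CARD('d) / \<alpha> < 2 powr \<beta>1"
    unfolding powr_inverse_Delta[symmetric] using \<beta>1 by (intro powr_less_mono) auto
  obtain B where B: "0 \<le> B" "\<And>A t. finite A \<Longrightarrow> A \<noteq> {} \<Longrightarrow> 1 \<le> t \<Longrightarrow> ball_size A (real t) \<le> exp (B * real t powr \<beta>1)"
    using ball_size_growth[OF \<beta>1(2,3) gt] by metis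
  obtain \<eta> where \<eta>: "0 < \<eta>" "4 * \<eta> < \<alpha> - real CARD('d)" using exponent_choice[OF gt] by blast
  have "0 \<le> real CARD('d)" by simp
  then have \<eta>2: "2 * \<eta> < \<alpha>" using \<eta> by linarith
  obtain C where C: "1 \<le> C" "\<And>A a x t G. finite A \<Longrightarrow> a \<in> A \<Longrightarrow> x \<in> A \<Longrightarrow> a \<noteq> x \<Longrightarrow> 1 \<le> t \<Longrightarrow> 1 \<le> G \<Longrightarrow>
    (\<And>j. j < t \<Longrightarrow> ball_size A (real j + 1) * ball_size A (real t - real j) \<le> G) \<Longrightarrow>
    p_reach A a x (real t) \<le> C * real t powr (\<alpha> + 2) * G * real_of_int (l1norm (a - x)) powr (- (\<alpha> - 2 * \<eta>))"
    using p_reach_polynomial_bound[OF \<eta>(1) \<eta>2] by metis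
  obtain C6 where C6: "C6 \<ge> 1" "\<And>F :: (int ^ 'd) set. finite F \<Longrightarrow>
      (\<Sum>x\<in>F. max 1 (real_of_int (l1norm x)) powr (- (real CARD('d) + \<eta>))) \<le> C6"
    using lattice_sum_bounded[of "real CARD('d) + \<eta>", where 'd='d] \<eta> by auto
  \<comment> \<open>The decay exponent \<alpha> - 2\<eta> is split as \<gamma> + (d + \<eta>): the
    second part is summable over the lattice, the first is spent on the minimal distance
    \<open>n\<close>.\<close>
  define \<gamma> where "\<gamma> = \<alpha> - 3 * \<eta> - real CARD('d)"
  have \<gamma>: "0 < \<gamma>" using \<eta> by (simp add: \<gamma>_def)
  let ?u = "\<lambda>t::real. C * (t + 1) powr (\<alpha> + 2) * exp (2 * B * (t + 1) powr \<beta>1) * (exp (- \<gamma> * t powr \<beta>) * C6)"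
  have bound: "prob (escape UNIV (exp (t powr \<beta>)) t) \<le>
      ?u t" if t: "1 \<le> t" for t
  proof (rule prob_escape_UNIV_le)
    fix A :: "(int ^ 'd) set" assume A: "finite A" "0 \<in> A"
    define T where "T = nat \<lceil>t\<rceil>"
    have T: "t \<le> real T" "real T \<le> t + 1" "1 \<le> T" using t unfolding T_def by linarith+
    define n where "n = exp (t powr \<beta>)"
    have n: "1 < n" using t by (simp add: n_def)
    define G where "G = exp (2 * B * real T powr \<beta>1)"
    have G1: "1 \<le> G" using B by (simp add: G_def)
    have G: "ball_size A (real j + 1) * ball_size A (real T - real j) \<le> G" if j: "j < T" for j
    proof -
      have le: "ball_size A (real k) \<le> exp (B * real T powr \<beta>1)" if "1 \<le> k" "k \<le> T" for k
      proof -
        have "ball_size A (real k) \<le> exp (B * real k powr \<beta>1)" using B(2)[OF A(1) _ that(1)] A by auto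
        also have "\<dots> \<le> exp (B * real T powr \<beta>1)"
          using B(1) that \<beta>1 by (simp add: mult_left_mono powr_mono2)
        finally show ?thesis .
      qed
      have "ball_size A (real (j + 1)) * ball_size A (real (T - j)) \<le> exp (B * real T powr \<beta>1) * exp (B * real T powr \<beta>1)"
      proof (intro mult_mono le)
        have "1 \<le> ball_size A (real (T - j))" by (rule ball_size_ge_1) (use A in auto)
        then show "0 \<le> ball_size A (real (T - j))" by linarith
      qed (use j in auto)
      also have "\<dots> = G" by (simp add: G_def exp_add[symmetric])
      finally show ?thesis using j by (simp add: of_nat_diff add.commute)
    qed
    let ?F = "{x \<in> A. n \<le> real_of_int (l1norm x)}"
    let ?Q = "C * real T powr (\<alpha> + 2) * G"
    have "prob (escape A n t) \<le> prob (\<Union>x\<in>?F. {w \<in> space M. reach r (cfg w) A 0 x (real T)})"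
    proof (rule finite_measure_mono)
      show "escape A n t \<subseteq> (\<Union>x\<in>?F. {w \<in> space M. reach r (cfg w) A 0 x (real T)})"
      proof
        fix w assume "w \<in> escape A n t"
        then obtain x where x: "w \<in> space M" "n \<le> real_of_int (l1norm x)" "reach r (cfg w) A 0 x t"
          by (auto simp: escape_def)
        then obtain xs where "is_path xs 0 x" "set xs \<subseteq> A" by (auto simp: reach_def)
        moreover then have "xs \<noteq> []" "last xs = x" using is_path_last by auto
        ultimately have "x \<in> A" using last_in_set[of xs] by auto
        then show "w \<in> (\<Union>x\<in>?F. {w \<in> space M. reach r (cfg w) A 0 x (real T)})"
          using x reach_mono[OF x(3) subset_refl T(1)] by auto
      qed
    qed (use A in \<open>auto intro!: sets.finite_UN\<close>)
    also have "\<dots> \<le> (\<Sum>x\<in>?F. p_reach A 0 x (real T))"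
      unfolding p_reach_def using A by (intro finite_measure_subadditive_finite) auto
    also have "\<dots> \<le> (\<Sum>x\<in>?F. ?Q * (n powr (- \<gamma>) * max 1 (real_of_int (l1norm x)) powr (- (real CARD('d) + \<eta>))))"
    proof (rule sum_mono)
      fix x assume x: "x \<in> ?F"
      let ?m = "real_of_int (l1norm x)"
      have m: "1 < ?m" "n \<le> ?m" using x n by auto
      then have x0: "0 \<noteq> x" by auto
      have "p_reach A 0 x (real T) \<le> ?Q * ?m powr (- (\<alpha> - 2 * \<eta>))"
        using C(2)[OF A(1,2) _ x0 T(3) G1 G] x by simp
      also have "?m powr (- (\<alpha> - 2 * \<eta>)) = ?m powr (- \<gamma>) * ?m powr (- (real CARD('d) + \<eta>))"
        using m by (simp add: powr_add[symmetric] \<gamma>_def)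
      also have "?Q * \<dots> \<le> ?Q * (n powr (- \<gamma>) * ?m powr (- (real CARD('d) + \<eta>)))"
        using m n \<gamma> C(1) G1 by (intro mult_left_mono mult_right_mono powr_mono2') auto
      finally show "p_reach A 0 x (real T) \<le> ?Q * (n powr (- \<gamma>) * max 1 ?m powr (- (real CARD('d) + \<eta>)))"
        using m by simp
    qed
    also have "\<dots> = ?Q * (n powr (- \<gamma>) * (\<Sum>x\<in>?F. max 1 (real_of_int (l1norm x)) powr (- (real CARD('d) + \<eta>))))"
      by (simp add: sum_distrib_left mult_ac)
    also have "\<dots> \<le> ?Q * (n powr (- \<gamma>) * C6)"
      using C(1) G1 A by (intro mult_left_mono C6) auto
    also have "\<dots> \<le> C * (t + 1) powr (\<alpha> + 2) * exp (2 * B * (t + 1) powr \<beta>1) * (n powr (- \<gamma>) * C6)"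
      unfolding G_def using C(1) C6(1) T B(1) \<beta>1 alpha_pos
      by (intro mult_right_mono mult_mono mult_left_mono powr_mono2 exp_le_cancel_iff[THEN iffD2]) auto
    also have "n powr (- \<gamma>) = exp (- \<gamma> * t powr \<beta>)" by (simp add: n_def powr_def)
    finally show "prob (escape A (exp (t powr \<beta>)) t) \<le>
      ?u t" by (simp add: n_def)
  qed
  show ?thesis
  proof (rule tendsto_sandwich[OF _ _ tendsto_const])
    show "\<forall>\<^sub>F t in at_top. 0 \<le> prob (escape UNIV (exp (t powr \<beta>)) t)" by simp
    show "\<forall>\<^sub>F t in at_top. prob (escape UNIV (exp (t powr \<beta>)) t) \<le>
      ?u t"
      using eventually_ge_at_top[of 1] by eventually_elim (rule bound)
    have "((\<lambda>t::real. (\<alpha> + 2) * (ln (t + 1) / t powr \<beta>) + 2 * B * ((t + 1) powr \<beta>1 / t powr \<beta>)) \<longlongrightarrow>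
        (\<alpha> + 2) * 0 + 2 * B * 0) at_top"
    proof (intro tendsto_add tendsto_mult tendsto_const)
      show "((\<lambda>t::real. ln (t + 1) / t powr \<beta>) \<longlongrightarrow> 0) at_top" using \<beta>1 by real_asymp
      show "((\<lambda>t::real. (t + 1) powr \<beta>1 / t powr \<beta>) \<longlongrightarrow> 0) at_top" using \<beta>1 by real_asymp
    qed
    then have "\<forall>\<^sub>F t::real in at_top. (\<alpha> + 2) * (ln (t + 1) / t powr \<beta>) + 2 * B * ((t + 1) powr \<beta>1 / t powr \<beta>) < \<gamma> / 2"
      using \<gamma> by (intro order_tendstoD(2)) auto
    then have "\<forall>\<^sub>F t::real in at_top. ?u t
        \<le> C * C6 * exp (- (\<gamma> / 2 * t powr \<beta>))"
      using eventually_ge_at_top[of "1::real"]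
    proof eventually_elim
      case (elim t)
      have p: "0 < t powr \<beta>" using elim by simp
      have "((\<alpha> + 2) * ln (t + 1) + 2 * B * (t + 1) powr \<beta>1) / t powr \<beta> < \<gamma> / 2"
        using elim(1) by (simp add: add_divide_distrib)
      then have "(\<alpha> + 2) * ln (t + 1) + 2 * B * (t + 1) powr \<beta>1 < \<gamma> / 2 * t powr \<beta>"
        unfolding pos_divide_less_eq[OF p] .
      then have "(\<alpha> + 2) * ln (t + 1) + 2 * B * (t + 1) powr \<beta>1 - \<gamma> * t powr \<beta> \<le> - (\<gamma> / 2 * t powr \<beta>)"
        by linarith
      then have "exp ((\<alpha> + 2) * ln (t + 1) + 2 * B * (t + 1) powr \<beta>1 - \<gamma> * t powr \<beta>) \<le> exp (- (\<gamma> / 2 * t powr \<beta>))"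
        by simp
      moreover have "?u t =
          C * C6 * exp ((\<alpha> + 2) * ln (t + 1) + 2 * B * (t + 1) powr \<beta>1 - \<gamma> * t powr \<beta>)"
        using elim by (simp add: powr_def exp_add exp_diff exp_minus field_simps)
      ultimately show ?case using C(1) C6(1) by (simp add: mult_left_mono)
    qed
    moreover have "((\<lambda>t::real. exp (- (\<gamma> / 2 * t powr \<beta>))) \<longlongrightarrow> 0) at_top"
      using \<gamma> \<beta>1 by real_asymp
    then have "((\<lambda>t::real. C * C6 * exp (- (\<gamma> / 2 * t powr \<beta>))) \<longlongrightarrow> 0) at_top"
      by (rule tendsto_mult_right_zero)
    ultimately have "\<forall>\<^sub>F t::real in at_top. norm (?u t)
        \<le> C * C6 * exp (- (\<gamma> / 2 * t powr \<beta>))"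
      using C(1) C6(1) by (auto simp: abs_mult elim!: eventually_mono)
    then show "((\<lambda>t::real. ?u t) \<longlongrightarrow> 0) at_top"
      using \<open>((\<lambda>t::real. C * C6 * exp (- (\<gamma> / 2 * t powr \<beta>))) \<longlongrightarrow> 0) at_top\<close> by (rule Lim_null_comparison)
  qed
qed

end

section \<open>Hierarchical connections\<close>

text \<open>A box of side m kept away from the origin, so that the norm of each offset lies between
  d m and 2 d m, exactly the range of distances covered by \<open>connector m\<close>.\<close>

definition offset_box :: "nat \<Rightarrow> (int ^ 'd) set" where
  "offset_box m = {z. \<forall>i. z $ i \<in> {int m..2 * int m}}"

lemma finite_offset_box: "finite (offset_box m)"
  unfolding offset_box_def by (rule finite_vec_box) simp

lemma card_offset_box: "card (offset_box m :: (int ^ 'd) set) = (m + 1) ^ CARD('d)"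
proof -
  have "bij_betw vec_lambda (PiE (UNIV :: 'd set) (\<lambda>_. {int m..2 * int m})) (offset_box m)"
  proof (rule bij_betwI[where g = vec_nth])
    show "vec_nth \<in> offset_box m \<rightarrow> PiE (UNIV :: 'd set) (\<lambda>_. {int m..2 * int m})"
      by (auto simp: offset_box_def)
  qed (auto simp: offset_box_def)
  then have "card (offset_box m :: (int ^ 'd) set) = card (PiE (UNIV :: 'd set) (\<lambda>_. {int m..2 * int m}))"
    by (simp add: bij_betw_same_card)
  also have "\<dots> = (m + 1) ^ CARD('d)"
    by (simp add: card_PiE nat_add_distrib)
  finally show ?thesis .
qed

lemma l1norm_offset_box:
  assumes "(z :: int ^ 'd) \<in> offset_box m"
  shows "int CARD('d) * int m \<le> l1norm z" "l1norm z \<le> 2 * int CARD('d) * int m"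
proof -
  have z: "int m \<le> \<bar>z $ i\<bar>" "\<bar>z $ i\<bar> \<le> 2 * int m" for i
    using assms by (auto simp: offset_box_def) (smt (verit))+
  have "(\<Sum>i\<in>(UNIV :: 'd set). int m) \<le> l1norm z" unfolding l1norm_def by (intro sum_mono z)
  then show "int CARD('d) * int m \<le> l1norm z" by simp
  have "l1norm z \<le> (\<Sum>i\<in>(UNIV :: 'd set). 2 * int m)" unfolding l1norm_def by (intro sum_mono z)
  then show "l1norm z \<le> 2 * int CARD('d) * int m" by simp
qed

lemma l1norm_offset_diff:
  assumes "(y :: int ^ 'd) \<in> offset_box m" "z \<in> offset_box m"
  shows "l1norm (y - z) \<le> int CARD('d) * int m"
proof -
  have "l1norm (y - z) \<le> (\<Sum>i\<in>(UNIV :: 'd set). int m)"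
    unfolding l1norm_def
  proof (intro sum_mono)
    fix i
    have "y $ i \<in> {int m..2 * int m}" "z $ i \<in> {int m..2 * int m}" using assms by (auto simp: offset_box_def)
    then show "\<bar>(y - z) $ i\<bar> \<le> int m" by (auto simp: abs_le_iff)
  qed
  then show ?thesis by simp
qed

definition short_edges :: "int \<Rightarrow> (int ^ 'd) set set" where
  "short_edges l = {{x, y} | x y. x \<noteq> y \<and> l1norm (x - y) \<le> l}"

lemma short_edges_subset: "short_edges l \<subseteq> lr_edges"
  by (auto simp: short_edges_def lr_edges_def)

lemma short_edges_mono: "l \<le> l' \<Longrightarrow> short_edges l \<subseteq> short_edges l'"
  by (fastforce simp: short_edges_def)

lemma short_edges_iff: "{x, y} \<in> short_edges l \<longleftrightarrow> x \<noteq> y \<and> l1norm (x - y) \<le> l"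
proof
  assume "{x, y} \<in> short_edges l"
  then obtain a b where "{x, y} = {a, b}" "a \<noteq> b" "l1norm (a - b) \<le> l" by (auto simp: short_edges_def)
  then show "x \<noteq> y \<and> l1norm (x - y) \<le> l"
    using l1norm_minus_commute[of a b] by (auto simp: doubleton_eq_iff)
qed (auto simp: short_edges_def)

lemma is_path_join:
  assumes "is_path xs a u" "is_path ys v b" "u \<noteq> v"
  shows "is_path (xs @ ys) a b"
    and "path_weight r om (xs @ ys) = path_weight r om xs + edge_weight r om u v + path_weight r om ys"
proof -
  obtain xs' where xs: "xs = xs' @ [u]"
    using is_path_last[OF assms(1)] assms(1) by (metis append_butlast_last_id not_is_path_Nil)
  obtain ys' where ys: "ys = v # ys'"
    using is_path_hd[OF assms(2)] assms(2) by (metis list.collapse not_is_path_Nil)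
  show "is_path (xs @ ys) a b" using is_path_split[of xs' u v ys' a b] assms xs ys by simp
  show "path_weight r om (xs @ ys) = path_weight r om xs + edge_weight r om u v + path_weight r om ys"
    using path_weight_split[of r om xs' u v ys'] xs ys by simp
qed

lemma exists_l1norm_eq: "\<exists>x :: int ^ 'd. l1norm x = int k"
proof -
  obtain i0 :: 'd where True by simp
  have "l1norm (\<chi> i. if i = i0 then int k else 0) = int k"
    unfolding l1norm_def by (simp add: if_distrib[of abs] cong: if_cong)
  then show ?thesis by blast
qed

context lr_percolation begin

text \<open>Ties are broken by an enumeration \<open>g\<close> of the edges, so the cells partition
  the whole space. They depend on the edges in \<open>V\<close> only, which keeps the selection
  independent of everything built from other edges.\<close>

lemma argmin_selection:
  assumes V: "finite V" "V \<noteq> {}"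
  obtains S where "\<And>v. v \<in> V \<Longrightarrow> S v \<in> sets (Fil V)" "disjoint_family_on S V" "(\<Union>v\<in>V. S v) = space M"
    "\<And>v w u. v \<in> V \<Longrightarrow> w \<in> S v \<Longrightarrow> u \<in> V \<Longrightarrow> om v w \<le> om u w"
proof -
  obtain g :: "(int ^ 'd) set \<Rightarrow> nat" where g: "inj_on g V"
    using finite_imp_inj_to_nat_seg[OF V(1)] by blast
  define S where "S v = {w \<in> space M. \<forall>u\<in>V. om v w \<le> om u w \<and> (g u < g v \<longrightarrow> om v w < om u w)}" for v
  show ?thesis
  proof (rule that[of S])
    fix v assume v: "v \<in> V"
    have *: "{w \<in> space (Fil V). om v w \<le> om u w \<and> (g u < g v \<longrightarrow> om v w < om u w)} \<in> sets (Fil V)"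
      if "u \<in> V" for u
    proof -
      note [measurable] = om_Fil[OF that] om_Fil[OF v]
      show ?thesis by measurable
    qed
    have "{w \<in> space (Fil V). \<forall>u\<in>V. om v w \<le> om u w \<and> (g u < g v \<longrightarrow> om v w < om u w)} \<in> sets (Fil V)"
      by (intro sets.sets_Collect_finite_All V(1) *)
    then show "S v \<in> sets (Fil V)" by (simp add: S_def)
  next
    show "disjoint_family_on S V"
      unfolding disjoint_family_on_def
    proof (intro ballI impI equals0I)
      fix u v w assume *: "u \<in> V" "v \<in> V" "u \<noteq> v" "w \<in> S u \<inter> S v"
      then have "g u \<noteq> g v" using g by (auto simp: inj_on_def)
      moreover have "om u w \<le> om v w" "om v w \<le> om u w"
        "g u < g v \<Longrightarrow> om v w < om u w" "g v < g u \<Longrightarrow> om u w < om v w"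
        using * unfolding S_def by blast+
      ultimately show False by linarith
    qed
  next
    show "(\<Union>v\<in>V. S v) = space M"
    proof (intro equalityI subsetI)
      fix w assume w: "w \<in> space M"
      define mu where "mu = Min ((\<lambda>v. om v w) ` V)"
      define C where "C = {v \<in> V. om v w = mu}"
      have "mu \<in> (\<lambda>v. om v w) ` V" unfolding mu_def using V by (intro Min_in) auto
      then have C: "finite C" "C \<noteq> {}" using V by (auto simp: C_def)
      have "Min (g ` C) \<in> g ` C" using C by (intro Min_in) auto
      then obtain v where v: "v \<in> C" "g v = Min (g ` C)" by auto
      have "om v w \<le> om u w \<and> (g u < g v \<longrightarrow> om v w < om u w)" if u: "u \<in> V" for u
      proof -
        have le: "om v w \<le> om u w" using v(1) u V unfolding C_def mu_def by auto
        moreover have "u \<notin> C" if "g u < g v"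
        proof
          assume "u \<in> C"
          then have "Min (g ` C) \<le> g u" using C by (intro Min_le) auto
          then show False using that v(2) by simp
        qed
        then have "om v w < om u w" if "g u < g v"
          using that le u v(1) unfolding C_def by force
        ultimately show ?thesis by blast
      qed
      then have "w \<in> S v" using w by (simp add: S_def)
      then show "w \<in> (\<Union>v\<in>V. S v)" using v(1) by (auto simp: C_def)
    qed (auto simp: S_def)
  qed (auto simp: S_def)
qed

lemma nn_integral_Min:
  assumes V: "finite V" "V \<noteq> {}" "V \<subseteq> lr_edges"
  shows "(\<integral>\<^sup>+w. ennreal (Min ((\<lambda>v. om v w) ` V)) \<partial>M) = ennreal (1 / real (card V))"
proof -
  let ?Y = "\<lambda>w. Min ((\<lambda>v. om v w) ` V)"
  have "distributed M lborel ?Y (exponential_density (\<Sum>v\<in>V. 1))"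
    by (rule exponential_distributed_Min[OF V(1,2) _ _ indep_vars_subset[OF indep V(3)]]) (use expo V in auto)
  then have D: "distributed M lborel ?Y (exponential_density (real (card V)))" by simp
  have l: "0 < real (card V)" using V by (simp add: card_gt_0_iff)
  have "AE w in M. w \<in> good" by (rule AE_good)
  then have nn: "AE w in M. 0 \<le> ?Y w"
  proof eventually_elim
    case (elim w)
    have "0 \<le> om v w" if "v \<in> V" for v using elim that V(3) by (auto simp: good_def intro: less_imp_le)
    then show ?case using V by (subst Min_ge_iff) auto
  qed
  have int: "integrable M ?Y" using erlang_ith_moment_integrable[OF l D, of 1] by simp
  show ?thesis
    unfolding nn_integral_eq_integral[OF int nn] using exponential_distributed_expectation[OF l D] by simp
qed

text \<open>The passage time depends on all edges; the random majorant \<open>X\<close> is used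
  instead because it is local, being measurable with respect to edges of length at most 3 d m. Of
  this length 2 d m is for the distance of the endpoints and d m is room for the displacement by the
  two boxes.\<close>

definition connector :: "nat \<Rightarrow> real \<Rightarrow> bool" where
  "connector m \<tau> \<longleftrightarrow> (\<forall>a b :: int ^ 'd.
     int CARD('d) * int m \<le> l1norm (a - b) \<longrightarrow> l1norm (a - b) \<le> 2 * int CARD('d) * int m \<longrightarrow>
     (\<exists>X :: 'w \<Rightarrow> ennreal. X \<in> borel_measurable (Fil (short_edges (3 * int CARD('d) * int m))) \<and>
        (\<forall>w\<in>good. \<exists>xs. is_path xs a b \<and> ennreal (path_weight r (cfg w) xs) \<le> X w) \<and>
        (\<integral>\<^sup>+w. X w \<partial>M) \<le> ennreal \<tau>))"

lemma connector_mono: "connector m \<tau> \<Longrightarrow> \<tau> \<le> \<tau>' \<Longrightarrow> connector m \<tau>'"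
  unfolding connector_def by (meson ennreal_leI order_trans)

lemma connector_single_edge:
  assumes m: "1 \<le> m"
  shows "connector m (1 / r (2 * CARD('d) * m))"
  unfolding connector_def
proof (intro allI impI)
  fix a b :: "int ^ 'd"
  assume ab: "int CARD('d) * int m \<le> l1norm (a - b)" "l1norm (a - b) \<le> 2 * int CARD('d) * int m"
  have "0 < int CARD('d) * int m" using m by simp
  then have ne: "a \<noteq> b" using ab by auto
  let ?X = "\<lambda>w. ennreal (edge_weight r (cfg w) a b)"
  let ?k = "nat (l1norm (a - b))"
  have e: "{a, b} \<in> short_edges (3 * int CARD('d) * int m)"
    unfolding short_edges_iff using ne ab m by (smt (verit) mult_right_mono of_nat_0_le_iff)
  then have e': "{a, b} \<in> lr_edges" using short_edges_subset by blast
  have [measurable]: "(\<lambda>w. edge_weight r (cfg w) a b) \<in> borel_measurable (Fil (short_edges (3 * int CARD('d) * int m)))"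
    by (rule edge_weight_Fil[OF e])
  have k: "1 \<le> ?k" using l1norm_pos[OF ne] by simp
  have "(\<integral>\<^sup>+w. ?X w \<partial>M) = (\<integral>\<^sup>+w. ennreal (1 / r ?k) * ennreal (Min ((\<lambda>v. om v w) ` {{a, b}})) \<partial>M)"
    using rate_pos[OF k] by (simp add: edge_weight_def ennreal_mult'[symmetric])
  also have "\<dots> = ennreal (1 / r ?k) * (\<integral>\<^sup>+w. ennreal (Min ((\<lambda>v. om v w) ` {{a, b}})) \<partial>M)"
    using om_measurable[OF e'] by (intro nn_integral_cmult) auto
  also have "\<dots> = ennreal (1 / r ?k)"
    using nn_integral_Min[of "{{a, b}}"] e' by simp
  also have "\<dots> \<le> ennreal (1 / r (2 * CARD('d) * m))"
  proof (intro ennreal_leI divide_left_mono)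
    have "?k \<le> 2 * CARD('d) * m" using ab(2) by (simp add: nat_le_iff)
    then show "r (2 * CARD('d) * m) \<le> r ?k" by (rule rate_antimono[OF k])
    show "0 < r ?k * r (2 * CARD('d) * m)" using k m by (intro mult_pos_pos rate_pos) auto
  qed simp
  finally have E: "(\<integral>\<^sup>+w. ?X w \<partial>M) \<le> ennreal (1 / r (2 * CARD('d) * m))" .
  have "\<exists>xs. is_path xs a b \<and> ennreal (path_weight r (cfg w) xs) \<le> ?X w" for w
    using ne by (intro exI[of _ "[a, b]"]) (simp add: is_path_Cons2)
  then show "\<exists>X :: 'w \<Rightarrow> ennreal. X \<in> borel_measurable (Fil (short_edges (3 * int CARD('d) * int m))) \<and>
        (\<forall>w\<in>good. \<exists>xs. is_path xs a b \<and> ennreal (path_weight r (cfg w) xs) \<le> X w) \<and>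
        (\<integral>\<^sup>+w. X w \<partial>M) \<le> ennreal (1 / r (2 * CARD('d) * m))"
    using E by (intro exI[of _ ?X]) auto
qed

text \<open>Among the edges joining the two boxes of side \<open>n\<close> near the endpoints, take the one with the
  smallest exponential variable. These edges are longer than all edges used by the
  connectors at scale \<open>n\<close>, so the choice is independent of the latter.\<close>

lemma connector_step:
  assumes n: "1 \<le> n" "4 * n < m" and \<tau>: "0 \<le> \<tau>" and con: "connector n \<tau>"
  shows "connector m (2 * \<tau> + 1 / ((real n + 1) ^ (2 * CARD('d)) * r (3 * CARD('d) * m)))"
  unfolding connector_def
proof (intro allI impI)
  let ?d = "int CARD('d)"
  have d: "0 < ?d" by simp
  fix a b :: "int ^ 'd"
  assume ab: "?d * int m \<le> l1norm (a - b)" "l1norm (a - b) \<le> 2 * ?d * int m"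
  define P where "P = (offset_box n :: (int ^ 'd) set) \<times> (offset_box n :: (int ^ 'd) set)"
  define e where "e p = {a + fst p, b + snd p}" for p :: "(int ^ 'd) \<times> (int ^ 'd)"
  have P: "finite P" by (simp add: P_def finite_offset_box)
  have cardP: "card P = (n + 1) ^ (2 * CARD('d))"
    by (simp add: P_def card_cartesian_product card_offset_box power_add[symmetric] mult_2)
  have Pne: "P \<noteq> {}" using cardP by auto
  have dn: "?d * int n \<ge> 1" using n d by (simp add: less_le_trans mult_le_cancel_left1 int_one_le_iff_zero_less)
  have dm: "4 * (?d * int n) < ?d * int m"
    using mult_strict_left_mono[of "4 * int n" "int m" ?d] n d by simp
  \<comment> \<open>The displacement changes the length by at most d n. Since 4 n < m, what remains
    exceeds 3 d n, so no candidate edge is used by the connectors at scale n.\<close>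
  have len: "3 * ?d * int n < l1norm (a + y - (b + z)) \<and> l1norm (a + y - (b + z)) \<le> 3 * ?d * int m"
    if "y \<in> offset_box n" "z \<in> offset_box n" for y z :: "int ^ 'd"
  proof -
    have 1: "l1norm (y - z) \<le> ?d * int n" by (rule l1norm_offset_diff[OF that])
    have eq: "a + y - (b + z) = (a - b) + (y - z)" "a - b = (a + y - (b + z)) + (z - y)" by simp_all
    have 2: "l1norm (a + y - (b + z)) \<le> l1norm (a - b) + l1norm (y - z)"
      unfolding eq(1) by (rule l1norm_add_le)
    have 3: "l1norm (a - b) \<le> l1norm (a + y - (b + z)) + l1norm (z - y)"
      by (subst eq(2)) (rule l1norm_add_le)
    show ?thesis unfolding mult.assoc
      using 1 2 3 ab[unfolded mult.assoc] dm l1norm_minus_commute[of y z] by (intro conjI; linarith)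
  qed
  have ne: "a + y \<noteq> b + z" if "y \<in> offset_box n" "z \<in> offset_box n" for y z :: "int ^ 'd"
  proof -
    have "0 < l1norm (a + y - (b + z))" using len[OF that, unfolded mult.assoc] dn by linarith
    then show ?thesis by auto
  qed
  have inj: "inj_on e P"
  proof (rule inj_onI)
    fix p q assume pq: "p \<in> P" "q \<in> P" "e p = e q"
    have "a + fst p \<noteq> b + snd q" using pq ne by (auto simp: P_def)
    then show "p = q" using pq(3) by (auto simp: e_def doubleton_eq_iff prod_eq_iff)
  qed
  let ?L = "short_edges (3 * ?d * int n) :: (int ^ 'd) set set"
  let ?L' = "short_edges (3 * ?d * int m) :: (int ^ 'd) set set"
  define V where "V = e ` P"
  have V: "finite V" "V \<noteq> {}" using P Pne by (auto simp: V_def)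
  have cardV: "card V = (n + 1) ^ (2 * CARD('d))" using card_image[OF inj] cardP by (simp add: V_def)
  have VL: "V \<subseteq> ?L'" "V \<inter> ?L = {}"
    using len ne unfolding V_def e_def P_def by (auto simp: short_edges_iff) (meson not_le)+
  have V_lr: "V \<subseteq> lr_edges" using VL(1) short_edges_subset by blast
  have LL: "?L \<subseteq> ?L'" using dm d by (intro short_edges_mono) simp
  obtain S where S: "\<And>v. v \<in> V \<Longrightarrow> S v \<in> sets (Fil V)" "disjoint_family_on S V" "(\<Union>v\<in>V. S v) = space M"
    "\<And>v w u. v \<in> V \<Longrightarrow> w \<in> S v \<Longrightarrow> u \<in> V \<Longrightarrow> om v w \<le> om u w"
    using argmin_selection[OF V] by metis
  have "\<exists>X :: 'w \<Rightarrow> ennreal. X \<in> borel_measurable (Fil ?L) \<and>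
        (\<forall>w\<in>good. \<exists>xs. is_path xs a (a + y) \<and> ennreal (path_weight r (cfg w) xs) \<le> X w) \<and>
        (\<integral>\<^sup>+w. X w \<partial>M) \<le> ennreal \<tau>" if "y \<in> offset_box n" for y
    using con[unfolded connector_def, rule_format, of a "a + y"] l1norm_offset_box[OF that] by simp
  then obtain X1 where X1: "\<And>y. y \<in> offset_box n \<Longrightarrow> X1 y \<in> borel_measurable (Fil ?L)"
    "\<And>y w. y \<in> offset_box n \<Longrightarrow> w \<in> good \<Longrightarrow> \<exists>xs. is_path xs a (a + y) \<and> ennreal (path_weight r (cfg w) xs) \<le> X1 y w"
    "\<And>y. y \<in> offset_box n \<Longrightarrow> (\<integral>\<^sup>+w. X1 y w \<partial>M) \<le> ennreal \<tau>"
    by metis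
  have "\<exists>X :: 'w \<Rightarrow> ennreal. X \<in> borel_measurable (Fil ?L) \<and>
        (\<forall>w\<in>good. \<exists>xs. is_path xs (b + z) b \<and> ennreal (path_weight r (cfg w) xs) \<le> X w) \<and>
        (\<integral>\<^sup>+w. X w \<partial>M) \<le> ennreal \<tau>" if "z \<in> offset_box n" for z
    using con[unfolded connector_def, rule_format, of "b + z" b] l1norm_offset_box[OF that] by simp
  then obtain X2 where X2: "\<And>z. z \<in> offset_box n \<Longrightarrow> X2 z \<in> borel_measurable (Fil ?L)"
    "\<And>z w. z \<in> offset_box n \<Longrightarrow> w \<in> good \<Longrightarrow> \<exists>xs. is_path xs (b + z) b \<and> ennreal (path_weight r (cfg w) xs) \<le> X2 z w"
    "\<And>z. z \<in> offset_box n \<Longrightarrow> (\<integral>\<^sup>+w. X2 z w \<partial>M) \<le> ennreal \<tau>"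
    by metis
  \<comment> \<open>The smallest rate a candidate edge can have. Dividing by it bounds every edge
    weight in terms of its exponential variable, and the variables, unlike the weights, are
    identically distributed.\<close>
  define \<rho> where "\<rho> = r (3 * CARD('d) * m)"
  have \<rho>: "0 < \<rho>" unfolding \<rho>_def using n by (intro rate_pos) simp
  let ?a = "\<lambda>p w. indicator (S (e p)) w * ennreal (om (e p) w / \<rho>)"
  let ?b = "\<lambda>p w. indicator (S (e p)) w * X1 (fst p) w" and ?c = "\<lambda>p w. indicator (S (e p)) w * X2 (snd p) w"
  \<comment> \<open>In each configuration exactly one \<open>p\<close> is selected, so the sum has a
    single active summand: the cheap edge and the two connectors that lead to its endpoints.\<close>
  define X where "X w = (\<Sum>p\<in>P. ?a p w + (?b p w + ?c p w))" for w
  have Sp: "S (e p) \<in> sets (Fil V)" "S (e p) \<in> sets M" "e p \<in> V" "e p \<in> lr_edges" if "p \<in> P" for p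
    using S(1)[of "e p"] that sets_Fil_subset[OF V_lr] V_lr by (auto simp: V_def)
  have XM: "X1 (fst p) \<in> borel_measurable (Fil ?L)" "X2 (snd p) \<in> borel_measurable (Fil ?L)"
    "X1 (fst p) \<in> borel_measurable M" "X2 (snd p) \<in> borel_measurable M" if "p \<in> P" for p
  proof -
    show 1: "X1 (fst p) \<in> borel_measurable (Fil ?L)" and 2: "X2 (snd p) \<in> borel_measurable (Fil ?L)"
      using X1(1) X2(1) that by (auto simp: P_def)
    show "X1 (fst p) \<in> borel_measurable M" "X2 (snd p) \<in> borel_measurable M"
      using measurable_Fil_M[OF 1 short_edges_subset] measurable_Fil_M[OF 2 short_edges_subset] .
  qed
  have "X \<in> borel_measurable (Fil ?L')"
    unfolding X_def
  proof (intro borel_measurable_sum)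
    fix p assume p: "p \<in> P"
    note [measurable] = measurable_Fil_mono[OF XM(1)[OF p] LL] measurable_Fil_mono[OF XM(2)[OF p] LL]
    have [measurable]: "S (e p) \<in> sets (Fil ?L')" using Sp(1)[OF p] sets_Fil_mono[OF VL(1)] by blast
    have [measurable]: "om (e p) \<in> borel_measurable (Fil ?L')" using Sp(3)[OF p] VL(1) by (intro om_Fil) auto
    show "(\<lambda>w. ?a p w + (?b p w + ?c p w)) \<in> borel_measurable (Fil ?L')"
      by measurable
  qed
  moreover have "\<exists>xs. is_path xs a b \<and> ennreal (path_weight r (cfg w) xs) \<le> X w" if w: "w \<in> good" for w
  proof -
    interpret positive_weights r "cfg w" by (rule good_positive_weights[OF w])
    have "w \<in> (\<Union>v\<in>V. S v)" unfolding S(3) using w by (simp add: good_def)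
    then obtain p where p: "p \<in> P" "w \<in> S (e p)" by (auto simp: V_def)
    have bx: "fst p \<in> offset_box n" "snd p \<in> offset_box n" using p by (auto simp: P_def)
    obtain xs where xs: "is_path xs a (a + fst p)" "ennreal (path_weight r (cfg w) xs) \<le> X1 (fst p) w"
      using X1(2)[OF bx(1) w] by auto
    obtain ys where ys: "is_path ys (b + snd p) b" "ennreal (path_weight r (cfg w) ys) \<le> X2 (snd p) w"
      using X2(2)[OF bx(2) w] by auto
    note j = is_path_join[OF xs(1) ys(1) ne[OF bx]]
    let ?k = "nat (l1norm (a + fst p - (b + snd p)))"
    have k: "1 \<le> ?k" "?k \<le> 3 * CARD('d) * m" using len[OF bx] dn by (auto simp: nat_le_iff)
    have om: "0 \<le> om (e p) w" using Sp(4)[OF p(1)] w by (auto simp: good_def intro: less_imp_le)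
    have "edge_weight r (cfg w) (a + fst p) (b + snd p) = om (e p) w / r ?k" by (simp add: edge_weight_def e_def)
    also have "\<dots> \<le> om (e p) w / \<rho>"
    proof (rule divide_left_mono)
      show "\<rho> \<le> r ?k" unfolding \<rho>_def by (rule rate_antimono[OF k])
      show "0 < r ?k * \<rho>" using rate_pos[OF k(1)] \<rho> by simp
    qed (rule om)
    finally have ew: "edge_weight r (cfg w) (a + fst p) (b + snd p) \<le> om (e p) w / \<rho>" .
    have "ennreal (path_weight r (cfg w) (xs @ ys)) = ennreal (path_weight r (cfg w) xs) +
        ennreal (edge_weight r (cfg w) (a + fst p) (b + snd p)) + ennreal (path_weight r (cfg w) ys)"
      unfolding j(2) using path_weight_nonneg[OF xs(1)] path_weight_nonneg[OF ys(1)] edge_weight_pos[OF ne[OF bx]]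
      by (simp add: ennreal_plus)
    also have "\<dots> \<le> X1 (fst p) w + ennreal (om (e p) w / \<rho>) + X2 (snd p) w"
      by (intro add_mono xs ys ennreal_leI ew)
    also have "\<dots> = ?a p w + (?b p w + ?c p w)"
      using p by (simp add: ac_simps)
    also have "\<dots> \<le> X w" unfolding X_def using P p(1) by (intro member_le_sum) auto
    finally show ?thesis using j(1) by blast
  qed
  moreover have "(\<integral>\<^sup>+w. X w \<partial>M) \<le> ennreal (2 * \<tau> + 1 / ((real n + 1) ^ (2 * CARD('d)) * \<rho>))"
  proof -
    have I1: "(\<Sum>p\<in>P. \<integral>\<^sup>+w. ?a p w \<partial>M)
        \<le> ennreal (1 / ((real n + 1) ^ (2 * CARD('d)) * \<rho>))"
    proof -
      have "(\<Sum>p\<in>P. \<integral>\<^sup>+w. ?a p w \<partial>M)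
          = (\<integral>\<^sup>+w. (\<Sum>p\<in>P. ?a p w) \<partial>M)"
      proof (rule nn_integral_sum[symmetric])
        fix p assume p: "p \<in> P"
        note [measurable] = Sp(2)[OF p] om_measurable[OF Sp(4)[OF p]]
        show "(\<lambda>w. ?a p w) \<in> borel_measurable M" by measurable
      qed
      also have "\<dots> = (\<integral>\<^sup>+w. ennreal (1 / \<rho>) * ennreal (Min ((\<lambda>v. om v w) ` V)) \<partial>M)"
      proof (rule nn_integral_cong)
        fix w assume "w \<in> space M"
        then obtain q where q: "q \<in> P" "w \<in> S (e q)" unfolding S(3)[symmetric] by (auto simp: V_def)
        have "w \<notin> S (e p)" if "p \<in> P" "p \<noteq> q" for p
        proof
          assume "w \<in> S (e p)"
          moreover have "e p \<noteq> e q" using inj that q(1) by (auto simp: inj_on_def)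
          ultimately show False using S(2) q that Sp(3) unfolding disjoint_family_on_def by blast
        qed
        then have "(\<Sum>p\<in>P. ?a p w) =
            (\<Sum>p\<in>P. if p = q then ennreal (om (e q) w / \<rho>) else 0)"
          using q by (intro sum.cong) auto
        also have "\<dots> = ennreal (om (e q) w / \<rho>)" using P q by simp
        also have "om (e q) w = Min ((\<lambda>v. om v w) ` V)"
          using V S(4)[OF Sp(3)[OF q(1)] q(2)] Sp(3)[OF q(1)] by (intro Min_eqI[symmetric]) auto
        finally show "(\<Sum>p\<in>P. ?a p w) =
            ennreal (1 / \<rho>) * ennreal (Min ((\<lambda>v. om v w) ` V))"
          using \<rho> by (simp add: ennreal_mult'[symmetric])
      qed
      also have "\<dots> = ennreal (1 / \<rho>) * (\<integral>\<^sup>+w. ennreal (Min ((\<lambda>v. om v w) ` V)) \<partial>M)"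
      proof (rule nn_integral_cmult)
        have "(\<lambda>w. Min ((\<lambda>v. om v w) ` V)) \<in> borel_measurable M"
          using V V_lr om_measurable by (intro borel_measurable_Min) auto
        then show "(\<lambda>w. ennreal (Min ((\<lambda>v. om v w) ` V))) \<in> borel_measurable M" by measurable
      qed
      also have "\<dots> = ennreal (1 / ((real n + 1) ^ (2 * CARD('d)) * \<rho>))"
        unfolding nn_integral_Min[OF V V_lr] cardV using \<rho> by (simp add: ennreal_mult'[symmetric] add.commute)
      finally show ?thesis by simp
    qed
    have prS: "(\<Sum>p\<in>P. emeasure M (S (e p))) = 1"
    proof -
      have "(\<Sum>p\<in>P. emeasure M (S (e p))) = (\<Sum>v\<in>V. emeasure M (S v))"
        unfolding V_def by (simp add: sum.reindex[OF inj])
      also have "\<dots> = emeasure M (\<Union>v\<in>V. S v)"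
        using S(1) sets_Fil_subset[OF V_lr] by (intro sum_emeasure S(2) V) auto
      finally show ?thesis unfolding S(3) by (simp add: emeasure_space_1)
    qed
    \<comment> \<open>The selection is independent of the connectors, so each of them keeps its mean
      bound \<tau> on the cell; as the cells have total mass 1, the random choice of connectors
      costs nothing in expectation.\<close>
    have ind: "(\<integral>\<^sup>+w. indicator (S (e p)) w * Y w \<partial>M) \<le> emeasure M (S (e p)) * ennreal \<tau>"
      if p: "p \<in> P" and Y: "Y \<in> borel_measurable (Fil ?L)" "(\<integral>\<^sup>+w. Y w \<partial>M) \<le> ennreal \<tau>" for p and Y :: "'w \<Rightarrow> ennreal"
    proof -
      have "(\<integral>\<^sup>+w. indicator (S (e p)) w * Y w \<partial>M) = (\<integral>\<^sup>+w. indicator (S (e p)) w \<partial>M) * (\<integral>\<^sup>+w. Y w \<partial>M)"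
        by (rule Fil_nn_integral_mult[OF V_lr short_edges_subset VL(2) _ Y(1)])
          (rule borel_measurable_indicator[OF Sp(1)[OF p]])
      also have "\<dots> \<le> emeasure M (S (e p)) * ennreal \<tau>"
        using Sp(2)[OF p] Y(2) by (simp add: mult_left_mono)
      finally show ?thesis .
    qed
    have sumP: "(\<Sum>p\<in>P. emeasure M (S (e p)) * ennreal \<tau>) = ennreal \<tau>"
      unfolding sum_distrib_right[symmetric] prS by simp
    have I2: "(\<Sum>p\<in>P. \<integral>\<^sup>+w. ?b p w \<partial>M) \<le> ennreal \<tau>"
      by (rule order_trans[OF sum_mono[OF ind] sumP[THEN eq_refl]]) (use XM X1(3) in \<open>auto simp: P_def\<close>)
    have I3: "(\<Sum>p\<in>P. \<integral>\<^sup>+w. ?c p w \<partial>M) \<le> ennreal \<tau>"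
      by (rule order_trans[OF sum_mono[OF ind] sumP[THEN eq_refl]]) (use XM X2(3) in \<open>auto simp: P_def\<close>)
    have "(\<integral>\<^sup>+w. X w \<partial>M) = (\<Sum>p\<in>P. \<integral>\<^sup>+w. ?a p w + (?b p w + ?c p w) \<partial>M)"
      unfolding X_def
    proof (rule nn_integral_sum)
      fix p assume p: "p \<in> P"
      note [measurable] = XM(3,4)[OF p] Sp(2)[OF p] om_measurable[OF Sp(4)[OF p]]
      show "(\<lambda>w. ?a p w + (?b p w + ?c p w)) \<in> borel_measurable M" by measurable
    qed
    also have "\<dots> = (\<Sum>p\<in>P. (\<integral>\<^sup>+w. ?a p w \<partial>M) +
      ((\<integral>\<^sup>+w. ?b p w \<partial>M) + (\<integral>\<^sup>+w. ?c p w \<partial>M)))"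
    proof (rule sum.cong[OF refl])
      fix p assume p: "p \<in> P"
      note [measurable] = XM(3,4)[OF p] Sp(2)[OF p] om_measurable[OF Sp(4)[OF p]]
      have "(\<integral>\<^sup>+w. ?b p w + ?c p w \<partial>M) =
        (\<integral>\<^sup>+w. ?b p w \<partial>M) + (\<integral>\<^sup>+w. ?c p w \<partial>M)"
        by (rule nn_integral_add) measurable
      moreover have "(\<integral>\<^sup>+w. ?a p w + (?b p w + ?c p w) \<partial>M) =
        (\<integral>\<^sup>+w. ?a p w \<partial>M) +
        (\<integral>\<^sup>+w. ?b p w + ?c p w \<partial>M)"
        by (rule nn_integral_add) measurable
      ultimately show "(\<integral>\<^sup>+w. ?a p w + (?b p w + ?c p w) \<partial>M) =
        (\<integral>\<^sup>+w. ?a p w \<partial>M) +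
        ((\<integral>\<^sup>+w. ?b p w \<partial>M) + (\<integral>\<^sup>+w. ?c p w \<partial>M))"
        by (simp only:)
    qed
    also have "\<dots> \<le> ennreal (1 / ((real n + 1) ^ (2 * CARD('d)) * \<rho>)) + (ennreal \<tau> + ennreal \<tau>)"
      unfolding sum.distrib by (intro add_mono I1 I2 I3)
    also have "\<dots> = ennreal (1 / ((real n + 1) ^ (2 * CARD('d)) * \<rho>) + (\<tau> + \<tau>))"
      using \<tau> \<rho> by (simp add: ennreal_plus[symmetric] del: ennreal_plus)
    also have "1 / ((real n + 1) ^ (2 * CARD('d)) * \<rho>) + (\<tau> + \<tau>) = 2 * \<tau> + 1 / ((real n + 1) ^ (2 * CARD('d)) * \<rho>)"
      by linarith
    finally show ?thesis .
  qed
  ultimately show "\<exists>X :: 'w \<Rightarrow> ennreal. X \<in> borel_measurable (Fil ?L') \<and>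
        (\<forall>w\<in>good. \<exists>xs. is_path xs a b \<and> ennreal (path_weight r (cfg w) xs) \<le> X w) \<and>
        (\<integral>\<^sup>+w. X w \<partial>M) \<le> ennreal (2 * \<tau> + 1 / ((real n + 1) ^ (2 * CARD('d)) * r (3 * CARD('d) * m)))"
    unfolding \<rho>_def by blast
qed

text \<open>The scales are n m, about m^\<gamma>, with \<gamma> = 2^(-1/\<kappa>') for an
  intermediate \<Delta> < \<kappa>' < \<kappa>. From \<kappa>' > \<Delta> follows 2 d \<gamma> >
  \<alpha>, so some of the m^(2d\<gamma>) candidate edges is cheap; from \<kappa> > \<kappa>'
  follows 2 \<gamma>^\<kappa> < 1, so doubling is compensated by the decrease of the
  logarithm.\<close>

lemma connector_recursion:
  assumes \<kappa>: "Delta < \<kappa>"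
  obtains m0 :: nat and n :: "nat \<Rightarrow> nat" where "1 \<le> m0"
    "\<And>m. m0 \<le> m \<Longrightarrow> 1 \<le> n m" "\<And>m. m0 \<le> m \<Longrightarrow> 4 * n m < m"
    "\<And>m. m0 \<le> m \<Longrightarrow> 1 / ((real (n m) + 1) ^ (2 * CARD('d)) * r (3 * CARD('d) * m)) \<le> 1"
    "\<And>m. m0 \<le> m \<Longrightarrow> 2 * (1 + ln (real (n m))) powr \<kappa> \<le> (1 + ln (real m)) powr \<kappa>"
proof -
  let ?d = "real CARD('d)"
  have d: "1 \<le> ?d" by (simp add: Suc_le_eq)
  have D: "1 < Delta" by (rule Delta_gt_1)
  define \<kappa>' where "\<kappa>' = (Delta + \<kappa>) / 2"
  have \<kappa>': "Delta < \<kappa>'" "\<kappa>' < \<kappa>" "1 < \<kappa>'" "1 < \<kappa>" using \<kappa> D by (auto simp: \<kappa>'_def)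
  define \<gamma> where "\<gamma> = 2 powr (- (1 / \<kappa>'))"
  have \<gamma>: "0 < \<gamma>" "\<gamma> < 1"
    unfolding \<gamma>_def using \<kappa>' powr_less_mono[of "- (1 / \<kappa>')" 0 2] by auto
  have s\<gamma>: "2 powr (1 / \<kappa>) * \<gamma> < 1"
  proof -
    have "1 / \<kappa> - 1 / \<kappa>' < 0" using \<kappa>' by (simp add: field_simps)
    then have "2 powr (1 / \<kappa> - 1 / \<kappa>') < 2 powr (0::real)" by (intro powr_less_mono) auto
    then show ?thesis by (simp add: \<gamma>_def powr_add[symmetric])
  qed
  have \<alpha>\<gamma>: "\<alpha> < 2 * ?d * \<gamma>"
  proof -
    have "1 / \<kappa>' < 1 / Delta" using \<kappa>' D by (simp add: field_simps)
    then have "2 powr (1 / \<kappa>') < 2 * ?d / \<alpha>" unfolding powr_inverse_Delta[symmetric] by (intro powr_less_mono) auto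
    then show ?thesis using alpha_pos by (simp add: \<gamma>_def powr_minus field_simps)
  qed
  \<comment> \<open>Half of the slack 2 d \<gamma> - \<alpha> is lost in \<open>rate_lower\<close>;
    the other half leaves a factor m^\<eta> that beats the constant \<open>c'\<close>.\<close>
  define \<eta> where "\<eta> = (2 * ?d * \<gamma> - \<alpha>) / 2"
  have \<eta>: "0 < \<eta>" "2 * ?d * \<gamma> = 2 * \<eta> + \<alpha>" using \<alpha>\<gamma> by (auto simp: \<eta>_def field_simps)
  obtain c where c: "c > 0" "\<And>k. k \<ge> 1 \<Longrightarrow> c * real k powr (- \<eta> - \<alpha>) \<le> r k"
    using rate_lower[OF \<eta>(1)] by auto
  define c' where "c' = c * (3 * ?d) powr (- \<eta> - \<alpha>)"
  have c': "0 < c'" using c by (simp add: c'_def)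
  \<comment> \<open>The \<kappa>-th root of 2: it makes the doubling inequality linear in the
    logarithms, with slope s \<gamma> < 1, so the additive constants from rounding are negligible
    for large m.\<close>
  define s where "s = 2 powr (1 / \<kappa>)"
  have s: "0 < s" "s * \<gamma> < 1" using s\<gamma> by (auto simp: s_def)
  have "filterlim (\<lambda>m::nat. real m powr \<eta>) at_top sequentially" using \<eta>(1) by real_asymp
  then have e1: "\<forall>\<^sub>F m::nat in sequentially. 1 / c' \<le> real m powr \<eta>" by (rule filterlim_at_top[THEN iffD1, rule_format])
  have "filterlim (\<lambda>m::nat. ln (real m)) at_top sequentially" by real_asymp
  then have e2: "\<forall>\<^sub>F m::nat in sequentially. (s * (1 + ln 2) - 1) / (1 - s * \<gamma>) \<le> ln (real m)"
    by (rule filterlim_at_top[THEN iffD1, rule_format])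
  have "((\<lambda>m::nat. 4 * (real m powr \<gamma> + 1) / real m) \<longlongrightarrow> 0) sequentially" using \<gamma> by real_asymp
  then have e3: "\<forall>\<^sub>F m::nat in sequentially. 4 * (real m powr \<gamma> + 1) / real m < 1" by (rule order_tendstoD) simp
  from eventually_conj[OF e1 eventually_conj[OF e2 e3]] obtain m1 where m1: "\<And>m. m1 \<le> m \<Longrightarrow>
      1 / c' \<le> real m powr \<eta> \<and> (s * (1 + ln 2) - 1) / (1 - s * \<gamma>) \<le> ln (real m) \<and> 4 * (real m powr \<gamma> + 1) / real m < 1"
    unfolding eventually_sequentially by auto
  define n where "n m = nat \<lceil>real m powr \<gamma>\<rceil>" for m :: nat
  show ?thesis
  proof (rule that[of "max 1 m1" n])
    fix m assume "max 1 m1 \<le> m"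
    then have m: "1 \<le> m" "m1 \<le> m" by auto
    note M = m1[OF m(2)]
    have p1: "1 \<le> real m powr \<gamma>" using m \<gamma> by (intro ge_one_powr_ge_zero) auto
    have n: "real m powr \<gamma> \<le> real (n m)" "real (n m) \<le> real m powr \<gamma> + 1"
      unfolding n_def using p1 by linarith+
    show n1: "1 \<le> n m" using n(1) p1 by linarith
    have "4 * (real m powr \<gamma> + 1) < real m" using M m by (simp add: field_simps)
    then have "4 * real (n m) < real m" using n by argo
    then show "4 * n m < m" by linarith
    show "1 / ((real (n m) + 1) ^ (2 * CARD('d)) * r (3 * CARD('d) * m)) \<le> 1"
    proof -
      have "1 \<le> real m powr \<eta> * c'" using M c' by (simp add: field_simps)
      also have "\<dots> = real m powr (2 * ?d * \<gamma>) * (c * (3 * ?d * real m) powr (- \<eta> - \<alpha>))"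
        using m d unfolding c'_def \<eta>(2) by (simp add: powr_mult powr_add[symmetric] mult_ac)
      also have "\<dots> \<le> (real (n m) + 1) ^ (2 * CARD('d)) * r (3 * CARD('d) * m)"
      proof (intro mult_mono)
        have "real m powr (2 * ?d * \<gamma>) = (real m powr \<gamma>) ^ (2 * CARD('d))"
        proof -
          have "(real m powr \<gamma>) ^ (2 * CARD('d)) = (real m powr \<gamma>) powr real (2 * CARD('d))"
            using m by (intro powr_realpow[symmetric]) auto
          then show ?thesis by (simp add: powr_powr mult_ac)
        qed
        also have "\<dots> \<le> (real (n m) + 1) ^ (2 * CARD('d))" using n p1 by (intro power_mono) auto
        finally show "real m powr (2 * ?d * \<gamma>) \<le> (real (n m) + 1) ^ (2 * CARD('d))" .
        have "1 \<le> 3 * CARD('d) * m" using m by (simp add: Suc_le_eq)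
        from c(2)[OF this] show "c * (3 * ?d * real m) powr (- \<eta> - \<alpha>) \<le> r (3 * CARD('d) * m)" by simp
      qed (use c in auto)
      finally show ?thesis by (simp add: divide_le_eq_1)
    qed
    have lnn: "0 \<le> ln (real (n m))" using n1 by simp
    have "ln (real (n m)) \<le> ln (2 * real m powr \<gamma>)" using n p1 n1 by (intro ln_mono) auto
    also have "\<dots> = ln 2 + \<gamma> * ln (real m)" using m by (simp add: ln_mult ln_powr)
    finally have "s * (1 + ln (real (n m))) \<le> s * (1 + (ln 2 + \<gamma> * ln (real m)))"
      using s by (intro mult_left_mono) auto
    also have "\<dots> \<le> 1 + ln (real m)"
    proof -
      have "s * (1 + ln 2) - 1 \<le> (1 - s * \<gamma>) * ln (real m)" using M s by (simp add: pos_divide_le_eq mult.commute)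
      then show ?thesis by (simp add: algebra_simps)
    qed
    finally have "(s * (1 + ln (real (n m)))) powr \<kappa> \<le> (1 + ln (real m)) powr \<kappa>"
      using s lnn \<kappa>' by (intro powr_mono2) auto
    moreover have "(s * (1 + ln (real (n m)))) powr \<kappa> = 2 * (1 + ln (real (n m))) powr \<kappa>"
      using lnn \<kappa>' by (simp add: s_def powr_mult powr_powr)
    ultimately show "2 * (1 + ln (real (n m))) powr \<kappa> \<le> (1 + ln (real m)) powr \<kappa>" by simp
  qed auto
qed

lemma connector_bound:
  assumes \<kappa>: "Delta < \<kappa>"
  obtains B where "0 \<le> B" "\<And>m. 1 \<le> m \<Longrightarrow> connector m (B * (1 + ln (real m)) powr \<kappa>)"
proof -
  obtain m0 :: nat and n :: "nat \<Rightarrow> nat" where n: "1 \<le> m0"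
    "\<And>m. m0 \<le> m \<Longrightarrow> 1 \<le> n m" "\<And>m. m0 \<le> m \<Longrightarrow> 4 * n m < m"
    "\<And>m. m0 \<le> m \<Longrightarrow> 1 / ((real (n m) + 1) ^ (2 * CARD('d)) * r (3 * CARD('d) * m)) \<le> 1"
    "\<And>m. m0 \<le> m \<Longrightarrow> 2 * (1 + ln (real (n m))) powr \<kappa> \<le> (1 + ln (real m)) powr \<kappa>"
    using connector_recursion[OF \<kappa>] by blast
  have \<kappa>0: "0 < \<kappa>" using \<kappa> Delta_gt_1 by linarith
  define B where "B = 1 + 1 / r (2 * CARD('d) * m0)"
  have "0 < r (2 * CARD('d) * m0)" using n(1) by (intro rate_pos) (simp add: Suc_le_eq)
  then have B: "1 \<le> B" by (simp add: B_def)
  have log1: "1 \<le> (1 + ln (real m)) powr \<kappa>" if "1 \<le> m" for m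
    using that \<kappa>0 by (intro ge_one_powr_ge_zero) auto
  have BL: "B \<le> B * (1 + ln (real m)) powr \<kappa>" if "1 \<le> m" for m
    using mult_left_mono[OF log1[OF that], of B] B by simp
  \<comment> \<open>Subtracting 1 makes the induction close: 2 (x - 1) + 1 = 2 x - 1 absorbs the
    unit cost of the cheap edge. \<open>B\<close> is chosen so that direct edges suffice below
    \<open>m0\<close>.\<close>
  have strong: "connector m (B * (1 + ln (real m)) powr \<kappa> - 1)" if "1 \<le> m" for m
    using that
  proof (induction m rule: less_induct)
    case (less m)
    show ?case
    proof (cases "m0 \<le> m")
      case True
      note N = n(2-5)[OF True]
      have lt: "n m < m" using N(2) by simp
      have "0 \<le> B * (1 + ln (real (n m))) powr \<kappa> - 1" using BL[OF N(1)] B by linarith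
      from connector_step[OF N(1,2) this less.IH[OF lt N(1)]]
      show ?thesis
      proof (rule connector_mono)
        have "B * (2 * (1 + ln (real (n m))) powr \<kappa>) \<le> B * (1 + ln (real m)) powr \<kappa>"
          using N(4) B by (intro mult_left_mono) auto
        then have "2 * (B * (1 + ln (real (n m))) powr \<kappa>) \<le> B * (1 + ln (real m)) powr \<kappa>"
          by (simp only: mult.left_commute[of B 2])
        then show "2 * (B * (1 + ln (real (n m))) powr \<kappa> - 1) +
            1 / ((real (n m) + 1) ^ (2 * CARD('d)) * r (3 * CARD('d) * m)) \<le> B * (1 + ln (real m)) powr \<kappa> - 1"
          using N(3) by argo
      qed
    next
      case False
      show ?thesis
      proof (rule connector_mono[OF connector_single_edge[OF less.prems]])
        have k: "1 \<le> 2 * CARD('d) * m" using less.prems by (simp add: Suc_le_eq)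
        have k2: "2 * CARD('d) * m \<le> 2 * CARD('d) * m0" using False by simp
        have "1 / r (2 * CARD('d) * m) \<le> 1 / r (2 * CARD('d) * m0)"
          using rate_antimono[OF k k2] rate_pos[OF k] rate_pos[OF order_trans[OF k k2]]
          by (intro divide_left_mono mult_pos_pos) auto
        also have "\<dots> = B - 1" by (simp add: B_def)
        also have "\<dots> \<le> B * (1 + ln (real m)) powr \<kappa> - 1" using BL[OF less.prems] by simp
        finally show "1 / r (2 * CARD('d) * m) \<le> B * (1 + ln (real m)) powr \<kappa> - 1" .
      qed
    qed
  qed
  show ?thesis
    by (rule that[of B]) (use B connector_mono[OF strong] in auto)
qed

lemma prob_not_reach_le:
  assumes "0 < s" and X: "X \<in> borel_measurable M" "(\<integral>\<^sup>+w. X w \<partial>M) \<le> ennreal \<tau>" "0 \<le> \<tau>"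
    and path: "\<And>w. w \<in> good \<Longrightarrow> \<exists>xs. is_path xs 0 x \<and> ennreal (path_weight r (cfg w) xs) \<le> X w"
  shows "prob {w \<in> space M. \<not> reach r (cfg w) UNIV 0 x s} \<le> \<tau> / s"
proof -
  let ?A = "{w \<in> space M. \<not> reach r (cfg w) UNIV 0 x s}"
  have A: "?A \<in> sets M" by (intro sets.sets_Collect_neg reach_sets)
  have "AE w in M. ennreal s * indicator ?A w \<le> X w"
    using AE_good
  proof eventually_elim
    case (elim w)
    show ?case
    proof (cases "w \<in> ?A")
      case True
      obtain xs where xs: "is_path xs 0 x" "ennreal (path_weight r (cfg w) xs) \<le> X w" using path[OF elim] by auto
      have "s \<le> path_weight r (cfg w) xs" using True xs(1) by (auto simp: reach_def not_le less_imp_le)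
      then have "ennreal s \<le> X w" using xs(2) by (meson ennreal_leI order_trans)
      then show ?thesis using True by simp
    qed simp
  qed
  then have "(\<integral>\<^sup>+w. ennreal s * indicator ?A w \<partial>M) \<le> (\<integral>\<^sup>+w. X w \<partial>M)" by (rule nn_integral_mono_AE)
  also have "(\<integral>\<^sup>+w. ennreal s * indicator ?A w \<partial>M) = ennreal (s * prob ?A)"
    using A assms(1) by (simp add: nn_integral_cmult_indicator emeasure_eq_measure ennreal_mult')
  finally have "ennreal (s * prob ?A) \<le> ennreal \<tau>" using X(2) by (rule order_trans)
  then have "s * prob ?A \<le> \<tau>" using X(3) by (simp add: ennreal_le_iff)
  then show ?thesis using assms(1) by (simp add: field_simps)
qed

text \<open>Markov's inequality turns the bound on the mean into a probability bound. The means are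
  controlled with an exponent \<open>\<kappa>1\<close> strictly below \<kappa>, so that the quotient
  tends to 0.\<close>

lemma reach_upper:
  assumes \<kappa>: "Delta < \<kappa>" and \<delta>: "0 < \<delta>"
  obtains N where "\<And>x :: int ^ 'd. N \<le> real_of_int (l1norm x) \<Longrightarrow>
    prob {w \<in> space M. \<not> reach r (cfg w) UNIV 0 x (ln (real_of_int (l1norm x)) powr \<kappa>)} \<le> \<delta>"
proof -
  define \<kappa>1 where "\<kappa>1 = (Delta + \<kappa>) / 2"
  have \<kappa>1: "Delta < \<kappa>1" "\<kappa>1 < \<kappa>" using \<kappa> by (auto simp: \<kappa>1_def)
  have pos: "0 < \<kappa>1" using \<kappa>1 Delta_gt_1 by linarith
  obtain B where B: "0 \<le> B" "\<And>m. 1 \<le> m \<Longrightarrow> connector m (B * (1 + ln (real m)) powr \<kappa>1)"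
    using connector_bound[OF \<kappa>1(1)] by metis
  have "((\<lambda>n::real. (1 + ln n) powr \<kappa>1 / ln n powr \<kappa>) \<longlongrightarrow> 0) at_top" using \<kappa>1 pos by real_asymp
  then have "((\<lambda>n::real. B * ((1 + ln n) powr \<kappa>1 / ln n powr \<kappa>)) \<longlongrightarrow> 0) at_top" by (rule tendsto_mult_right_zero)
  then have "\<forall>\<^sub>F n in at_top. B * ((1 + ln n) powr \<kappa>1 / ln n powr \<kappa>) < \<delta>" using \<delta> by (rule order_tendstoD(2))
  then obtain N1 where N1: "\<And>n. N1 \<le> n \<Longrightarrow> B * ((1 + ln n) powr \<kappa>1 / ln n powr \<kappa>) < \<delta>"
    unfolding eventually_at_top_linorder by auto
  show ?thesis
  proof (rule that[of "max N1 (max 2 (real CARD('d)))"])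
    fix x :: "int ^ 'd" assume x: "max N1 (max 2 (real CARD('d))) \<le> real_of_int (l1norm x)"
    let ?n = "real_of_int (l1norm x)"
    have n: "N1 \<le> ?n" "2 \<le> ?n" "real CARD('d) \<le> ?n" using x by auto
    define k where "k = nat (l1norm x)"
    have k: "l1norm x = int k" using l1norm_nonneg[of x] by (simp add: k_def)
    \<comment> \<open>This scale satisfies d m \<le> k \<le> 2 d m once k is at least d, as
      \<open>connector m\<close> requires.\<close>
    define m where "m = k div CARD('d)"
    have dk: "CARD('d) \<le> k" using n(3) k by simp
    then have m: "1 \<le> m" unfolding m_def by (simp add: Suc_le_eq div_greater_zero_iff)
    have "k = CARD('d) * m + k mod CARD('d)" by (simp add: m_def)
    moreover have "k mod CARD('d) < CARD('d)" by simp
    moreover have "CARD('d) \<le> CARD('d) * m" using m by simp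
    ultimately have mk: "CARD('d) * m \<le> k" "k \<le> 2 * CARD('d) * m" by linarith+
    have 1: "int CARD('d) * int m \<le> l1norm (0 - x)" "l1norm (0 - x) \<le> 2 * int CARD('d) * int m"
      using mk by (simp_all add: k) (metis of_nat_le_iff of_nat_mult of_nat_numeral)+
    obtain X where X: "X \<in> borel_measurable (Fil (short_edges (3 * int CARD('d) * int m)))"
      "\<forall>w\<in>good. \<exists>xs. is_path xs 0 x \<and> ennreal (path_weight r (cfg w) xs) \<le> X w"
      "(\<integral>\<^sup>+w. X w \<partial>M) \<le> ennreal (B * (1 + ln (real m)) powr \<kappa>1)"
      using B(2)[OF m] 1 unfolding connector_def by blast
    have s: "0 < ln ?n powr \<kappa>" using n(2) by simp
    have "prob {w \<in> space M. \<not> reach r (cfg w) UNIV 0 x (ln ?n powr \<kappa>)} \<le> (B * (1 + ln (real m)) powr \<kappa>1) / ln ?n powr \<kappa>"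
      by (rule prob_not_reach_le[OF s measurable_Fil_M[OF X(1) short_edges_subset] X(3)]) (use B(1) X(2) in auto)
    also have "\<dots> \<le> (B * (1 + ln ?n) powr \<kappa>1) / ln ?n powr \<kappa>"
    proof (intro divide_right_mono mult_left_mono powr_mono2)
      have "m \<le> k" unfolding m_def by (rule div_le_dividend)
      then show "1 + ln (real m) \<le> 1 + ln ?n" using m k by simp
    qed (use B(1) m pos in auto)
    also have "\<dots> \<le> \<delta>" using N1[OF n(1)] by simp
    finally show "prob {w \<in> space M. \<not> reach r (cfg w) UNIV 0 x (ln ?n powr \<kappa>)} \<le> \<delta>" .
  qed
qed

section \<open>Asymptotics of passage times and diameters\<close>

lemma paths_nonempty: "\<exists>xs :: (int ^ 'd) list. is_path xs x y"
  by (cases "x = y") (auto intro: exI[of _ "[x]"] exI[of _ "[x, y]"] simp: is_path_Cons2)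

lemma passage_time_measurable: "(\<lambda>w. passage_time r (cfg w) x y) \<in> borel_measurable M"
proof -
  have "(\<lambda>w. Inf {path_weight r (cfg w) xs | xs. xs \<in> {xs. is_path xs x y}}) \<in> borel_measurable M"
  proof (rule borel_measurable_Inf_countable)
    show "countable {xs. is_path xs x y}" by (rule countable_subset[OF subset_UNIV]) simp
    show "{xs. is_path xs x y} \<noteq> {}" using paths_nonempty by blast
  qed (use path_weight_measurable in blast)
  then show ?thesis unfolding passage_time_def by simp
qed

lemma fpp_diam_measurable: "(\<lambda>w. fpp_diam r (cfg w) t) \<in> borel_measurable M"
proof -
  note [measurable] = passage_time_measurable
  let ?f = "\<lambda>(x, y). real_of_int (l1norm (x - y :: int ^ 'd))"
  let ?P = "\<lambda>(x, y) w. passage_time r (cfg w) 0 x \<le> t \<and> passage_time r (cfg w) 0 y \<le> t"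
  have "(\<lambda>w. Sup {?f p | p. p \<in> UNIV \<and> ?P p w}) \<in> borel_measurable M"
  proof (rule borel_measurable_Sup_countable)
    fix p :: "(int ^ 'd) \<times> (int ^ 'd)"
    show "{w \<in> space M. ?P p w} \<in> sets M" unfolding case_prod_beta by measurable
  qed simp
  moreover have "{?f p | p. p \<in> UNIV \<and> ?P p w} =
      {real_of_int (l1norm (x - y)) | x y. x \<in> fpp_ball r (cfg w) t \<and> y \<in> fpp_ball r (cfg w) t}" for w
    by (auto simp: fpp_ball_def)
  ultimately show ?thesis unfolding fpp_diam_def by simp
qed

lemma passage_time_le:
  assumes "w \<in> good" "reach r (cfg w) UNIV x y s"
  shows "passage_time r (cfg w) x y \<le> s"
proof -
  interpret positive_weights r "cfg w" by (rule good_positive_weights[OF assms(1)])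
  obtain xs where xs: "is_path xs x y" "path_weight r (cfg w) xs \<le> s" using assms(2) by (auto simp: reach_def)
  have "passage_time r (cfg w) x y \<le> path_weight r (cfg w) xs"
    unfolding passage_time_def
    by (rule cInf_lower) (use xs in \<open>auto intro!: bdd_belowI[of _ 0] path_weight_nonneg\<close>)
  then show ?thesis using xs by linarith
qed

text \<open>Only the weak inequality is available, since the infimum over all paths need not be
  attained.\<close>

lemma passage_time_ge:
  assumes "\<not> reach r (cfg w) UNIV x y s"
  shows "s \<le> passage_time r (cfg w) x y"
  unfolding passage_time_def
proof (rule cInf_greatest)
  show "{path_weight r (cfg w) xs |xs. is_path xs x y} \<noteq> {}" using paths_nonempty by blast
qed (use assms in \<open>auto simp: reach_def not_le less_imp_le\<close>)

lemma prob_ge_of_good: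
  assumes "E \<in> sets M" "B \<in> sets M" "prob B \<le> \<delta>" "\<And>w. w \<in> good \<Longrightarrow> w \<notin> B \<Longrightarrow> w \<in> E"
  shows "1 - \<delta> \<le> prob E"
proof -
  have "prob (space M - E) \<le> prob B"
    by (rule prob_le_of_good) (use assms in auto)
  then show ?thesis using prob_compl[OF assms(1)] assms(3) by linarith
qed

lemma not_reach_sets [measurable]: "{w \<in> space M. \<not> reach r (cfg w) A x y s} \<in> sets M"
  by (intro sets.sets_Collect_neg reach_sets)

lemma passage_time_growth:
  assumes \<epsilon>: "0 < \<epsilon>" and \<delta>: "0 < \<delta>"
  shows "\<exists>N. \<forall>x :: int ^ 'd. real_of_int (l1norm x) \<ge> N \<longrightarrow>
         prob {w \<in> space M.
            Delta - \<epsilon> \<le> ln (passage_time r (cfg w) 0 x) / ln (ln (real_of_int (l1norm x))) \<and>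
            ln (passage_time r (cfg w) 0 x) / ln (ln (real_of_int (l1norm x))) \<le> Delta + \<epsilon>}
         \<ge> 1 - \<delta>"
proof -
  \<comment> \<open>The cap keeps \<Delta> - \<epsilon>' positive, so that its reciprocal \<beta>
    exists and exceeds 1/\<Delta>. With t = (ln n)^(\<Delta> - \<epsilon>') one has exp (t^\<beta>)
    = n, which matches \<open>prob_escape_tendsto_0\<close>.\<close>
  define \<epsilon>' where "\<epsilon>' = min \<epsilon> (Delta / 2)"
  have \<epsilon>': "0 < \<epsilon>'" "\<epsilon>' \<le> \<epsilon>" "0 < Delta - \<epsilon>'" using \<epsilon> Delta_gt_1 by (auto simp: \<epsilon>'_def)
  define \<beta> where "\<beta> = 1 / (Delta - \<epsilon>')"
  have \<beta>: "1 / Delta < \<beta>" using \<epsilon>' Delta_gt_1 unfolding \<beta>_def by (intro divide_strict_left_mono mult_pos_pos) auto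
  have "\<forall>\<^sub>F t in at_top. prob (escape UNIV (exp (t powr \<beta>)) t) < \<delta> / 2"
    by (rule order_tendstoD(2)[OF prob_escape_tendsto_0[OF \<beta>]]) (use \<delta> in simp)
  moreover have "filterlim (\<lambda>n::real. ln n powr (Delta - \<epsilon>')) at_top at_top" using \<epsilon>'(3) by real_asymp
  ultimately have "\<forall>\<^sub>F n::real in at_top. prob (escape UNIV (exp ((ln n powr (Delta - \<epsilon>')) powr \<beta>)) (ln n powr (Delta - \<epsilon>'))) < \<delta> / 2"
    by (rule eventually_compose_filterlim)
  then obtain N1 where N1: "\<And>n::real. N1 \<le> n \<Longrightarrow>
      prob (escape UNIV (exp ((ln n powr (Delta - \<epsilon>')) powr \<beta>)) (ln n powr (Delta - \<epsilon>'))) < \<delta> / 2"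
    unfolding eventually_at_top_linorder by auto
  obtain N2 where N2: "\<And>x :: int ^ 'd. N2 \<le> real_of_int (l1norm x) \<Longrightarrow>
    prob {w \<in> space M. \<not> reach r (cfg w) UNIV 0 x (ln (real_of_int (l1norm x)) powr (Delta + \<epsilon>))} \<le> \<delta> / 2"
    using reach_upper[of "Delta + \<epsilon>" "\<delta> / 2"] \<epsilon> \<delta> by auto
  show ?thesis
  proof (intro exI[of _ "max (exp 2) (max N1 N2)"] allI impI)
    fix x :: "int ^ 'd" assume x: "max (exp 2) (max N1 N2) \<le> real_of_int (l1norm x)"
    define n where "n = real_of_int (l1norm x)"
    have n: "exp 2 \<le> n" "N1 \<le> n" "N2 \<le> n" using x by (auto simp: n_def)
    have "0 < n" using n(1) exp_gt_zero[of "2::real"] by linarith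
    then have ln2: "2 \<le> ln n" using n(1) by (simp add: ln_ge_iff)
    have lln: "0 < ln (ln n)" using ln2 by simp
    have "(ln n powr (Delta - \<epsilon>')) powr \<beta> = ln n"
      using ln2 \<epsilon>'(3) by (simp add: powr_powr \<beta>_def)
    then have en: "exp ((ln n powr (Delta - \<epsilon>')) powr \<beta>) = n" using \<open>0 < n\<close> by simp
    let ?t = "ln n powr (Delta - \<epsilon>')" and ?s = "ln n powr (Delta + \<epsilon>)"
    let ?E = "{w \<in> space M. Delta - \<epsilon> \<le> ln (passage_time r (cfg w) 0 x) / ln (ln n) \<and>
            ln (passage_time r (cfg w) 0 x) / ln (ln n) \<le> Delta + \<epsilon>}"
    let ?B = "escape UNIV n ?t \<union> {w \<in> space M. \<not> reach r (cfg w) UNIV 0 x ?s}"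
    note [measurable] = passage_time_measurable
    have "1 - \<delta> \<le> prob ?E"
    proof (rule prob_ge_of_good)
      show "?E \<in> sets M" by measurable
      show "?B \<in> sets M" by (intro sets.Un escape_sets not_reach_sets)
      have "prob ?B \<le> prob (escape UNIV n ?t) + prob {w \<in> space M. \<not> reach r (cfg w) UNIV 0 x ?s}"
        by (rule measure_Un_le[OF escape_sets not_reach_sets])
      also have "\<dots> \<le> \<delta> / 2 + \<delta> / 2"
        using N1[OF n(2)] N2[of x] n(3) unfolding en n_def[symmetric] by (intro add_mono) auto
      finally show "prob ?B \<le> \<delta>" by simp
      fix w assume w: "w \<in> good" "w \<notin> ?B"
      have wM: "w \<in> space M" using w(1) by (simp add: good_def)
      have up: "passage_time r (cfg w) 0 x \<le> ?s" using w wM by (intro passage_time_le) auto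
      have "\<not> reach r (cfg w) UNIV 0 x ?t" using w(2) wM by (auto simp: escape_def n_def)
      then have low: "?t \<le> passage_time r (cfg w) 0 x" by (rule passage_time_ge)
      have tpos: "0 < ?t" using ln2 by simp
      have "(Delta - \<epsilon>) * ln (ln n) \<le> (Delta - \<epsilon>') * ln (ln n)" using \<epsilon>' lln by (intro mult_right_mono) auto
      also have "\<dots> = ln ?t" using ln2 by (simp add: ln_powr)
      also have "\<dots> \<le> ln (passage_time r (cfg w) 0 x)" using tpos low by (intro ln_mono) auto
      finally have 1: "(Delta - \<epsilon>) * ln (ln n) \<le> ln (passage_time r (cfg w) 0 x)" .
      have "ln (passage_time r (cfg w) 0 x) \<le> ln ?s" using less_le_trans[OF tpos low] up by (intro ln_mono) auto
      also have "\<dots> = (Delta + \<epsilon>) * ln (ln n)" using ln2 by (simp add: ln_powr)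
      finally have 2: "ln (passage_time r (cfg w) 0 x) \<le> (Delta + \<epsilon>) * ln (ln n)" .
      show "w \<in> ?E" using 1 2 lln wM by (simp add: pos_le_divide_eq pos_divide_le_eq)
    qed
    then show "prob {w \<in> space M.
            Delta - \<epsilon> \<le> ln (passage_time r (cfg w) 0 x) / ln (ln (real_of_int (l1norm x))) \<and>
            ln (passage_time r (cfg w) 0 x) / ln (ln (real_of_int (l1norm x))) \<le> Delta + \<epsilon>}
         \<ge> 1 - \<delta>" by (simp add: n_def)
  qed
qed

lemma diameter_growth:
  assumes \<epsilon>: "0 < \<epsilon>" and \<delta>: "0 < \<delta>"
  shows "\<exists>t0. \<forall>t\<ge>t0. prob {w \<in> space M. \<bar>ln (ln (fpp_diam r (cfg w) t)) / ln t - 1 / Delta\<bar> \<le> \<epsilon>} \<ge> 1 - \<delta>"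
proof -
  define l where "l = 1 / Delta"
  have l: "0 < l" using Delta_gt_1 by (simp add: l_def)
  \<comment> \<open>Halving makes the exponents \<open>a\<close> and \<open>b\<close> strictly
    interior to the allowed interval, which leaves room for the factors 1/2 and 2 lost below;
    \<open>a\<close> stays positive.\<close>
  define \<epsilon>' where "\<epsilon>' = min \<epsilon> l / 2"
  have \<epsilon>': "0 < \<epsilon>'" "\<epsilon>' < \<epsilon>" "\<epsilon>' < l" using \<epsilon> l by (auto simp: \<epsilon>'_def)
  define a where "a = l - \<epsilon>'"
  define b where "b = l + \<epsilon>'"
  have a: "0 < a" "a < l" "l - \<epsilon> < a" and b: "0 < b" "l < b" "b < l + \<epsilon>" using \<epsilon>' l by (auto simp: a_def b_def)
  have \<beta>: "1 / Delta < b" using b(2) by (simp add: l_def)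
  have "Delta = 1 / l" by (simp add: l_def)
  moreover have "1 / l < 1 / a" using a l by (intro divide_strict_left_mono mult_pos_pos) auto
  ultimately have \<kappa>: "Delta < 1 / a" by simp
  obtain N where N: "\<And>x :: int ^ 'd. N \<le> real_of_int (l1norm x) \<Longrightarrow>
    prob {w \<in> space M. \<not> reach r (cfg w) UNIV 0 x (ln (real_of_int (l1norm x)) powr (1 / a))} \<le> \<delta> / 2"
    using reach_upper[OF \<kappa>, of "\<delta> / 2"] \<delta> by auto
  have "\<forall>\<^sub>F t in at_top. prob (escape UNIV (exp (t powr b)) t) < \<delta> / 2"
    by (rule order_tendstoD(2)[OF prob_escape_tendsto_0[OF \<beta>]]) (use \<delta> in simp)
  moreover have "filterlim (\<lambda>t::real. t + 1) at_top at_top" by real_asymp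
  \<comment> \<open>A point with passage time at most t may have no path of weight at most t, but it
    has one of weight at most t + 1; hence the shift.\<close>
  ultimately have ev1: "\<forall>\<^sub>F t::real in at_top. prob (escape UNIV (exp ((t + 1) powr b)) (t + 1)) < \<delta> / 2"
    by (rule eventually_compose_filterlim)
  have "filterlim (\<lambda>t::real. t powr a) at_top at_top" using a(1) by real_asymp
  then have ev2: "\<forall>\<^sub>F t::real in at_top. max 4 (ln (N + 1)) \<le> t powr a" by (rule filterlim_at_top[THEN iffD1, rule_format])
  have "((\<lambda>t::real. ln (t powr a / 2) / ln t) \<longlongrightarrow> a) at_top" using a(1) by real_asymp
  then have ev3: "\<forall>\<^sub>F t::real in at_top. l - \<epsilon> < ln (t powr a / 2) / ln t" by (rule order_tendstoD(1)) (rule a(3))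
  have "((\<lambda>t::real. ln (ln 2 + (t + 1) powr b) / ln t) \<longlongrightarrow> b) at_top" using b(1) by real_asymp
  then have ev4: "\<forall>\<^sub>F t::real in at_top. ln (ln 2 + (t + 1) powr b) / ln t < l + \<epsilon>" by (rule order_tendstoD(2)) (rule b(3))
  from eventually_conj[OF ev1 eventually_conj[OF ev2 eventually_conj[OF ev3 eventually_conj[OF ev4 eventually_gt_at_top[of 1]]]]]
  obtain t0 where t0: "\<And>t. t0 \<le> t \<Longrightarrow> prob (escape UNIV (exp ((t + 1) powr b)) (t + 1)) < \<delta> / 2 \<and>
      max 4 (ln (N + 1)) \<le> t powr a \<and> l - \<epsilon> < ln (t powr a / 2) / ln t \<and>
      ln (ln 2 + (t + 1) powr b) / ln t < l + \<epsilon> \<and> 1 < t"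
    unfolding eventually_at_top_linorder by blast
  show ?thesis
  proof (intro exI[of _ t0] allI impI)
    fix t assume "t0 \<le> t"
    note T = t0[OF this]
    have t: "1 < t" using T by blast
    have lnt: "0 < ln t" using t by simp
    define y where "y = t powr a"
    have y: "4 \<le> y" "ln (N + 1) \<le> y" using T by (auto simp: y_def)
    \<comment> \<open>A single lattice point at distance about exp (t^a) witnesses the lower bound:
      its typical passage time is below (ln k)^(1/a) \<le> t because 1/a > \<Delta>. The loss from
      rounding is covered by halving the exponent in \<open>half\<close>.\<close>
    define k where "k = nat \<lfloor>exp y\<rfloor>"
    have k: "real k \<le> exp y" "exp y - 1 \<le> real k" unfolding k_def by (simp, linarith)
    obtain x :: "int ^ 'd" where x: "l1norm x = int k" using exists_l1norm_eq by blast
    have half: "exp (y / 2) \<le> real k"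
    proof -
      have "2 \<le> exp (y / 2)" using exp_ge_add_one_self[of "y / 2"] y(1) by linarith
      then have "exp (y / 2) + 1 \<le> exp (y / 2) * exp (y / 2)"
        using mult_right_mono[of 2 "exp (y / 2)" "exp (y / 2)"] by linarith
      also have "\<dots> = exp y" by (simp add: exp_add[symmetric])
      finally show ?thesis using k(2) by linarith
    qed
    have "1 < exp (y / 2)" using y(1) by simp
    then have k1: "1 < real k" using half by linarith
    have "N \<le> real k"
    proof (cases "N \<le> 0")
      case False
      then have "N + 1 = exp (ln (N + 1))" by simp
      also have "\<dots> \<le> exp y" using y(2) by simp
      finally have "N + 1 \<le> exp y" .
      then show ?thesis using k(2) by linarith
    qed (use k1 in linarith)
    then have reach: "prob {w \<in> space M. \<not> reach r (cfg w) UNIV 0 x (ln (real k) powr (1 / a))} \<le> \<delta> / 2"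
      using N[of x] x by simp
    have "ln (real k) \<le> y" using k(1) k1 ln_mono[of "real k" "exp y"] by simp
    then have "ln (real k) powr (1 / a) \<le> y powr (1 / a)" using a(1) k1 by (intro powr_mono2) auto
    also have "\<dots> = t" using t a(1) by (simp add: y_def powr_powr)
    finally have kt: "ln (real k) powr (1 / a) \<le> t" .
    let ?R = "exp ((t + 1) powr b)"
    let ?E = "{w \<in> space M. \<bar>ln (ln (fpp_diam r (cfg w) t)) / ln t - 1 / Delta\<bar> \<le> \<epsilon>}"
    let ?B = "escape UNIV ?R (t + 1) \<union> {w \<in> space M. \<not> reach r (cfg w) UNIV 0 x (ln (real k) powr (1 / a))}"
    note [measurable] = fpp_diam_measurable
    show "1 - \<delta> \<le> prob ?E"
    proof (rule prob_ge_of_good)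
      show "?E \<in> sets M" by measurable
      show "?B \<in> sets M" by (intro sets.Un escape_sets not_reach_sets)
      have "prob ?B \<le> prob (escape UNIV ?R (t + 1)) + prob {w \<in> space M. \<not> reach r (cfg w) UNIV 0 x (ln (real k) powr (1 / a))}"
        by (rule measure_Un_le[OF escape_sets not_reach_sets])
      also have "\<dots> \<le> \<delta> / 2 + \<delta> / 2" using T reach by (intro add_mono) auto
      finally show "prob ?B \<le> \<delta>" by simp
      fix w assume w: "w \<in> good" "w \<notin> ?B"
      have wM: "w \<in> space M" using w(1) by (simp add: good_def)
      have "passage_time r (cfg w) 0 x \<le> t" using w wM kt by (intro order_trans[OF passage_time_le kt]) auto
      then have xB: "x \<in> fpp_ball r (cfg w) t" by (simp add: fpp_ball_def)
      have "reach r (cfg w) UNIV 0 0 0" unfolding reach_def by (intro exI[of _ "[0]"]) auto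
      then have "passage_time r (cfg w) 0 0 \<le> 0" by (rule passage_time_le[OF w(1)])
      then have zB: "0 \<in> fpp_ball r (cfg w) t" using t by (simp add: fpp_ball_def)
      have far: "real_of_int (l1norm z) < ?R" if z: "z \<in> fpp_ball r (cfg w) t" for z
      proof (rule ccontr)
        assume "\<not> real_of_int (l1norm z) < ?R"
        then have "\<not> reach r (cfg w) UNIV 0 z (t + 1)" using w(2) wM by (auto simp: escape_def not_less)
        then have "t + 1 \<le> passage_time r (cfg w) 0 z" by (rule passage_time_ge)
        then show False using z by (simp add: fpp_ball_def)
      qed
      let ?S = "{real_of_int (l1norm (x - y)) |x y. x \<in> fpp_ball r (cfg w) t \<and> y \<in> fpp_ball r (cfg w) t}"
      \<comment> \<open>This bounds the set of distances, so that its \<open>Sup\<close> is a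
        genuine supremum and not a default value.\<close>
      have le: "s \<le> 2 * ?R" if "s \<in> ?S" for s
      proof -
        obtain u v where uv: "s = real_of_int (l1norm (u - v))" "u \<in> fpp_ball r (cfg w) t" "v \<in> fpp_ball r (cfg w) t"
          using \<open>s \<in> ?S\<close> by blast
        have "l1norm (u - v) \<le> l1norm u + l1norm v" using l1norm_add_le[of u "- v"] by simp
        then have "s \<le> real_of_int (l1norm u) + real_of_int (l1norm v)" unfolding uv(1) by linarith
        then show ?thesis using far[OF uv(2)] far[OF uv(3)] by linarith
      qed
      define D where "D = fpp_diam r (cfg w) t"
      have in_S: "real k \<in> ?S" using xB zB x by (intro CollectI exI[of _ x] exI[of _ 0]) simp
      have D_up: "D \<le> 2 * ?R" unfolding D_def fpp_diam_def by (rule cSup_least) (use in_S le in blast)+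
      have "real k \<le> D" unfolding D_def fpp_diam_def
        by (rule cSup_upper[OF in_S]) (rule bdd_aboveI[of _ "2 * ?R"], rule le)
      then have D_low: "exp (y / 2) \<le> D" using half by linarith
      then have Dpos: "0 < D" by (rule less_le_trans[OF exp_gt_zero])
      have "y / 2 \<le> ln D" using D_low unfolding ln_ge_iff[OF Dpos] .
      then have "ln (y / 2) \<le> ln (ln D)" using y(1) by (intro ln_mono) auto
      then have "ln (y / 2) / ln t \<le> ln (ln D) / ln t" using lnt by (intro divide_right_mono) auto
      then have 1: "l - \<epsilon> \<le> ln (ln D) / ln t" using T by (simp add: y_def)
      have "ln D \<le> ln (2 * ?R)" using D_up Dpos by (intro ln_mono) auto
      also have "\<dots> = ln 2 + (t + 1) powr b" by (simp add: ln_mult)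
      finally have "ln (ln D) \<le> ln (ln 2 + (t + 1) powr b)" using \<open>y / 2 \<le> ln D\<close> y(1) by (intro ln_mono) auto
      then have "ln (ln D) / ln t \<le> ln (ln 2 + (t + 1) powr b) / ln t" using lnt by (intro divide_right_mono) auto
      then have 2: "ln (ln D) / ln t \<le> l + \<epsilon>" using T by linarith
      show "w \<in> ?E" using 1 2 wM by (simp add: l_def[symmetric] D_def[symmetric] abs_le_iff)
    qed
  qed
qed

end

theorem theorem1p3:
  fixes M :: "'w measure" and \<omega> :: "(int ^ 'd::finite) set \<Rightarrow> 'w \<Rightarrow> real"
    and r :: "nat \<Rightarrow> real" and L :: "real \<Rightarrow> real" and \<alpha> \<epsilon> :: real
  assumes "prob_space M"
    and "prob_space.indep_vars M (\<lambda>_. borel) \<omega> lr_edges"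
    and "\<forall>e\<in>lr_edges. distributed M lborel (\<omega> e) (exponential_density 1)"
    and "real CARD('d) < \<alpha>" and "\<alpha> < 2 * real CARD('d)"
    and "slowly_varying L" and "L 1 = 1"
    and "\<forall>k\<ge>1. r k = real k powr (- \<alpha>) * L (real k)"
    and "\<forall>k\<ge>1. 0 \<le> r k"
    and "\<forall>m n. 1 \<le> m \<longrightarrow> m \<le> n \<longrightarrow> r n \<le> r m"
    and "\<epsilon> > 0"
  shows
    "(let \<Delta> = ln 2 / ln (2 * real CARD('d) / \<alpha>) in
      (\<forall>\<delta>>0. \<exists>N. \<forall>x :: int ^ 'd. real_of_int (l1norm x) \<ge> N \<longrightarrow>
         measure M {w \<in> space M.
            \<Delta> - \<epsilon> \<le> ln (passage_time r (\<lambda>e. \<omega> e w) 0 x) / ln (ln (real_of_int (l1norm x))) \<and>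
            ln (passage_time r (\<lambda>e. \<omega> e w) 0 x) / ln (ln (real_of_int (l1norm x))) \<le> \<Delta> + \<epsilon>}
         \<ge> 1 - \<delta>)
      \<and>
      (\<forall>\<delta>>0. \<exists>t0. \<forall>t \<ge> t0.
         measure M {w \<in> space M.
            \<bar>ln (ln (fpp_diam r (\<lambda>e. \<omega> e w) t)) / ln t - 1 / \<Delta>\<bar> \<le> \<epsilon>}
         \<ge> 1 - \<delta>))"
proof -
  interpret prob_space M by fact
  interpret lr_percolation M \<omega> r \<alpha>
  proof unfold_locales
    show "indep_vars (\<lambda>_. borel) \<omega> lr_edges" by fact
    show "distributed M lborel (\<omega> e) (exponential_density 1)" if "e \<in> lr_edges" for e
      using assms(3) that by blast
    show "0 < r k" if "1 \<le> k" for k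
      using assms(6,8) that by (auto simp: slowly_varying_def)
    show "r n \<le> r m" if "1 \<le> m" "m \<le> n" for m n using assms(10) that by blast
    show "real CARD('d) < \<alpha>" "\<alpha> < 2 * real CARD('d)" by fact+
    show "\<exists>C>0. \<forall>k\<ge>1. r k \<le> C * real k powr (\<eta> - \<alpha>)" if "0 < \<eta>" for \<eta>
      by (rule slowly_varying_rate_bounds(1)[OF assms(6,8,10) that])
    show "\<exists>c>0. \<forall>k\<ge>1. c * real k powr (- \<eta> - \<alpha>) \<le> r k" if "0 < \<eta>" for \<eta>
      by (rule slowly_varying_rate_bounds(2)[OF assms(6,8,10) that])
  qed
  show ?thesis
    unfolding Let_def Delta_def[symmetric]
    using passage_time_growth[OF assms(11)] diameter_growth[OF assms(11)] by blast
qed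

end
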